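(* Up to isomorphism there is precisely one simple (finite-dimensional, complex) Lie algebra of the third kind (LATKe), namely $\mathfrak{L}_3$. It is four-dimensional; it corresponds to the singularity $\mathbb{C}^3/\mathbb{Z}_3$; its Lie algebra $\mathfrak{g}_{\mathfrak{L}_3}$ is $\mathfrak{so}_4\simeq\mathfrak{sl}_2\times\mathfrak{sl}_2$; and its Dynkin diagram consists of one node. Its commutators are given, in a basis $\{H_1,H_2,X,Y\}$, by $$[H_1,H_2,X]=X,\quad [H_1,H_2,Y]=-Y,\quad [H_1,X,Y]=H_2,\quad [H_2,X,Y]=H_1,$$ or, in another basis $\{e_1,e_2,e_3,e_4\}$, by $$[e_1,e_2,e_3]=-e_4,\quad [e_1,e_2,e_4]=e_3,\quad [e_1,e_3,e_4]=-e_2,\quad [e_2,e_3,e_4]=e_1,$$ all other commutators being determined by trilinearity and total antisymmetry. The two bases are related by $X=\frac{1}{\sqrt2}(e_1+ie_4)$, $Y=\frac{1}{\sqrt2}(e_1-ie_4)$, $H_1=-ie_2$, $H_2=e_3$.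
   Context: A Lie algebra of the third kind (LATKe) is a vector space $\mathfrak{L}$ (here finite-dimensional over $\mathbb{C}$) with a trilinear totally antisymmetric map (commutator) $[\cdot,\cdot,\cdot]:\Lambda^3\mathfrak{L}\to\mathfrak{L}$ satisfying, for all $X,Y,Z_1,Z_2,Z_3\in\mathfrak{L}$, $$[X,Y,[Z_1,Z_2,Z_3]]=[[X,Y,Z_1],Z_2,Z_3]+[Z_1,[X,Y,Z_2],Z_3]+[Z_1,Z_2,[X,Y,Z_3]].$$ Isomorphisms are linear bijections preserving the commutator. A subalgebra is a subspace closed under the commutator. An ideal is a subalgebra $\mathcal{I}$ with $[\mathfrak{L},\mathfrak{L},\mathcal{I}]\subset\mathcal{I}$. $\mathfrak{L}$ is abelian if its commutator is identically zero, and simple if it is non-abelian and its only ideals are $0$ and $\mathfrak{L}$. For $X,Y\in\mathfrak{L}$ let $\mathrm{ad}(X\wedge Y):\mathfrak{L}\to\mathfrak{L}$, $Z\mapsto[X,Y,Z]$. The Lie algebra $\mathfrak{g}_{\mathfrak{L}}$ of $\mathfrak{L}$ is the space of inner derivations of $\mathfrak{L}$, i.e. the linear span of all operators $\mathrm{ad}(X\wedge Y)$, with bracket $[D_1,D_2]=D_1D_2-D_2D_1$. A Cartan subalgebra $\mathfrak{h}_{\mathfrak{L}}$ of $\mathfrak{L}$ is a maximal commuting subalgebra such that $\Lambda^2\mathfrak{h}_{\mathfrak{L}}$ acts diagonally on $\mathfrak{L}$ via $H_1\wedge H_2: X\mapsto[H_1,H_2,X]$. A root of $\mathfrak{L}$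 is a (nonzero) element $\alpha\in(\Lambda^2\mathfrak{h}_{\mathfrak{L}})^*$ occurring as a weight of this action, i.e. there is $X\neq0$ in $\mathfrak{L}$ with $[H_1,H_2,X]=\alpha(H_1\wedge H_2)X$ for all $H_1,H_2\in\mathfrak{h}_{\mathfrak{L}}$. Positive and simple roots are defined by choosing a direction in $(\Lambda^2\mathfrak{h}_{\mathfrak{L}})^*$ and ordering the roots, as for ordinary Lie algebras. The Dynkin diagram of $\mathfrak{L}$ is a graph with one vertex for each simple positive root. The singularity $\mathbb{C}^3/\mathbb{Z}_3$ is the one at the origin of the quotient of $\mathbb{C}^3$ by the action $(x,y,z)\mapsto(\epsilon x,\epsilon y,\epsilon z)$ of a generator $\epsilon$ of $\mathbb{Z}_3$, $\epsilon^3=1$. The exceptional divisor of its blow-up is a single $\mathbb{P}^2$. "Corresponds to" is meant in analogy with the Du Val–Artin correspondence between singularities $\mathbb{C}^2/\Gamma$ ($\Gamma\subset SU(2)$ finite) and ADE Lie algebras, in which components of the exceptional divisor correspond to nodes of the Dynkin diagram (simple positive roots): here the single component $\mathbb{P}^2$ of the exceptional divisor corresponds to the single node of the Dynkin diagram of $\mathfrak{L}_3$, i.e. to its single simple positive root. *)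

theory Defs
  imports "HOL-Analysis.Analysis" "HOL-Library.Function_Algebras"
begin

section \<open>Lie algebras of the third kind\<close>

locale latke = vector_space scale
  for scale :: "complex \<Rightarrow> 'a::ab_group_add \<Rightarrow> 'a" +
  fixes br :: "'a \<Rightarrow> 'a \<Rightarrow> 'a \<Rightarrow> 'a"
  assumes linear1: "Vector_Spaces.linear scale scale (\<lambda>x. br x y z)"
    and linear2: "Vector_Spaces.linear scale scale (\<lambda>y. br x y z)"
    and linear3: "Vector_Spaces.linear scale scale (\<lambda>z. br x y z)"
    and antisym12: "br y x z = - br x y z"
    and antisym23: "br x z y = - br x y z"
    and derivation: "br x y (br z1 z2 z3) =
          br (br x y z1) z2 z3 + br z1 (br x y z2) z3 + br z1 z2 (br x y z3)"
begin

definition subalgebra :: "'a set \<Rightarrow> bool" where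
  "subalgebra S \<longleftrightarrow> subspace S \<and> (\<forall>x\<in>S. \<forall>y\<in>S. \<forall>z\<in>S. br x y z \<in> S)"

definition ideal :: "'a set \<Rightarrow> bool" where
  "ideal I \<longleftrightarrow> subalgebra I \<and> (\<forall>x y. \<forall>z\<in>I. br x y z \<in> I)"

definition abelian :: bool where
  "abelian \<longleftrightarrow> (\<forall>x y z. br x y z = 0)"

definition simple :: bool where
  "simple \<longleftrightarrow> \<not> abelian \<and> (\<forall>I. ideal I \<longrightarrow> I = {0} \<or> I = UNIV)"

definition ad :: "'a \<Rightarrow> 'a \<Rightarrow> 'a \<Rightarrow> 'a" where
  "ad x y = (\<lambda>z. br x y z)"

text \<open>The span is taken in the space of all functions, with pointwise operations.\<close>

definition inner_derivations :: "('a \<Rightarrow> 'a) set" where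
  "inner_derivations =
     module.span (\<lambda>c D z. scale c (D z)) {ad x y | x y. True}"

subsection \<open>Cartan subalgebras, roots and the Dynkin diagram\<close>

definition commuting :: "'a set \<Rightarrow> bool" where
  "commuting S \<longleftrightarrow> (\<forall>x\<in>S. \<forall>y\<in>S. \<forall>z\<in>S. br x y z = 0)"

definition acts_diagonally :: "'a set \<Rightarrow> bool" where
  "acts_diagonally \<hh> \<longleftrightarrow>
     (\<exists>B. independent B \<and> span B = UNIV \<and>
        (\<forall>b\<in>B. \<forall>h1\<in>\<hh>. \<forall>h2\<in>\<hh>. \<exists>c. ad h1 h2 b = scale c b))"

definition cartan_subalgebra :: "'a set \<Rightarrow> bool" where
  "cartan_subalgebra \<hh> \<longleftrightarrow>
     subalgebra \<hh> \<and> commuting \<hh> \<and>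
     (\<forall>\<kk>. subalgebra \<kk> \<and> commuting \<kk> \<and> \<hh> \<subseteq> \<kk> \<longrightarrow> \<kk> = \<hh>) \<and>
     acts_diagonally \<hh>"

text \<open>The dual of the exterior square of \<open>\<hh>\<close>, as the space of alternating bilinear forms on
  \<open>\<hh>\<close>: the value of a functional at \<open>h1 \<and> h2\<close> is \<open>\<alpha> h1 h2\<close>. Forms are extended by zero
  outside \<open>\<hh>\<close>, so that equal functionals are equal functions.\<close>

definition alt_forms :: "'a set \<Rightarrow> ('a \<Rightarrow> 'a \<Rightarrow> complex) set" where
  "alt_forms \<hh> = {\<alpha>.
     (\<forall>x y. x \<notin> \<hh> \<or> y \<notin> \<hh> \<longrightarrow> \<alpha> x y = 0) \<and>
     (\<forall>x\<in>\<hh>. \<alpha> x x = 0) \<and>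
     (\<forall>x\<in>\<hh>. \<forall>y\<in>\<hh>. \<forall>z\<in>\<hh>. \<alpha> (x + y) z = \<alpha> x z + \<alpha> y z \<and> \<alpha> z (x + y) = \<alpha> z x + \<alpha> z y) \<and>
     (\<forall>c. \<forall>x\<in>\<hh>. \<forall>y\<in>\<hh>. \<alpha> (scale c x) y = c * \<alpha> x y \<and> \<alpha> x (scale c y) = c * \<alpha> x y)}"

definition roots :: "'a set \<Rightarrow> ('a \<Rightarrow> 'a \<Rightarrow> complex) set" where
  "roots \<hh> = {\<alpha> \<in> alt_forms \<hh>. \<alpha> \<noteq> 0 \<and>
     (\<exists>X. X \<noteq> 0 \<and> (\<forall>h1\<in>\<hh>. \<forall>h2\<in>\<hh>. br h1 h2 X = scale (\<alpha> h1 h2) X))}"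

text \<open>A direction in the space of forms is given by the real-linear height function it defines
  (the projection onto the direction); it must not be orthogonal to any root.\<close>

definition direction :: "'a set \<Rightarrow> (('a \<Rightarrow> 'a \<Rightarrow> complex) \<Rightarrow> real) \<Rightarrow> bool" where
  "direction \<hh> l \<longleftrightarrow>
     (\<forall>\<alpha>\<in>alt_forms \<hh>. \<forall>\<beta>\<in>alt_forms \<hh>. l (\<alpha> + \<beta>) = l \<alpha> + l \<beta>) \<and>
     (\<forall>r. \<forall>\<alpha>\<in>alt_forms \<hh>. l (\<lambda>x y. complex_of_real r * \<alpha> x y) = r * l \<alpha>) \<and>
     (\<forall>\<alpha>\<in>roots \<hh>. l \<alpha> \<noteq> 0)"

definition positive_roots ::
  "'a set \<Rightarrow> (('a \<Rightarrow> 'a \<Rightarrow> complex) \<Rightarrow> real) \<Rightarrow> ('a \<Rightarrow> 'a \<Rightarrow> complex) set" where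
  "positive_roots \<hh> l = {\<alpha> \<in> roots \<hh>. l \<alpha> > 0}"

definition simple_roots ::
  "'a set \<Rightarrow> (('a \<Rightarrow> 'a \<Rightarrow> complex) \<Rightarrow> real) \<Rightarrow> ('a \<Rightarrow> 'a \<Rightarrow> complex) set" where
  "simple_roots \<hh> l = {\<alpha> \<in> positive_roots \<hh> l.
     \<not> (\<exists>\<beta>\<in>positive_roots \<hh> l. \<exists>\<gamma>\<in>positive_roots \<hh> l. \<alpha> = \<beta> + \<gamma>)}"

definition dynkin_nodes ::
  "'a set \<Rightarrow> (('a \<Rightarrow> 'a \<Rightarrow> complex) \<Rightarrow> real) \<Rightarrow> ('a \<Rightarrow> 'a \<Rightarrow> complex) set" where
  "dynkin_nodes \<hh> l = simple_roots \<hh> l"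

end

definition latke_isomorphic ::
  "(complex \<Rightarrow> 'a::ab_group_add \<Rightarrow> 'a) \<Rightarrow> ('a \<Rightarrow> 'a \<Rightarrow> 'a \<Rightarrow> 'a) \<Rightarrow>
   (complex \<Rightarrow> 'b::ab_group_add \<Rightarrow> 'b) \<Rightarrow> ('b \<Rightarrow> 'b \<Rightarrow> 'b \<Rightarrow> 'b) \<Rightarrow> bool" where
  "latke_isomorphic sc br sc' br' \<longleftrightarrow>
     (\<exists>f. Vector_Spaces.linear sc sc' f \<and> bij f \<and>
        (\<forall>x y z. f (br x y z) = br' (f x) (f y) (f z)))"

section \<open>The algebra on four generators\<close>

definition L3_e :: "4 \<Rightarrow> complex^4" where
  "L3_e i = axis i 1"

definition minor3 :: "complex^4 \<Rightarrow> complex^4 \<Rightarrow> complex^4 \<Rightarrow> 4 \<Rightarrow> 4 \<Rightarrow> 4 \<Rightarrow> complex" where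
  "minor3 x y z i j k =
     x$i * (y$j * z$k - y$k * z$j) - x$j * (y$i * z$k - y$k * z$i) + x$k * (y$i * z$j - y$j * z$i)"

text \<open>The trilinear totally antisymmetric extension of the commutators of the \<open>L3_e i\<close>.\<close>

definition L3 :: "complex^4 \<Rightarrow> complex^4 \<Rightarrow> complex^4 \<Rightarrow> complex^4" where
  "L3 x y z = minor3 x y z 2 3 4 *s L3_e 1 - minor3 x y z 1 3 4 *s L3_e 2
            + minor3 x y z 1 2 4 *s L3_e 3 - minor3 x y z 1 2 3 *s L3_e 4"

definition L3_H1 :: "complex^4" where "L3_H1 = (- \<i>) *s L3_e 2"
definition L3_H2 :: "complex^4" where "L3_H2 = L3_e 3"
definition L3_X :: "complex^4" where "L3_X = complex_of_real (1 / sqrt 2) *s (L3_e 1 + \<i> *s L3_e 4)"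
definition L3_Y :: "complex^4" where "L3_Y = complex_of_real (1 / sqrt 2) *s (L3_e 1 - \<i> *s L3_e 4)"

section \<open>Lie algebras on a subspace of an ambient space\<close>

locale lie_algebra = vector_space scale
  for scale :: "complex \<Rightarrow> 'a::ab_group_add \<Rightarrow> 'a" +
  fixes S :: "'a set" and br :: "'a \<Rightarrow> 'a \<Rightarrow> 'a"
  assumes subspace: "subspace S"
    and closed: "\<lbrakk>x \<in> S; y \<in> S\<rbrakk> \<Longrightarrow> br x y \<in> S"
    and add_left: "\<lbrakk>x \<in> S; y \<in> S; z \<in> S\<rbrakk> \<Longrightarrow> br (x + y) z = br x z + br y z"
    and add_right: "\<lbrakk>x \<in> S; y \<in> S; z \<in> S\<rbrakk> \<Longrightarrow> br z (x + y) = br z x + br z y"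
    and scale_left: "\<lbrakk>x \<in> S; y \<in> S\<rbrakk> \<Longrightarrow> br (scale c x) y = scale c (br x y)"
    and scale_right: "\<lbrakk>x \<in> S; y \<in> S\<rbrakk> \<Longrightarrow> br x (scale c y) = scale c (br x y)"
    and alternating: "x \<in> S \<Longrightarrow> br x x = 0"
    and jacobi: "\<lbrakk>x \<in> S; y \<in> S; z \<in> S\<rbrakk> \<Longrightarrow>
          br x (br y z) + br y (br z x) + br z (br x y) = 0"

definition lie_isomorphic ::
  "(complex \<Rightarrow> 'a::ab_group_add \<Rightarrow> 'a) \<Rightarrow> 'a set \<Rightarrow> ('a \<Rightarrow> 'a \<Rightarrow> 'a) \<Rightarrow>
   (complex \<Rightarrow> 'b::ab_group_add \<Rightarrow> 'b) \<Rightarrow> 'b set \<Rightarrow> ('b \<Rightarrow> 'b \<Rightarrow> 'b) \<Rightarrow> bool" where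
  "lie_isomorphic sc S br sc' T br' \<longleftrightarrow>
     lie_algebra sc S br \<and> lie_algebra sc' T br' \<and>
     (\<exists>f. bij_betw f S T \<and>
        (\<forall>x\<in>S. \<forall>y\<in>S. f (x + y) = f x + f y) \<and>
        (\<forall>c. \<forall>x\<in>S. f (sc c x) = sc' c (f x)) \<and>
        (\<forall>x\<in>S. \<forall>y\<in>S. f (br x y) = br' (f x) (f y)))"

definition op_scale :: "complex \<Rightarrow> ('a \<Rightarrow> complex^'n) \<Rightarrow> 'a \<Rightarrow> complex^'n" where
  "op_scale c D = (\<lambda>z. c *s D z)"

definition op_comm :: "('a::ab_group_add \<Rightarrow> 'a) \<Rightarrow> ('a \<Rightarrow> 'a) \<Rightarrow> 'a \<Rightarrow> 'a" where
  "op_comm D E = (\<lambda>z. D (E z) - E (D z))"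

definition mat_scale :: "complex \<Rightarrow> complex^'n^'n \<Rightarrow> complex^'n^'n" where
  "mat_scale c A = (\<chi> i j. c * A$i$j)"

definition mat_comm :: "complex^'n^'n \<Rightarrow> complex^'n^'n \<Rightarrow> complex^'n^'n" where
  "mat_comm A B = A ** B - B ** A"

definition so4 :: "(complex^4^4) set" where
  "so4 = {A. transpose A = - A}"

definition sl2 :: "(complex^2^2) set" where
  "sl2 = {A. trace A = 0}"

definition pair_scale :: "complex \<Rightarrow> (complex^2^2) \<times> (complex^2^2) \<Rightarrow> (complex^2^2) \<times> (complex^2^2)" where
  "pair_scale c p = (mat_scale c (fst p), mat_scale c (snd p))"

definition pair_comm ::
  "(complex^2^2) \<times> (complex^2^2) \<Rightarrow> (complex^2^2) \<times> (complex^2^2) \<Rightarrow> (complex^2^2) \<times> (complex^2^2)" where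
  "pair_comm p q = (mat_comm (fst p) (fst q), mat_comm (snd p) (snd q))"

section \<open>Blow-up of an affine variety at the origin\<close>

text \<open>The algebra of functions generated by \<open>F\<close>.\<close>

inductive_set alg_gen :: "('b \<Rightarrow> complex) set \<Rightarrow> ('b \<Rightarrow> complex) set"
  for F :: "('b \<Rightarrow> complex) set" where
  const: "(\<lambda>_. c) \<in> alg_gen F"
| gen: "f \<in> F \<Longrightarrow> f \<in> alg_gen F"
| add: "\<lbrakk>f \<in> alg_gen F; g \<in> alg_gen F\<rbrakk> \<Longrightarrow> (\<lambda>x. f x + g x) \<in> alg_gen F"
| mult: "\<lbrakk>f \<in> alg_gen F; g \<in> alg_gen F\<rbrakk> \<Longrightarrow> (\<lambda>x. f x * g x) \<in> alg_gen F"

definition polys :: "((complex^'n) \<Rightarrow> complex) set" where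
  "polys = alg_gen (range (\<lambda>i x. x$i))"

definition polys2 :: "((complex^'n) \<times> (complex^'m) \<Rightarrow> complex) set" where
  "polys2 = alg_gen (range (\<lambda>i p. fst p $ i) \<union> range (\<lambda>i p. snd p $ i))"

definition hom_polys :: "nat \<Rightarrow> ((complex^'n) \<Rightarrow> complex) set" where
  "hom_polys d = {f \<in> polys. \<forall>c x. f (c *s x) = c ^ d * f x}"

text \<open>Points of projective space are lines through the origin.\<close>

definition proj_pt :: "complex^'n \<Rightarrow> (complex^'n) set" where
  "proj_pt v = vec.span {v}"

definition proj_space :: "(complex^'n) set set" where
  "proj_space = {proj_pt v | v. v \<noteq> 0}"

definition proj_closed :: "(complex^'n) set set \<Rightarrow> bool" where
  "proj_closed Z \<longleftrightarrow>
     (\<exists>F \<subseteq> (\<Union>d. hom_polys d). Z = {L \<in> proj_space. \<forall>f\<in>F. \<forall>x\<in>L. f x = 0})"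

definition proj_irreducible :: "(complex^'n) set set \<Rightarrow> bool" where
  "proj_irreducible Z \<longleftrightarrow> Z \<noteq> {} \<and>
     (\<forall>A B. proj_closed A \<and> proj_closed B \<and> Z \<subseteq> A \<union> B \<longrightarrow> Z \<subseteq> A \<or> Z \<subseteq> B)"

definition irreducible_components :: "(complex^'n) set set \<Rightarrow> (complex^'n) set set set" where
  "irreducible_components E = {Z. Z \<subseteq> E \<and> proj_irreducible Z \<and>
     (\<forall>W. W \<subseteq> E \<and> proj_irreducible W \<and> Z \<subseteq> W \<longrightarrow> W = Z)}"

text \<open>Regular maps are given locally by tuples of homogeneous polynomials of equal degree
  without common zero.\<close>

definition proj_regular ::
  "(complex^'n) set set \<Rightarrow> ((complex^'n) set \<Rightarrow> (complex^'m) set) \<Rightarrow> bool" where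
  "proj_regular S f \<longleftrightarrow>
     (\<forall>L\<in>S. \<exists>d G. (\<forall>i. (\<lambda>x. G x $ i) \<in> hom_polys d) \<and> (\<exists>x\<in>L. G x \<noteq> 0) \<and>
        (\<forall>M\<in>S. \<forall>x\<in>M. G x \<noteq> 0 \<longrightarrow> f M = proj_pt (G x)))"

definition proj_isomorphic :: "(complex^'n) set set \<Rightarrow> (complex^'m) set set \<Rightarrow> bool" where
  "proj_isomorphic S T \<longleftrightarrow>
     (\<exists>f. bij_betw f S T \<and> proj_regular S f \<and> proj_regular T (inv_into S f))"

text \<open>The blow-up of \<open>V\<close> at the origin is the Zariski closure of \<open>{(x, [x]) | x \<in> V, x \<noteq> 0}\<close> in
  affine space times projective space, and its exceptional divisor is the fibre over \<open>0\<close>. Points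
  \<open>(x, [v])\<close> are represented by the pairs \<open>(x, v)\<close> with \<open>v \<noteq> 0\<close>. All polynomials in \<open>(x, v)\<close> may
  be used in place of those homogeneous in \<open>v\<close>: the set of pairs \<open>(x, t *s x)\<close> is invariant under
  scaling of the second component, so the homogeneous parts of a polynomial vanishing on it
  also vanish on it.\<close>

definition blow_up :: "(complex^'n) set \<Rightarrow> ((complex^'n) \<times> (complex^'n)) set" where
  "blow_up V = {p. snd p \<noteq> 0 \<and>
     (\<forall>f\<in>polys2. (\<forall>x\<in>V. \<forall>t. x \<noteq> 0 \<and> t \<noteq> 0 \<longrightarrow> f (x, t *s x) = 0) \<longrightarrow> f p = 0)}"

definition exceptional_divisor :: "(complex^'n) set \<Rightarrow> (complex^'n) set set" where
  "exceptional_divisor V = {proj_pt v | v. (0, v) \<in> blow_up V}"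

section \<open>The quotient of affine space by a cyclic group of scalars\<close>

text \<open>\<open>\<pi>\<close> realises the quotient of affine space by the group generated by \<open>x \<mapsto> \<epsilon> *s x\<close> as the
  affine variety \<open>range \<pi>\<close>: its coordinates generate the ring of invariant polynomials, and its
  fibres are the orbits.\<close>

definition quotient_map_by :: "complex \<Rightarrow> (complex^'n \<Rightarrow> complex^'m) \<Rightarrow> bool" where
  "quotient_map_by \<epsilon> \<pi> \<longleftrightarrow>
     {f \<in> polys. \<forall>x. f (\<epsilon> *s x) = f x} = alg_gen (range (\<lambda>i x. \<pi> x $ i)) \<and>
     (\<forall>x y. \<pi> x = \<pi> y \<longleftrightarrow> (\<exists>k::nat. y = \<epsilon> ^ k *s x))"

text \<open>All cubic monomials, listed with repetitions.\<close>

definition cubics :: "complex^3 \<Rightarrow> complex^(3 \<times> 3 \<times> 3)" where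
  "cubics x = (\<chi> m. x $ fst m * x $ fst (snd m) * x $ snd (snd m))"

definition C3_mod_Z3 :: "(complex^(3 \<times> 3 \<times> 3)) set" where
  "C3_mod_Z3 = range cubics"

end

theory Submission
  imports Defs "HOL-Computational_Algebra.Fundamental_Theorem_Algebra"
begin

text \<open>For uniqueness, let \<open>V\<close> be simple and let \<open>G\<close> be the Lie algebra of all its derivations, which acts
  irreducibly. If \<open>x \<in> G\<close> has generalised eigenvalues \<open>c\<close>, then for every additive \<open>\<phi>\<close> the operator with
  eigenvalues \<open>\<phi> c\<close> on the same spaces is again a derivation. Taking for \<open>\<phi>\<close> the complex conjugation, an
  element \<open>x\<close> of the radical of the trace form satisfies \<open>\<Sum>\<bar>c\<bar>\<^sup>2 = 0\<close>, so it is nilpotent, and by Engel's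
  theorem the radical vanishes. It follows that the centraliser \<open>T\<close> of a generic diagonalisable
  derivation is a torus, and that \<open>G\<close> has root vectors with \<open>\<ss>\<ll>\<^sub>2\<close>-triples.

  Now choose weight vectors \<open>x\<close>, \<open>y\<close> of opposite weights \<open>\<sigma>\<close>, \<open>-\<sigma>\<close> such that \<open>k = [x, y, \<cdot>]\<close> does not vanish,
  and \<open>z\<close> of weight \<open>\<tau>\<close> with \<open>k z = c z\<close>, \<open>c \<noteq> 0\<close>. Then \<open>[z, x, \<cdot>]\<close> is a root vector for \<open>\<tau> + \<sigma>\<close>; by
  \<open>\<ss>\<ll>\<^sub>2\<close>-theory \<open>x\<close> and \<open>z\<close> lie in doublets, and with \<open>u = f x\<close> the vectors \<open>x, y, z, u\<close> span a copy of
  the four-dimensional algebra. Total antisymmetry forces every other weight vector to be killed by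
  this copy, which is therefore an ideal.

  For a Cartan subalgebra of the four-dimensional algebra, spanned by \<open>a\<close> and \<open>b\<close>, the skew operator
  \<open>A = [a, b, \<cdot>]\<close> satisfies \<open>A\<^sup>3 = \<delta> A\<close>, so the roots are two opposite forms. The exceptional divisor is
  the image of the cubic Veronese embedding of the projective plane.\<close>

text \<open>The conjugation argument needs operators that are derivations without being visibly
  inner: all that is known of \<open>fc x cnj\<close> is that brackets add eigenvalues. Hence
  \<open>der\<close> contains all derivations. Inner ones enter where antisymmetry gives
  information: \<open>ad z x\<close> kills \<open>z\<close> and \<open>x\<close>, so both are
  highest weight vectors of its sl2. Their weights are naturals with sum 2, and excluding (2, 0) and
  (0, 2) leaves two doublets. Genericity of \<open>t\<close> is made combinatorial: \<open>t\<close>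
  maximises the number of differences of its eigenvalues, and these differences are the amounts by
  which an operator can shift eigenvalues. That \<open>T\<close> is a torus then rests on the
  observation that nilpotency is a linear condition on \<open>T\<close>. No root system is
  classified. Weights of coroots are real, so the trace form is definite on differences of coroots,
  and coroots with matching traces coincide. Weight vectors outside the block are handled by going
  to the extreme of the spectrum of \<open>ad x y\<close>, where raising operators must
  vanish.\<close>

locale fd_space = finite_dimensional_vector_space scale Basis
  for scale :: "complex \<Rightarrow> 'a::ab_group_add \<Rightarrow> 'a" (infixr "\<cdot>" 75) and Basis :: "'a set"
begin

section \<open>Linear operators on a finite-dimensional complex space\<close>

abbreviation lin :: "('a \<Rightarrow> 'a) \<Rightarrow> bool" where
  "lin \<equiv> Vector_Spaces.linear scale scale"

lemma lin_iff: "lin f \<longleftrightarrow> (\<forall>x y. f (x + y) = f x + f y) \<and> (\<forall>c x. f (c \<cdot> x) = c \<cdot> f x)"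
  using vector_space_axioms by (auto simp: Vector_Spaces.linear_iff)

lemma lin_add: "lin f \<Longrightarrow> f (x + y) = f x + f y"
  and lin_scale: "lin f \<Longrightarrow> f (c \<cdot> x) = c \<cdot> f x"
  by (auto simp: lin_iff)

lemma lin_zero: "lin f \<Longrightarrow> f 0 = 0"
  using lin_scale[of f 0 0] by simp

lemma lin_minus: "lin f \<Longrightarrow> f (- x) = - f x"
  using lin_scale[of f "-1" x] by simp

lemma lin_diff: "lin f \<Longrightarrow> f (x - y) = f x - f y"
  using lin_add[of f x "- y"] lin_minus[of f y] by simp

lemma lin_sum: "lin f \<Longrightarrow> f (sum g A) = (\<Sum>a\<in>A. f (g a))"
  by (induction A rule: infinite_finite_induct) (auto simp: lin_zero lin_add)

lemmas lin_simps = lin_add lin_scale lin_zero lin_minus lin_diff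

lemma lin_comp: "\<lbrakk>lin f; lin g\<rbrakk> \<Longrightarrow> lin (\<lambda>v. f (g v))"
  and lin_plus: "\<lbrakk>lin f; lin g\<rbrakk> \<Longrightarrow> lin (\<lambda>v. f v + g v)"
  and lin_sub: "\<lbrakk>lin f; lin g\<rbrakk> \<Longrightarrow> lin (\<lambda>v. f v - g v)"
  and lin_smult: "lin f \<Longrightarrow> lin (\<lambda>v. c \<cdot> f v)"
  and lin_const0: "lin (\<lambda>v. 0)"
  and lin_ident: "lin (\<lambda>v. v)"
  and lin_scalar: "lin (\<lambda>v. c \<cdot> v)"
  by (auto simp: lin_iff scale_right_distrib scale_right_diff_distrib mult.commute)

lemma lin_comm: "\<lbrakk>lin f; lin g\<rbrakk> \<Longrightarrow> lin (op_comm f g)"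
  unfolding op_comm_def by (rule lin_sub; rule lin_comp)

lemma lin_sum_fun: "(\<And>a. a \<in> A \<Longrightarrow> lin (g a)) \<Longrightarrow> lin (\<lambda>v. \<Sum>a\<in>A. g a v)"
  by (induction A rule: infinite_finite_induct) (auto intro: lin_const0 lin_plus)

lemma lin_funpow: "lin f \<Longrightarrow> lin (f ^^ n)"
  by (induction n) (auto simp: lin_iff)

lemma lin_eq_on_span:
  assumes "lin f" "lin g" "span S = UNIV" "\<And>s. s \<in> S \<Longrightarrow> f s = g s"
  shows "f = g"
proof
  fix v
  have "v \<in> span S" using assms by auto
  then show "f v = g v"
    by (induction rule: span_induct_alt) (use assms in \<open>auto simp: lin_simps\<close>)
qed

lemma basis_of_spanning:
  assumes "span S = UNIV"
  obtains B where "B \<subseteq> S" "independent B" "span B = UNIV" "finite B"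
proof -
  obtain B where B: "B \<subseteq> S" "independent B" "S \<subseteq> span B"
    using maximal_independent_subset by blast
  then have "span B = UNIV"
    using assms span_mono[of S "span B"] by (auto simp: span_span)
  with B show ?thesis using that finiteI_independent by blast
qed

subsection \<open>Trace\<close>

definition trace_on :: "'a set \<Rightarrow> ('a \<Rightarrow> 'a) \<Rightarrow> complex" where
  "trace_on B f = (\<Sum>b\<in>B. representation B (f b) b)"

abbreviation tr :: "('a \<Rightarrow> 'a) \<Rightarrow> complex" where "tr \<equiv> trace_on Basis"

lemma expand_basis:
  assumes "independent B" "span B = UNIV"
  shows "(\<Sum>b\<in>B. representation B v b \<cdot> b) = v"
  using sum_representation_eq[OF assms(1), of v B] assms finiteI_independent by auto

lemma representation_sum_UNIV:
  assumes "independent B" "span B = UNIV"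
  shows "representation B (sum g A) b = (\<Sum>a\<in>A. representation B (g a) b)"
  using representation_sum[OF assms(1), of A g] assms by auto

text \<open>With two different bases, one computation yields both independence of the basis
  (\<open>g\<close> the identity) and cyclicity of the trace.\<close>

lemma trace_comp_swap:
  assumes B: "independent B" "span B = UNIV" and C: "independent C" "span C = UNIV"
    and f: "lin f" and g: "lin g"
  shows "trace_on B (\<lambda>v. f (g v)) = trace_on C (\<lambda>v. g (f v))"
proof -
  have "trace_on B (\<lambda>v. f (g v)) = (\<Sum>b\<in>B. representation B (f (\<Sum>c\<in>C. representation C (g b) c \<cdot> c)) b)"
    unfolding trace_on_def by (simp add: expand_basis[OF C])
  also have "\<dots> = (\<Sum>b\<in>B. \<Sum>c\<in>C. representation C (g b) c * representation B (f c) b)"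
    using B by (simp add: lin_sum[OF f] representation_sum_UNIV[OF B] lin_scale[OF f] representation_scale)
  also have "\<dots> = (\<Sum>c\<in>C. \<Sum>b\<in>B. representation B (f c) b * representation C (g b) c)"
    by (subst sum.swap) (simp add: mult.commute)
  also have "\<dots> = (\<Sum>c\<in>C. representation C (g (\<Sum>b\<in>B. representation B (f c) b \<cdot> b)) c)"
    using C by (simp add: lin_sum[OF g] representation_sum_UNIV[OF C] lin_scale[OF g] representation_scale)
  also have "\<dots> = trace_on C (\<lambda>v. g (f v))"
    unfolding trace_on_def by (simp add: expand_basis[OF B])
  finally show ?thesis .
qed

lemma tr_on_basis: "\<lbrakk>independent B; span B = UNIV; lin f\<rbrakk> \<Longrightarrow> tr f = trace_on B f"
  using trace_comp_swap[OF independent_Basis span_Basis, of B f "\<lambda>v. v"] by (simp add: lin_ident)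

lemma tr_commute: "\<lbrakk>lin f; lin g\<rbrakk> \<Longrightarrow> tr (\<lambda>v. f (g v)) = tr (\<lambda>v. g (f v))"
  by (rule trace_comp_swap) (auto simp: independent_Basis span_Basis)

lemma tr_add: "tr (\<lambda>v. f v + g v) = tr f + tr g"
  by (simp add: trace_on_def representation_add independent_Basis span_Basis sum.distrib)

lemma tr_scale: "tr (\<lambda>v. c \<cdot> f v) = c * tr f"
  by (simp add: trace_on_def representation_scale independent_Basis span_Basis sum_distrib_left)

lemma tr_zero [simp]: "tr (\<lambda>v. 0) = 0"
  using tr_scale[of 0 "\<lambda>v. v"] by simp

lemma tr_diff: "tr (\<lambda>v. f v - g v) = tr f - tr g"
  using tr_add[of f "\<lambda>v. (-1) \<cdot> g v"] tr_scale[of "-1" g] by simp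

lemma tr_eigenbasis:
  assumes B: "independent B" "span B = UNIV" and "lin f" and eig: "\<And>b. b \<in> B \<Longrightarrow> f b = c b \<cdot> b"
  shows "tr f = (\<Sum>b\<in>B. c b)"
proof -
  have "tr f = trace_on B f" by (rule tr_on_basis[OF B assms(3)])
  also have "\<dots> = (\<Sum>b\<in>B. c b)"
    unfolding trace_on_def
    using B by (intro sum.cong) (auto simp: eig representation_scale representation_basis span_base)
  finally show ?thesis .
qed

lemma tr_comm_mult:
  assumes "lin x" "lin y" "lin z"
  shows "tr (\<lambda>v. op_comm x y (z v)) = tr (\<lambda>v. x (op_comm y z v))"
proof -
  have "tr (\<lambda>v. op_comm x y (z v)) = tr (\<lambda>v. x (y (z v))) - tr (\<lambda>v. y (x (z v)))"
    by (simp add: op_comm_def tr_diff)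
  also have "tr (\<lambda>v. y (x (z v))) = tr (\<lambda>v. x (z (y v)))"
    using tr_commute[of y "\<lambda>v. x (z v)"] assms by (simp add: lin_comp)
  also have "tr (\<lambda>v. x (y (z v))) - \<dots> = tr (\<lambda>v. x (op_comm y z v))"
    using assms by (simp add: op_comm_def tr_diff lin_diff)
  finally show ?thesis .
qed

subsection \<open>Nilpotent operators\<close>

definition nilp :: "('a \<Rightarrow> 'a) \<Rightarrow> bool" where
  "nilp f \<longleftrightarrow> (\<forall>v. \<exists>n. (f ^^ n) v = 0)"

lemma funpow_zero_mono:
  assumes "lin f" "(f ^^ n) v = 0" "n \<le> m" shows "(f ^^ m) v = 0"
proof -
  obtain k where "m = k + n" using assms(3) le_Suc_ex by (metis add.commute)
  then show ?thesis using assms lin_zero[OF lin_funpow] by (simp add: funpow_add)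
qed

lemma nilp_uniform:
  assumes "lin f" "nilp f"
  obtains n where "\<And>v. (f ^^ n) v = 0"
proof -
  obtain k where k: "\<And>v. (f ^^ k v) v = 0" using assms(2) unfolding nilp_def by metis
  define n where "n = Max (k ` Basis)"
  have "(f ^^ n) b = 0" if "b \<in> Basis" for b
    using funpow_zero_mono[OF assms(1) k[of b]] that finite_Basis by (simp add: n_def)
  then have "f ^^ n = (\<lambda>_. 0)"
    by (intro lin_eq_on_span[OF lin_funpow[OF assms(1)] lin_const0 span_Basis]) auto
  then show ?thesis using that by metis
qed

lemma subspace_nil_vectors:
  assumes f: "lin f" shows "subspace {v. \<exists>n. (f ^^ n) v = 0}"
proof (rule subspaceI)
  show "0 \<in> {v. \<exists>n. (f ^^ n) v = 0}" by (auto intro: exI[of _ 0])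
next
  fix x y assume "x \<in> {v. \<exists>n. (f ^^ n) v = 0}" "y \<in> {v. \<exists>n. (f ^^ n) v = 0}"
  then obtain n m where "(f ^^ n) x = 0" "(f ^^ m) y = 0" by blast
  then have "(f ^^ (n + m)) (x + y) = 0"
    using funpow_zero_mono[OF f, of n x "n + m"] funpow_zero_mono[OF f, of m y "n + m"] f
    by (simp add: lin_add[OF lin_funpow])
  then show "x + y \<in> {v. \<exists>n. (f ^^ n) v = 0}" by blast
next
  fix c x assume "x \<in> {v. \<exists>n. (f ^^ n) v = 0}"
  then show "c \<cdot> x \<in> {v. \<exists>n. (f ^^ n) v = 0}"
    using f by (auto simp: lin_scale[OF lin_funpow])
qed

lemma nilp_on_span:
  assumes "lin f" "span S = UNIV" "\<And>s. s \<in> S \<Longrightarrow> \<exists>n. (f ^^ n) s = 0"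
  shows "nilp f"
proof -
  have "span S \<subseteq> {v. \<exists>n. (f ^^ n) v = 0}"
    using assms subspace_nil_vectors by (intro span_minimal) auto
  then show ?thesis using assms(2) unfolding nilp_def by auto
qed

lemma funpow_commute_apply: "(\<And>v. f (g v) = g (f v)) \<Longrightarrow> (f ^^ n) (g v) = g ((f ^^ n) v)"
  by (induction n) auto

lemma nilp_comp_commute:
  assumes "lin g" "nilp f" "\<And>v. f (g v) = g (f v)"
  shows "nilp (\<lambda>v. f (g v))"
proof -
  have "((\<lambda>v. f (g v)) ^^ n) v = (g ^^ n) ((f ^^ n) v)" for n v
  proof (induction n)
    case (Suc n)
    have fg: "f ((g ^^ n) w) = (g ^^ n) (f w)" for w
      using funpow_commute_apply[of g f n] assms(3) by simp
    have "((\<lambda>v. f (g v)) ^^ Suc n) v = f (g (((\<lambda>v. f (g v)) ^^ n) v))" by simp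
    also have "\<dots> = g (f ((g ^^ n) ((f ^^ n) v)))" unfolding Suc by (rule assms(3))
    also have "\<dots> = (g ^^ Suc n) ((f ^^ Suc n) v)" by (simp add: fg)
    finally show ?case .
  qed auto
  then show ?thesis using assms(2) lin_zero[OF lin_funpow[OF assms(1)]] unfolding nilp_def by metis
qed

text \<open>Extending bases along the kernels of \<open>f ^^ n\<close> makes \<open>f\<close>
  strictly triangular. This is recorded as \<open>f b \<in> span (B - {b})\<close>, which is all
  that the diagonal coefficients see.\<close>

lemma tr_nilp:
  assumes f: "lin f" and "nilp f"
  shows "tr f = 0"
proof -
  have "\<exists>B. independent B \<and> span B = {v. (f ^^ n) v = 0} \<and> (\<forall>b\<in>B. f b \<in> span (B - {b}))" for n
  proof (induction n)
    case 0
    show ?case by (rule exI[of _ "{}"]) (auto simp: independent_empty)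
  next
    case (Suc n)
    then obtain B where B: "independent B" "span B = {v. (f ^^ n) v = 0}"
      "\<And>b. b \<in> B \<Longrightarrow> f b \<in> span (B - {b})" by blast
    let ?K = "{v. (f ^^ Suc n) v = 0}"
    have sub: "subspace ?K"
      using lin_funpow[OF f, of "Suc n"] by (auto intro!: subspaceI simp: lin_simps simp del: funpow.simps)
    have "B \<subseteq> span B" by (rule span_superset)
    then have "B \<subseteq> ?K" using B(2) lin_zero[OF f] by auto
    then obtain C where C: "B \<subseteq> C" "C \<subseteq> ?K" "independent C" "?K \<subseteq> span C"
      using maximal_independent_subset_extend[OF _ B(1)] by blast
    have "span C = ?K" using C sub by (simp add: span_minimal subset_antisym)
    moreover have "f b \<in> span (C - {b})" if b: "b \<in> C" for b
    proof (cases "b \<in> B")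
      case True
      then show ?thesis using B(3) span_mono[of "B - {b}" "C - {b}"] C(1) by blast
    next
      case False
      have "(f ^^ n) (f b) = 0" using b C(2) by (auto simp: funpow_swap1)
      then have "f b \<in> span B" using B(2) by simp
      then show ?thesis using span_mono[of B "C - {b}"] C(1) False by blast
    qed
    ultimately show ?case using C(3) by blast
  qed
  moreover obtain n where "\<And>v. (f ^^ n) v = 0" using nilp_uniform assms by blast
  ultimately obtain B where B: "independent B" "span B = UNIV" "\<And>b. b \<in> B \<Longrightarrow> f b \<in> span (B - {b})"
    by (metis (mono_tags) UNIV_eq_I mem_Collect_eq)
  have "representation B (f b) b = 0" if "b \<in> B" for b
  proof -
    have "representation B (f b) = representation (B - {b}) (f b)"
      using B that by (intro representation_extend) auto
    then show ?thesis using representation_ne_zero[of "B - {b}" "f b" b] by auto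
  qed
  then have "trace_on B f = 0" by (simp add: trace_on_def)
  then show ?thesis using tr_on_basis[OF B(1,2) f] by simp
qed

subsection \<open>Generalised eigenspaces\<close>

definition shift :: "('a \<Rightarrow> 'a) \<Rightarrow> complex \<Rightarrow> 'a \<Rightarrow> 'a" where
  "shift x c v = x v - c \<cdot> v"

definition gev :: "('a \<Rightarrow> 'a) \<Rightarrow> complex \<Rightarrow> 'a set" where
  "gev x c = {v. \<exists>n. (shift x c ^^ n) v = 0}"

lemma lin_shift: "lin x \<Longrightarrow> lin (shift x c)"
  unfolding shift_def[abs_def] by (intro lin_sub lin_scalar)

lemma subspace_gev: "lin x \<Longrightarrow> subspace (gev x c)"
  unfolding gev_def by (intro subspace_nil_vectors lin_shift)

lemma gev_shift_iff: "lin x \<Longrightarrow> shift x c v \<in> gev x c \<longleftrightarrow> v \<in> gev x c"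
proof
  assume "shift x c v \<in> gev x c"
  then obtain n where "(shift x c ^^ n) (shift x c v) = 0" unfolding gev_def by blast
  then have "(shift x c ^^ Suc n) v = 0" by (simp only: funpow_Suc_right o_apply)
  then show "v \<in> gev x c" unfolding gev_def by blast
next
  assume x: "lin x" and "v \<in> gev x c"
  then obtain n where n: "(shift x c ^^ n) v = 0" unfolding gev_def by blast
  have "(shift x c ^^ n) (shift x c v) = shift x c ((shift x c ^^ n) v)" by (simp add: funpow_swap1)
  then show "shift x c v \<in> gev x c" using n lin_zero[OF lin_shift[OF x]] unfolding gev_def by auto
qed

lemma gev_commute:
  assumes "lin x" "lin y" "\<And>v. x (y v) = y (x v)" "v \<in> gev x c"
  shows "y v \<in> gev x c"
proof -
  obtain n where n: "(shift x c ^^ n) v = 0" using assms unfolding gev_def by blast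
  have "(shift x c ^^ n) (y v) = y ((shift x c ^^ n) v)"
    by (rule funpow_commute_apply) (simp add: shift_def assms lin_simps)
  then show ?thesis using n lin_zero[OF assms(2)] unfolding gev_def by auto
qed

lemma eigenvector_gev: "x v = c \<cdot> v \<Longrightarrow> v \<in> gev x c"
  unfolding gev_def by (auto intro!: exI[of _ 1] simp: shift_def)

text \<open>\<open>shift x c\<close> and \<open>shift x d\<close> differ by the nonzero scalar
  \<open>d - c\<close>, so a solution for \<open>shift x d u\<close>, which is one step closer to
  zero, can be corrected to one for \<open>u\<close>.\<close>

lemma gev_shift_surj:
  assumes x: "lin x" and "c \<noteq> d" "u \<in> gev x d"
  shows "\<exists>w\<in>gev x d. shift x c w = u"
proof -
  have "(shift x d ^^ n) u = 0 \<Longrightarrow> \<exists>w\<in>gev x d. shift x c w = u" for n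
  proof (induction n arbitrary: u)
    case 0
    then show ?case using subspace_0[OF subspace_gev[OF x]] lin_zero[OF lin_shift[OF x]] by force
  next
    case (Suc n)
    have "(shift x d ^^ n) (shift x d u) = 0" using Suc.prems by (simp add: funpow_swap1)
    then obtain w where w: "w \<in> gev x d" "shift x c w = shift x d u" using Suc.IH by blast
    have u: "u \<in> gev x d" using Suc.prems unfolding gev_def by blast
    let ?w = "inverse (d - c) \<cdot> (u - w)"
    have "shift x c ?w = inverse (d - c) \<cdot> (shift x c u - shift x c w)"
      using lin_shift[OF x] by (simp add: lin_simps)
    also have "shift x c u - shift x c w = (d - c) \<cdot> u"
      by (simp add: w(2)) (simp add: shift_def scale_left_diff_distrib)
    finally have "shift x c ?w = u" using assms(2) by simp
    moreover have "?w \<in> gev x d"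
      using u w(1) subspace_gev[OF x] by (intro subspace_scale subspace_diff)
    ultimately show ?case by blast
  qed
  then show ?thesis using assms(3) unfolding gev_def by blast
qed

section \<open>Polynomials in an operator; generalised eigenvectors span the space\<close>

definition pev :: "('a \<Rightarrow> 'a) \<Rightarrow> complex poly \<Rightarrow> 'a \<Rightarrow> 'a" where
  "pev x p v = (\<Sum>i\<le>degree p. coeff p i \<cdot> (x ^^ i) v)"

lemma pev_ge:
  assumes "degree p \<le> n" shows "pev x p v = (\<Sum>i\<le>n. coeff p i \<cdot> (x ^^ i) v)"
  unfolding pev_def using assms by (intro sum.mono_neutral_left) (auto simp: coeff_eq_0)

lemma pev_pCons: "lin x \<Longrightarrow> pev x (pCons a p) v = a \<cdot> v + x (pev x p v)"
proof -
  assume x: "lin x"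
  have "pev x (pCons a p) v = (\<Sum>i\<le>Suc (degree p). coeff (pCons a p) i \<cdot> (x ^^ i) v)"
    by (rule pev_ge) (simp add: degree_pCons_le)
  also have "\<dots> = a \<cdot> v + (\<Sum>i\<le>degree p. coeff p i \<cdot> (x ^^ Suc i) v)"
    by (simp add: sum.atMost_Suc_shift del: sum.atMost_Suc funpow.simps(2))
  also have "(\<Sum>i\<le>degree p. coeff p i \<cdot> (x ^^ Suc i) v) = x (pev x p v)"
    unfolding pev_def by (simp add: lin_sum[OF x] lin_scale[OF x])
  finally show ?thesis .
qed

lemma pev_add: "pev x (p + q) v = pev x p v + pev x q v"
proof -
  let ?n = "max (degree p) (degree q)"
  have "pev x (p + q) v = (\<Sum>i\<le>?n. coeff (p + q) i \<cdot> (x ^^ i) v)"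
    by (rule pev_ge) (rule degree_add_le_max)
  also have "\<dots> = pev x p v + pev x q v"
    by (simp add: pev_ge[of p ?n] pev_ge[of q ?n] scale_left_distrib sum.distrib)
  finally show ?thesis .
qed

lemma pev_smult: "pev x (smult a p) v = a \<cdot> pev x p v"
  by (subst pev_ge[of _ "degree p"]) (auto simp: pev_def scale_sum_right)

lemma pev_linear_factor: "lin x \<Longrightarrow> pev x ([:- c, 1:] * q) v = shift x c (pev x q v)"
  using pev_add[of x "smult (- c) q" "pCons 0 q" v]
  using pev_smult[of x "- c" q v]
  by (simp add: pev_pCons shift_def)

lemma pev_commute: "lin x \<Longrightarrow> pev x q (shift x c v) = shift x c (pev x q v)"
proof (induction q)
  case 0 then show ?case using lin_zero[OF lin_shift] by (simp add: pev_def)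
next
  case (pCons a q)
  then show ?case by (simp add: pev_pCons) (simp add: shift_def lin_simps algebra_simps)
qed

lemma annihilating_poly:
  assumes x: "lin x"
  shows "\<exists>p. p \<noteq> 0 \<and> pev x p v = 0"
proof (cases "inj (\<lambda>i. (x ^^ i) v)")
  case False
  then obtain i j where ij: "i < j" "(x ^^ i) v = (x ^^ j) v"
    unfolding inj_def by (metis linorder_neqE_nat)
  have m: "pev x (monom c k) v = c \<cdot> (x ^^ k) v" for c k
    by (subst pev_ge[of _ k]) (auto simp: degree_monom_le if_distrib[of "\<lambda>c. c \<cdot> _"] cong: if_cong)
  let ?p = "monom 1 i + monom (-1) j :: complex poly"
  have "coeff ?p i = 1" using ij by simp
  then have "?p \<noteq> 0" by (metis coeff_0 zero_neq_one)
  moreover have "pev x ?p v = 0" using ij by (simp only: pev_add m) simp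
  ultimately show ?thesis by blast
next
  case True
  let ?f = "\<lambda>i. (x ^^ i) v" let ?S = "?f ` {..card Basis}"
  have inj: "inj_on ?f {..card Basis}" using True by (meson inj_on_subset subset_UNIV)
  have "card ?S = Suc (card Basis)" using card_image[OF inj] by simp
  then have "\<not> independent ?S"
    using independent_span_bound[OF finite_Basis, of ?S] by (auto simp: span_Basis)
  then obtain u w where u: "w \<in> ?S" "u w \<noteq> 0" "(\<Sum>w\<in>?S. u w \<cdot> w) = 0"
    using dependent_finite[of ?S] by auto
  define p where "p = (\<Sum>i\<le>card Basis. monom (u (?f i)) i)"
  have cf: "coeff p i = (if i \<le> card Basis then u (?f i) else 0)" for i
    unfolding p_def by (simp add: coeff_sum)
  have "degree p \<le> card Basis" by (rule degree_le) (simp add: cf)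
  then have "pev x p v = (\<Sum>i\<le>card Basis. u (?f i) \<cdot> ?f i)" by (simp add: pev_ge cf)
  also have "\<dots> = 0" using u(3) by (simp add: sum.reindex[OF inj])
  finally have "pev x p v = 0" .
  moreover have "p \<noteq> 0" using u(1,2) cf by (metis (no_types, lifting) atMost_iff coeff_0 imageE)
  ultimately show ?thesis by blast
qed

lemma span_gev:
  assumes x: "lin x"
  shows "span (\<Union>c. gev x c) = UNIV"
proof -
  let ?S = "span (\<Union>c. gev x c)"
  \<comment> \<open>By \<open>ex\<close>, every vector of the span lies in the image of the span
    under \<open>shift x c\<close> up to an element of \<open>gev x c\<close>. So \<open>v\<close>
    differs from a vector of the span by an element of \<open>gev x c\<close>. Splitting off roots
    of an annihilating polynomial then reaches every vector.\<close>
  have step: "v \<in> ?S" if sc: "shift x c v \<in> ?S" for c v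
  proof -
    have ex: "\<exists>v'\<in>?S. \<exists>u\<in>gev x c. shift x c v' = w - u" if w: "w \<in> ?S" for w
      using w
    proof (induction rule: span_induct_alt)
      case base
      have "0 \<in> gev x c" "shift x c 0 = 0" "0 \<in> ?S"
        using subspace_0[OF subspace_gev[OF x]] lin_zero[OF lin_shift[OF x]] span_zero by auto
      then show ?case by force
    next
      case (step a w y)
      then obtain d where d: "w \<in> gev x d" by blast
      obtain v' u where vu: "v' \<in> ?S" "u \<in> gev x c" "shift x c v' = y - u" using step by blast
      have "\<exists>v''\<in>?S. \<exists>u'\<in>gev x c. shift x c v'' = w - u'"
      proof (cases "c = d")
        case True
        then show ?thesis using d lin_zero[OF lin_shift[OF x]] span_zero by (metis diff_self)
      next
        case False
        then obtain w' where "w' \<in> gev x d" "shift x c w' = w" using gev_shift_surj[OF x _ d] by blast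
        moreover have "w' \<in> ?S" using calculation by (auto intro: span_base)
        ultimately show ?thesis using subspace_0[OF subspace_gev[OF x]] by force
      qed
      then obtain v'' u' where vu': "v'' \<in> ?S" "u' \<in> gev x c" "shift x c v'' = w - u'" by blast
      have "shift x c (a \<cdot> v'' + v') = (a \<cdot> w + y) - (a \<cdot> u' + u)"
        using lin_shift[OF x] vu vu' by (simp add: lin_simps scale_right_diff_distrib)
      moreover have "a \<cdot> v'' + v' \<in> ?S" using vu vu' by (intro span_add span_scale)
      moreover have "a \<cdot> u' + u \<in> gev x c"
        using vu vu' subspace_gev[OF x] by (intro subspace_add subspace_scale)
      ultimately show ?case by blast
    qed
    then obtain v' u where vu: "v' \<in> ?S" "u \<in> gev x c" "shift x c v' = shift x c v - u"
      using ex[OF sc] by blast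
    then have "shift x c (v - v') = u" using lin_shift[OF x] by (simp add: lin_simps)
    then have "v - v' \<in> gev x c" using vu gev_shift_iff[OF x] by metis
    then have "v - v' \<in> ?S" by (auto intro: span_base)
    then show ?thesis using vu(1) span_add by fastforce
  qed
  have "v \<in> ?S" if "p \<noteq> 0" "pev x p v = 0" for p v
    using that
  proof (induction "degree p" arbitrary: p v)
    case 0
    then obtain a where "p = [:a:]" "a \<noteq> 0" by (metis degree_eq_zeroE pCons_0_0)
    then have "v = 0" using 0 by (simp add: pev_def)
    then show ?case by (simp add: span_zero)
  next
    case (Suc n)
    then have "\<not> constant (poly p)" by (simp add: constant_degree)
    then obtain c where "poly p c = 0" using fundamental_theorem_of_algebra by blast
    then obtain q where q: "p = [:- c, 1:] * q" by (metis dvdE poly_eq_0_iff_dvd)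
    have "q \<noteq> 0" using Suc.prems q by auto
    then have "degree p = Suc (degree q)" unfolding q by (subst degree_mult_eq) auto
    moreover have "pev x q (shift x c v) = 0"
      using Suc.prems(2) unfolding q by (simp only: pev_commute[OF x] pev_linear_factor[OF x])
    ultimately show ?case using Suc.hyps \<open>q \<noteq> 0\<close> step by (metis Suc_inject)
  qed
  then show ?thesis using annihilating_poly[OF x] by blast
qed

lemma gev_shift_inj:
  assumes x: "lin x" and "c \<noteq> d" "u \<in> gev x d" "shift x c u = 0"
  shows "u = 0"
proof -
  have "(shift x d ^^ n) u = ((c - d) ^ n) \<cdot> u" for n
  proof (induction n)
    case (Suc n)
    have "shift x d u = (c - d) \<cdot> u"
      using assms(4) by (simp add: shift_def scale_left_diff_distrib)
    then show ?case using Suc lin_shift[OF x] by (simp add: lin_simps mult.commute)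
  qed auto
  then show ?thesis using assms unfolding gev_def by (auto simp: scale_eq_0_iff)
qed

lemma gev_shift_funpow_inj:
  assumes x: "lin x" and "c \<noteq> d" "u \<in> gev x d" "(shift x c ^^ n) u = 0"
  shows "u = 0"
  using assms(3,4)
proof (induction n arbitrary: u)
  case (Suc n)
  have "shift x c u \<in> gev x d"
    using Suc.prems x by (intro gev_commute[OF x lin_shift]) (auto simp: shift_def lin_simps)
  then have "shift x c u = 0" using Suc by (simp add: funpow_swap1)
  then show ?case using gev_shift_inj assms Suc.prems by blast
qed auto

text \<open>A power of \<open>shift x d\<close> that kills the \<open>d\<close>-component removes
  one summand and is injective on the other generalised eigenspaces, so the induction hypothesis
  gives back the other components.\<close>

lemma gev_independent:
  assumes x: "lin x" and "finite C" "\<And>c. c \<in> C \<Longrightarrow> u c \<in> gev x c" "(\<Sum>c\<in>C. u c) = 0" "c \<in> C"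
  shows "u c = 0"
  using assms(2-5)
proof (induction C arbitrary: u c rule: finite_induct)
  case (insert d C)
  obtain n where n: "(shift x d ^^ n) (u d) = 0" using insert.prems unfolding gev_def by blast
  let ?s = "shift x d ^^ n"
  have ls: "lin ?s" by (intro lin_funpow lin_shift x)
  have mem: "?s (u e) \<in> gev x e" if "e \<in> C" for e
  proof (rule gev_commute[OF x ls])
    show "x (?s v) = ?s (x v)" for v
      by (rule funpow_commute_apply[symmetric]) (simp add: shift_def lin_simps[OF x])
  qed (use that insert.prems in auto)
  have "0 = ?s (\<Sum>c\<in>insert d C. u c)" using insert.prems ls by (simp add: lin_zero)
  also have "\<dots> = (\<Sum>c\<in>C. ?s (u c))" using insert.hyps n by (simp add: lin_sum[OF ls] lin_add[OF ls])
  finally have s0: "(\<Sum>c\<in>C. ?s (u c)) = 0" by simp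
  have C0: "u e = 0" if e: "e \<in> C" for e
  proof -
    have "?s (u e) = 0" by (rule insert.IH[OF _ s0 e]) (rule mem)
    moreover have "d \<noteq> e" using insert.hyps e by blast
    ultimately show ?thesis using gev_shift_funpow_inj[OF x, of d e "u e" n] insert.prems(1) e by blast
  qed
  then have "u d = 0" using insert by simp
  then show ?case using C0 insert.prems by auto
qed auto

subsection \<open>Functional calculus\<close>

lemma gev_basis:
  assumes "lin x"
  obtains B c where "independent B" "span B = UNIV" "finite B" "\<And>b. b \<in> B \<Longrightarrow> b \<in> gev x (c b)"
proof -
  obtain B where B: "B \<subseteq> (\<Union>c. gev x c)" "independent B" "span B = UNIV" "finite B"
    using basis_of_spanning[OF span_gev[OF assms]] by blast
  then have "\<forall>b. \<exists>c. b \<in> B \<longrightarrow> b \<in> gev x c" by blast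
  then obtain c where "\<And>b. b \<in> B \<Longrightarrow> b \<in> gev x (c b)" by metis
  then show ?thesis using that B by blast
qed

lemma fc_exists:
  assumes x: "lin x"
  shows "\<exists>F. lin F \<and> (\<forall>c. \<forall>v\<in>gev x c. F v = \<phi> c \<cdot> v)"
proof -
  obtain B c where B: "independent B" "span B = UNIV" "finite B" "\<And>b. b \<in> B \<Longrightarrow> b \<in> gev x (c b)"
    using gev_basis[OF x] by blast
  interpret vector_space_pair scale scale by unfold_locales
  define F where "F = construct B (\<lambda>b. \<phi> (c b) \<cdot> b)"
  have F: "lin F" and Fb: "\<And>b. b \<in> B \<Longrightarrow> F b = \<phi> (c b) \<cdot> b"
    using B(1) by (auto simp: F_def linear_construct construct_basis)
  have "F v = \<phi> d \<cdot> v" if v: "v \<in> gev x d" for d v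
  proof -
    let ?r = "representation B v"
    \<comment> \<open>\<open>F\<close> is prescribed on a basis only. Uniqueness of the
      decomposition into the components \<open>w e\<close> shows that \<open>v\<close> is its own
      \<open>d\<close>-component, so \<open>F\<close> is scalar on all of
      \<open>gev x d\<close>.\<close>
    define w where "w e = (\<Sum>b\<in>{b\<in>B. c b = e}. ?r b \<cdot> b)" for e
    let ?C = "insert d (c ` B)"
    have w: "w e \<in> gev x e" for e
      unfolding w_def using B(4) subspace_gev[OF x] by (intro subspace_sum subspace_scale) auto
    have sp: "(\<Sum>e\<in>?C. \<Sum>b\<in>{b\<in>B. c b = e}. g b) = (\<Sum>b\<in>B. g b)" for g :: "'a \<Rightarrow> 'a"
      using B(3) by (intro sum.group) auto
    have tot: "(\<Sum>e\<in>?C. w e) = v"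
      unfolding w_def sp by (rule expand_basis[OF B(1,2)])
    have "(\<Sum>e\<in>?C. (if e = d then w d - v else w e)) = (\<Sum>e\<in>?C. w e) - v"
    proof -
      have "(\<Sum>e\<in>?C. (if e = d then w d - v else w e)) = (\<Sum>e\<in>?C. w e - (if e = d then v else 0))"
        by (intro sum.cong) auto
      then show ?thesis using B(3) by (simp add: sum_subtractf del: sum.insert_if)
    qed
    then have s0: "(\<Sum>e\<in>?C. (if e = d then w d - v else w e)) = 0" using tot by simp
    have ind: "(if e = d then w d - v else w e) = 0" if "e \<in> ?C" for e
      by (rule gev_independent[OF x _ _ s0 that])
         (use B(3) w v subspace_diff[OF subspace_gev[OF x]] in auto)
    have wd: "w d = v" using ind[of d] by simp
    have "F (w d) = (\<Sum>b\<in>{b\<in>B. c b = d}. ?r b \<cdot> \<phi> d \<cdot> b)"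
      unfolding w_def lin_sum[OF F] by (intro sum.cong) (auto simp: lin_scale[OF F] Fb)
    also have "\<dots> = \<phi> d \<cdot> w d"
      unfolding w_def scale_sum_right by (intro sum.cong) (auto simp: mult.commute)
    finally show ?thesis unfolding wd .
  qed
  then show ?thesis using F by blast
qed

text \<open>Functional calculus for the semisimple part of \<open>x\<close>:
  \<open>fc x (\<lambda>c. c)\<close> is the semisimple part in the Jordan decomposition, and
  \<open>fc x cnj\<close> is the same operator with conjugated eigenvalues.\<close>

definition fc :: "('a \<Rightarrow> 'a) \<Rightarrow> (complex \<Rightarrow> complex) \<Rightarrow> 'a \<Rightarrow> 'a" where
  "fc x \<phi> = (SOME F. lin F \<and> (\<forall>c. \<forall>v\<in>gev x c. F v = \<phi> c \<cdot> v))"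

lemma lin_fc: "lin x \<Longrightarrow> lin (fc x \<phi>)"
  and fc_gev: "\<lbrakk>lin x; v \<in> gev x c\<rbrakk> \<Longrightarrow> fc x \<phi> v = \<phi> c \<cdot> v"
  using someI_ex[OF fc_exists[of x \<phi>]] unfolding fc_def by auto

lemma eq_on_gev:
  assumes "lin x" "lin f" "lin g" "\<And>c v. v \<in> gev x c \<Longrightarrow> f v = g v"
  shows "f = g"
  by (rule lin_eq_on_span[OF assms(2,3) span_gev[OF assms(1)]]) (use assms(4) in auto)

lemma fc_commute:
  assumes "lin x" "lin y" "\<And>v. x (y v) = y (x v)"
  shows "fc x \<phi> (y v) = y (fc x \<phi> v)"
proof -
  note l = lin_fc[OF assms(1), of \<phi>]
  have "(\<lambda>v. fc x \<phi> (y v)) = (\<lambda>v. y (fc x \<phi> v))"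
    by (rule eq_on_gev[OF assms(1) lin_comp[OF l assms(2)] lin_comp[OF assms(2) l]])
       (use assms in \<open>simp add: fc_gev gev_commute lin_scale\<close>)
  then show ?thesis by metis
qed

lemma nilp_minus_fc:
  assumes x: "lin x"
  shows "nilp (\<lambda>v. x v - fc x (\<lambda>c. c) v)"
proof (rule nilp_on_span[OF _ span_gev[OF x]])
  show "lin (\<lambda>v. x v - fc x (\<lambda>c. c) v)" by (intro lin_sub lin_fc x)
  fix v assume "v \<in> (\<Union>c. gev x c)"
  then obtain c where v: "v \<in> gev x c" by blast
  have "((\<lambda>v. x v - fc x (\<lambda>c. c) v) ^^ n) v = (shift x c ^^ n) v \<and> (shift x c ^^ n) v \<in> gev x c" for n
  proof (induction n)
    case (Suc n)
    then show ?case
      using gev_shift_iff[OF x] fc_gev[OF x, of "(shift x c ^^ n) v" c "\<lambda>c. c"] by (simp add: shift_def[of x c "(shift x c ^^ n) v", symmetric])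
  qed (use v in simp)
  then show "\<exists>n. ((\<lambda>v. x v - fc x (\<lambda>c. c) v) ^^ n) v = 0"
    using v unfolding gev_def by auto
qed

end

context fd_space begin

subsection \<open>Engel's theorem\<close>

definition lie_space :: "('a \<Rightarrow> 'a) set \<Rightarrow> bool" where
  "lie_space L \<longleftrightarrow> (\<forall>x\<in>L. lin x) \<and> (\<lambda>v. 0) \<in> L \<and>
     (\<forall>x\<in>L. \<forall>y\<in>L. (\<lambda>v. x v + y v) \<in> L) \<and> (\<forall>c. \<forall>x\<in>L. (\<lambda>v. c \<cdot> x v) \<in> L) \<and>
     (\<forall>x\<in>L. \<forall>y\<in>L. op_comm x y \<in> L)"

lemma lie_spaceD:
  assumes "lie_space L"
  shows "x \<in> L \<Longrightarrow> lin x" "(\<lambda>v. 0) \<in> L" "\<lbrakk>x \<in> L; y \<in> L\<rbrakk> \<Longrightarrow> (\<lambda>v. x v + y v) \<in> L"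
    "x \<in> L \<Longrightarrow> (\<lambda>v. c \<cdot> x v) \<in> L" "\<lbrakk>x \<in> L; y \<in> L\<rbrakk> \<Longrightarrow> op_comm x y \<in> L"
  using assms unfolding lie_space_def by auto

lemma lie_space_diff:
  assumes "lie_space L" "x \<in> L" "y \<in> L" shows "(\<lambda>v. x v - y v) \<in> L"
  using lie_spaceD(3)[OF assms(1,2) lie_spaceD(4)[OF assms(1,3), of "-1"]] by simp

text \<open>Engel's theorem is stated as the vanishing of the descending series \<open>V \<supseteq> M V \<supseteq> M (M V) \<supseteq> \<dots>\<close>,
  which makes adjoining one normalising nilpotent element to \<open>M\<close> a computation.\<close>

primrec chain :: "('a \<Rightarrow> 'a) set \<Rightarrow> nat \<Rightarrow> 'a set" where
  "chain M 0 = UNIV"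
| "chain M (Suc j) = span {m w | m w. m \<in> M \<and> w \<in> chain M j}"

lemma subspace_chain: "subspace (chain M j)"
  by (cases j) auto

lemma chain_apply: "\<lbrakk>m \<in> M; w \<in> chain M j\<rbrakk> \<Longrightarrow> m w \<in> chain M (Suc j)"
  by (auto intro: span_base)

lemma chain_Suc_least:
  "\<lbrakk>subspace U; \<And>m w. \<lbrakk>m \<in> M; w \<in> chain M j\<rbrakk> \<Longrightarrow> m w \<in> U\<rbrakk> \<Longrightarrow> chain M (Suc j) \<subseteq> U"
  unfolding chain.simps by (rule span_minimal) auto

lemma chain_decreasing: "chain M (Suc j) \<subseteq> chain M j"
proof (induction j)
  case (Suc j)
  then show ?case by (intro chain_Suc_least subspace_chain chain_apply) auto
qed auto

lemma subspace_preimage: "\<lbrakk>lin f; subspace U\<rbrakk> \<Longrightarrow> subspace {v. f v \<in> U}"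
  by (rule subspaceI) (auto simp: lin_simps subspace_0 subspace_add subspace_scale)

text \<open>Each quotient of \<open>chain M j\<close> by \<open>chain M (Suc j)\<close> is filtered
  by the images of the powers of \<open>x\<close> (the spaces \<open>B j i\<close>). An element
  \<open>m + c x\<close> raises \<open>i\<close> by one, and \<open>x ^^ n = 0\<close> puts
  \<open>B j n\<close> inside the next term, so \<open>n\<close> steps for \<open>M'\<close> achieve
  one step for \<open>M\<close>.\<close>

lemma chain_extend:
  assumes M: "\<And>m. m \<in> M \<Longrightarrow> lin m" and k: "chain M k = {0}"
    and x: "lin x" "nilp x" and norm: "\<And>m. m \<in> M \<Longrightarrow> op_comm m x \<in> M"
    and M': "\<And>y. y \<in> M' \<Longrightarrow> \<exists>m\<in>M. \<exists>c. y = (\<lambda>v. m v + c \<cdot> x v)"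
  shows "\<exists>k. chain M' k = {0}"
proof -
  have xch: "x w \<in> chain M j" if "w \<in> chain M j" for w j
    using that
  proof (induction j arbitrary: w)
    case (Suc j)
    have "chain M (Suc j) \<subseteq> {w. x w \<in> chain M (Suc j)}"
    proof (rule chain_Suc_least)
      show "subspace {w. x w \<in> chain M (Suc j)}" by (intro subspace_preimage x subspace_chain)
      fix m u assume mu: "m \<in> M" "u \<in> chain M j"
      have "x (m u) = m (x u) - op_comm m x u" by (simp add: op_comm_def)
      also have "\<dots> \<in> chain M (Suc j)"
        using mu Suc.IH norm by (intro subspace_diff[OF subspace_chain] chain_apply)
      finally show "m u \<in> {w. x w \<in> chain M (Suc j)}" by simp
    qed
    then show ?case using Suc.prems by blast
  qed auto
  obtain n where n: "\<And>v. (x ^^ n) v = 0" using nilp_uniform[OF x] by blast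
  define B where "B j i = span ((x ^^ i) ` chain M j \<union> chain M (Suc j))" for j i
  have pow: "(x ^^ i) w \<in> chain M j" if "w \<in> chain M j" for i j w
    by (induction i) (use that xch in auto)
  have step: "y w \<in> B j (Suc i)" if y: "y \<in> M'" and w: "w \<in> B j i" for y w i j
  proof -
    obtain m c where m: "m \<in> M" and yy: "y = (\<lambda>v. m v + c \<cdot> x v)" using M' y by blast
    have "lin y" unfolding yy by (intro lin_plus lin_smult x M m)
    have "B j i \<subseteq> {w. y w \<in> B j (Suc i)}" unfolding B_def[of j i]
    proof (rule span_minimal)
      show "subspace {w. y w \<in> B j (Suc i)}"
        unfolding B_def by (intro subspace_preimage \<open>lin y\<close> subspace_span)
      have 1: "y ((x ^^ i) u) \<in> B j (Suc i)" if "u \<in> chain M j" for u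
      proof -
        have "m ((x ^^ i) u) \<in> B j (Suc i)"
          unfolding B_def by (rule span_base) (use chain_apply[OF m pow[OF that]] in blast)
        moreover have "x ((x ^^ i) u) \<in> B j (Suc i)"
          unfolding B_def by (rule span_base) (use that in auto)
        ultimately show ?thesis unfolding yy B_def by (intro span_add span_scale)
      qed
      have 2: "y u \<in> B j (Suc i)" if "u \<in> chain M (Suc j)" for u
      proof -
        have "m u \<in> chain M (Suc j)" using chain_apply[OF m that] chain_decreasing by blast
        then have "y u \<in> chain M (Suc j)"
          unfolding yy using xch[OF that] by (intro subspace_add subspace_scale subspace_chain)
        then show ?thesis unfolding B_def by (intro span_base) auto
      qed
      show "(x ^^ i) ` chain M j \<union> chain M (Suc j) \<subseteq> {w. y w \<in> B j (Suc i)}" using 1 2 by blast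
    qed
    then show ?thesis using w by blast
  qed
  have sub: "chain M' (p + i) \<subseteq> B j i" if "chain M' p \<subseteq> chain M j" for p i j
  proof (induction i)
    case 0
    then show ?case using that unfolding B_def by (auto intro: span_base)
  next
    case (Suc i)
    have "chain M' (Suc (p + i)) \<subseteq> B j (Suc i)"
      by (rule chain_Suc_least) (use Suc step in \<open>auto simp: B_def\<close>)
    then show ?case by simp
  qed
  have Bn: "B j n \<subseteq> chain M (Suc j)" for j
    unfolding B_def using n subspace_0[OF subspace_chain[of M "Suc j"]]
    by (intro span_minimal subspace_chain) auto
  have "chain M' (j * n) \<subseteq> chain M j" for j
  proof (induction j)
    case (Suc j)
    then show ?case using sub[OF Suc, of n] Bn[of j] by (simp add: add.commute)
  qed auto
  then have "chain M' (k * n) \<subseteq> {0}" using k by metis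
  then show ?thesis using subspace_0[OF subspace_chain] by blast
qed

section \<open>The space of operators and the maximality argument in Engel's theorem\<close>

lemma vector_space_operators: "vector_space (\<lambda>c (f::'a \<Rightarrow> 'a) v. c \<cdot> f v)"
  by unfold_locales (auto simp: fun_eq_iff scale_right_distrib scale_left_distrib)

interpretation op: vector_space "\<lambda>c (f::'a \<Rightarrow> 'a) v. c \<cdot> f v"
  by (rule vector_space_operators)

lemma sum_fun_apply: "(\<Sum>a\<in>A. (g a :: 'a \<Rightarrow> 'a)) v = (\<Sum>a\<in>A. g a v)"
  by (induction A rule: infinite_finite_induct) auto

text \<open>Matrix units span the linear operators. The bound permits choosing a subalgebra of
  greatest dimension in \<open>engel\<close>.\<close>

lemma op_independent_bound:
  "\<exists>N. \<forall>S. op.independent S \<longrightarrow> (\<forall>f\<in>S. lin f) \<longrightarrow> finite S \<and> card S \<le> N"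
proof -
  define E where "E b b' = (\<lambda>v. representation Basis v b \<cdot> b')" for b b' :: 'a
  define T where "T = (\<lambda>(b, b'). E b b') ` (Basis \<times> Basis)"
  have "finite T" unfolding T_def using finite_Basis by auto
  have "f \<in> op.span T" if f: "lin f" for f
  proof -
    let ?r = "representation Basis"
    have eq: "f = (\<Sum>b\<in>Basis. \<Sum>b'\<in>Basis. (\<lambda>v. ?r (f b) b' \<cdot> E b b' v))"
    proof
      fix v
      have "f v = f (\<Sum>b\<in>Basis. ?r v b \<cdot> b)" by (simp add: expand_basis independent_Basis span_Basis)
      also have "\<dots> = (\<Sum>b\<in>Basis. ?r v b \<cdot> f b)" by (simp add: lin_sum[OF f] lin_scale[OF f])
      also have "\<dots> = (\<Sum>b\<in>Basis. ?r v b \<cdot> (\<Sum>b'\<in>Basis. ?r (f b) b' \<cdot> b'))"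
        by (simp add: expand_basis independent_Basis span_Basis)
      also have "\<dots> = (\<Sum>b\<in>Basis. \<Sum>b'\<in>Basis. ?r (f b) b' \<cdot> E b b' v)"
        unfolding E_def by (simp add: scale_sum_right mult.commute)
      finally show "f v = (\<Sum>b\<in>Basis. \<Sum>b'\<in>Basis. (\<lambda>v. ?r (f b) b' \<cdot> E b b' v)) v"
        by (simp add: sum_fun_apply)
    qed
    show ?thesis
      by (subst eq) (intro op.span_sum op.span_scale op.span_base, auto simp: T_def)
  qed
  then have "\<forall>S. op.independent S \<longrightarrow> (\<forall>f\<in>S. lin f) \<longrightarrow> finite S \<and> card S \<le> card T"
    using op.independent_span_bound[OF \<open>finite T\<close>] by blast
  then show ?thesis by blast
qed

text \<open>The terms in the expansion of an iterated commutator of \<open>y\<close> with elements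
  of \<open>M\<close>, counting the factors on the left and on the right of \<open>y\<close>
  separately.\<close>

inductive wordop :: "('a \<Rightarrow> 'a) set \<Rightarrow> ('a \<Rightarrow> 'a) \<Rightarrow> nat \<Rightarrow> nat \<Rightarrow> ('a \<Rightarrow> 'a) \<Rightarrow> bool"
  for M y where
  base: "wordop M y 0 0 y"
| left: "\<lbrakk>wordop M y p q z; m \<in> M\<rbrakk> \<Longrightarrow> wordop M y (Suc p) q (\<lambda>v. m (z v))"
| right: "\<lbrakk>wordop M y p q z; m \<in> M\<rbrakk> \<Longrightarrow> wordop M y p (Suc q) (\<lambda>v. z (m v))"

lemma wordop_chain: "wordop M y p q z \<Longrightarrow> z v \<in> chain M p"
  by (induction arbitrary: v rule: wordop.induct) (auto intro: span_base)

lemma chain_antimono: "i \<le> j \<Longrightarrow> chain M j \<subseteq> chain M i"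
  using lift_Suc_antimono_le[of "chain M" i j] chain_decreasing[of M] by blast

lemma wordop_kills:
  assumes "wordop M y p q z" "lin y" "\<And>m. m \<in> M \<Longrightarrow> lin m" "chain M k = {0}" "w \<in> chain M i" "k \<le> q + i"
  shows "z w = 0"
  using assms(1,5,6)
proof (induction arbitrary: w i rule: wordop.induct)
  case base
  then have "w \<in> chain M k" using chain_antimono[of k i M] by auto
  then show ?case using assms(2,4) by (simp add: lin_zero)
next
  case (left p q z m)
  then show ?case using lin_zero[OF assms(3)] by metis
next
  case (right p q z m)
  then show ?case using chain_apply[of m M w i] right.IH[of "m w" "Suc i"] by simp
qed

text \<open>Otherwise some \<open>y\<close> outside \<open>M\<close> could be commuted with elements
  of \<open>M\<close> for ever without entering \<open>M\<close>. But after \<open>2 * k\<close>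
  commutators every term has at least \<open>k\<close> factors from \<open>M\<close> on one side of
  \<open>y\<close> and vanishes, so 0 would lie outside \<open>M\<close>.\<close>

lemma normaliser_exists:
  assumes L: "lie_space L" and M: "M \<subseteq> L" "(\<lambda>v. 0) \<in> M" and k: "chain M k = {0}" and "M \<noteq> L"
  shows "\<exists>x\<in>L - M. \<forall>m\<in>M. op_comm m x \<in> M"
proof (rule ccontr)
  assume "\<not> ?thesis"
  then have neg: "\<And>x. x \<in> L - M \<Longrightarrow> \<exists>m\<in>M. op_comm m x \<notin> M" by blast
  obtain y where y: "y \<in> L - M" using assms by blast
  note lin = lie_spaceD(1)[OF L]
  define W where "W j = op.span {z. \<exists>p q. p + q = j \<and> wordop M y p q z}" for j
  have ad: "op_comm m z \<in> W (Suc j)" if m: "m \<in> M" and z: "z \<in> W j" for m z j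
  proof -
    have lm: "lin m" using lin m M by blast
    show ?thesis using z unfolding W_def
    proof (induction rule: op.span_induct_alt)
      case base
      have "op_comm m 0 = 0" by (simp add: op_comm_def fun_eq_iff lin_zero[OF lm])
      show ?case unfolding \<open>op_comm m 0 = 0\<close> by (rule op.span_zero)
    next
      case (step c z z')
      then obtain p q where z: "p + q = j" "wordop M y p q z" by blast
      have "(\<lambda>v. m (z v)) \<in> W (Suc j)" "(\<lambda>v. z (m v)) \<in> W (Suc j)"
        unfolding W_def
        by (rule op.span_base, rule CollectI, rule exI[of _ "Suc p"], rule exI[of _ q],
            use wordop.left[OF z(2) m] z(1) in simp)
           (rule op.span_base, rule CollectI, rule exI[of _ p], rule exI[of _ "Suc q"],
            use wordop.right[OF z(2) m] z(1) in simp)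
      then have "(\<lambda>v. m (z v)) - (\<lambda>v. z (m v)) \<in> W (Suc j)"
        unfolding W_def by (rule op.span_diff)
      then have "(\<lambda>v. c \<cdot> ((\<lambda>v. m (z v)) - (\<lambda>v. z (m v))) v) + op_comm m z' \<in> W (Suc j)"
        using step(2) unfolding W_def by (intro op.span_add op.span_scale)
      also have "(\<lambda>v. c \<cdot> ((\<lambda>v. m (z v)) - (\<lambda>v. z (m v))) v) + op_comm m z' = op_comm m ((\<lambda>v. c \<cdot> z v) + z')"
        by (auto simp: op_comm_def fun_eq_iff lin_simps[OF lm] scale_right_diff_distrib)
      finally show ?case unfolding W_def .
    qed
  qed
  have ex: "\<exists>x\<in>L - M. x \<in> W j" for j
  proof (induction j)
    case 0
    show ?case using y unfolding W_def by (auto intro!: bexI[of _ y] op.span_base wordop.base)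
  next
    case (Suc j)
    then obtain x where x: "x \<in> L - M" "x \<in> W j" by blast
    then obtain m where "m \<in> M" "op_comm m x \<notin> M" using neg by blast
    moreover have "op_comm m x \<in> L" using calculation(1) x M lie_spaceD(5)[OF L] by blast
    ultimately show ?case using ad x by blast
  qed
  have "z = 0" if "p + q = 2 * k" "wordop M y p q z" for p q z
  proof
    fix v
    show "z v = 0 v"
    proof (cases "k \<le> q")
      case True
      then show ?thesis using wordop_kills[OF that(2) _ _ k, of v 0] lin y M by auto
    next
      case False
      then have "k \<le> p" using that by simp
      then have "z v \<in> chain M k" using wordop_chain[OF that(2)] chain_antimono by blast
      then show ?thesis using k by simp
    qed
  qed
  then have "{z. \<exists>p q. p + q = 2 * k \<and> wordop M y p q z} \<subseteq> {0}" by blast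
  then have "W (2 * k) \<subseteq> {0}" unfolding W_def by (rule op.span_minimal[OF _ op.subspace_single_0])
  moreover obtain x where x: "x \<in> L - M" "x \<in> W (2 * k)" using ex[of "2 * k"] by (elim bexE)
  ultimately have "x = (\<lambda>v. 0)" by (auto simp: zero_fun_def)
  then show False using M(2) x(1) by simp
qed

theorem engel:
  assumes L: "lie_space L" and nil: "\<And>x. x \<in> L \<Longrightarrow> nilp x"
  shows "\<exists>k. chain L k = {0}"
proof -
  note lin = lie_spaceD(1)[OF L]
  \<comment> \<open>Some \<open>n\<close>-dimensional subalgebra satisfies the conclusion. One of
    greatest dimension must be \<open>L\<close>, since a normalising element could be adjoined
    otherwise.\<close>
  define P where "P n \<longleftrightarrow> (\<exists>I\<subseteq>L. op.independent I \<and> finite I \<and> card I = n \<and>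
     (\<forall>x\<in>op.span I. \<forall>y\<in>op.span I. op_comm x y \<in> op.span I) \<and> (\<exists>k. chain (op.span I) k = {0}))" for n
  have spanL: "op.span I \<subseteq> L" if "I \<subseteq> L" for I
    using that lie_spaceD[OF L]
    by (intro op.span_minimal op.subspaceI) (auto simp: plus_fun_def zero_fun_def)
  have "P 0" unfolding P_def
  proof (intro exI[of _ "{}"] conjI)
    have "chain (op.span {}) 1 = {0}"
      by (simp add: zero_fun_def)
    then show "\<exists>k. chain (op.span {}) k = {0}" by blast
  qed (auto simp: op.independent_empty op_comm_def fun_eq_iff)
  obtain N where N: "\<forall>S. op.independent S \<longrightarrow> (\<forall>f\<in>S. lin f) \<longrightarrow> finite S \<and> card S \<le> N"
    using op_independent_bound by blast
  have bound: "n \<le> N" if "P n" for n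
  proof -
    from that obtain I where I: "I \<subseteq> L" "op.independent I" "card I = n" unfolding P_def by (elim exE conjE)
    have "\<forall>f\<in>I. lin f" using I(1) lin by auto
    then show ?thesis using N[rule_format, OF I(2)] I(3) by simp
  qed
  then have G: "P (Greatest P)" "\<And>n. P n \<Longrightarrow> n \<le> Greatest P"
    using GreatestI_nat[of P 0 N] Greatest_le_nat[of P _ N] \<open>P 0\<close> by simp_all
  then obtain I where I: "I \<subseteq> L" "op.independent I" "finite I" "card I = Greatest P"
    "\<forall>x\<in>op.span I. \<forall>y\<in>op.span I. op_comm x y \<in> op.span I" "\<exists>k. chain (op.span I) k = {0}"
    unfolding P_def[of "Greatest P"] by (elim exE conjE) (rule that, assumption+, rule exI, assumption)
  from I(6) obtain k where k: "chain (op.span I) k = {0}" by (elim exE)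
  let ?M = "op.span I"
  have "?M = L"
  proof (rule ccontr)
    assume "?M \<noteq> L"
    then obtain x where x: "x \<in> L - ?M" "\<And>m. m \<in> ?M \<Longrightarrow> op_comm m x \<in> ?M"
      using normaliser_exists[OF L spanL[OF I(1)] _ k] op.span_zero by (auto simp: zero_fun_def)
    let ?J = "insert x I"
    have el: "\<exists>m\<in>?M. \<exists>c. z = (\<lambda>v. m v + c \<cdot> x v)" if "z \<in> op.span ?J" for z
    proof -
      obtain c where c: "z - (\<lambda>v. c \<cdot> x v) \<in> ?M" using \<open>z \<in> op.span ?J\<close> unfolding op.span_insert by blast
      show ?thesis by (rule bexI[OF _ c], rule exI[of _ c]) auto
    qed
    have linM: "m \<in> ?M \<Longrightarrow> lin m" for m using spanL[OF I(1)] lin by blast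
    have lx: "lin x" using x lin by blast
    have "\<exists>k. chain (op.span ?J) k = {0}"
      by (rule chain_extend[OF linM k lx _ x(2) el]) (use x nil in auto)
    moreover have "op_comm z z' \<in> op.span ?J" if zz: "z \<in> op.span ?J" "z' \<in> op.span ?J" for z z'
    proof -
      obtain m c m' c' where m: "m \<in> ?M" "m' \<in> ?M" and
        z: "z = (\<lambda>v. m v + c \<cdot> x v)" "z' = (\<lambda>v. m' v + c' \<cdot> x v)" using el[OF zz(1)] el[OF zz(2)] by (elim bexE exE)
      have "op_comm z z' = op_comm m m' + ((\<lambda>v. c' \<cdot> op_comm m x v) - (\<lambda>v. c \<cdot> op_comm m' x v))"
        unfolding z
        by (auto simp: op_comm_def fun_eq_iff lin_simps[OF linM[OF m(1)]] lin_simps[OF linM[OF m(2)]] lin_simps[OF lx] scale_right_diff_distrib scale_right_distrib mult.commute)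
      also have "\<dots> \<in> ?M" using m x(2) I(5)[rule_format, OF m] by (intro op.span_add op.span_diff op.span_scale)
      also have "?M \<subseteq> op.span ?J" by (intro op.span_mono) auto
      finally show ?thesis .
    qed
    moreover have "op.independent ?J" using x I(2) op.independent_insertI by blast
    moreover have "x \<notin> I" using x op.span_base by blast
    moreover have "?J \<subseteq> L" using I(1) x(1) by simp
    ultimately have "P (Suc (card I))"
      unfolding P_def by (intro exI[of _ ?J] conjI ballI) (simp_all add: I(3))
    then have "Suc (card I) \<le> Greatest P" by (rule G(2))
    then show False using I(4) by simp
  qed
  then show ?thesis using k by blast
qed

lemma engel_kernel:
  assumes L: "lie_space L" "\<And>x. x \<in> L \<Longrightarrow> nilp x" and "(UNIV :: 'a set) \<noteq> {0}"
  shows "\<exists>v. v \<noteq> 0 \<and> (\<forall>x\<in>L. x v = 0)"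
proof -
  define k where "k = (LEAST k. chain L k = {0})"
  have k: "chain L k = {0}" unfolding k_def by (rule LeastI_ex[OF engel[OF L]])
  have "k \<noteq> 0"
  proof
    assume "k = 0" then show False using k assms(3) by simp
  qed
  then obtain j where j: "k = Suc j" by (rule not0_implies_Suc[THEN exE])
  then have "chain L j \<noteq> {0}"
    unfolding k_def by (intro not_less_Least) simp
  moreover have "0 \<in> chain L j" by (rule subspace_0[OF subspace_chain])
  ultimately obtain v where v: "v \<in> chain L j" "v \<noteq> 0" by blast
  have "x v = 0" if "x \<in> L" for x using chain_apply[OF that v(1)] unfolding j[symmetric] k by simp
  then show ?thesis using v(2) by (intro exI[of _ v]) simp
qed

text \<open>A product of two elements need not lie in \<open>L\<close>; it is nilpotent because it
  moves every vector down the common series.\<close>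

lemma engel_nilp_comp:
  assumes L: "lie_space L" "\<And>x. x \<in> L \<Longrightarrow> nilp x" and "x \<in> L" "y \<in> L"
  shows "nilp (\<lambda>v. x (y v))"
proof -
  obtain k where k: "chain L k = {0}" using engel[OF L(1)] L(2) by blast
  have mem: "((\<lambda>v. x (y v)) ^^ n) v \<in> chain L n" for n v
  proof (induction n)
    case (Suc n)
    have "y (((\<lambda>v. x (y v)) ^^ n) v) \<in> chain L n"
      using chain_apply[OF assms(4) Suc] chain_decreasing by blast
    from chain_apply[OF assms(3) this] show ?case by simp
  qed auto
  show ?thesis unfolding nilp_def using mem[of k] unfolding k by blast
qed

end

context fd_space begin

subsection \<open>Diagonalisable operators\<close>

definition diag :: "('a \<Rightarrow> 'a) \<Rightarrow> bool" where
  "diag t \<longleftrightarrow> lin t \<and> span {v. \<exists>c. t v = c \<cdot> v} = UNIV"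

definition evs :: "('a \<Rightarrow> 'a) \<Rightarrow> complex set" where
  "evs t = {c. \<exists>v. v \<noteq> 0 \<and> t v = c \<cdot> v}"

definition proj :: "('a \<Rightarrow> 'a) \<Rightarrow> complex \<Rightarrow> 'a \<Rightarrow> 'a" where
  "proj t s = fc t (\<lambda>c. if c = s then 1 else 0)"

lemma diag_lin: "diag t \<Longrightarrow> lin t"
  by (simp add: diag_def)

lemma diag_fc: "diag t \<Longrightarrow> fc t (\<lambda>c. c) = t"
  unfolding diag_def
proof (elim conjE, rule lin_eq_on_span[OF lin_fc])
  fix v assume "lin t" "v \<in> {v. \<exists>c. t v = c \<cdot> v}"
  then obtain c where v: "t v = c \<cdot> v" by blast
  show "fc t (\<lambda>c. c) v = t v"
    unfolding v by (rule fc_gev[OF \<open>lin t\<close> eigenvector_gev[of t v c, OF v]])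
qed

lemma diag_gev: "diag t \<Longrightarrow> v \<in> gev t c \<longleftrightarrow> t v = c \<cdot> v"
  using diag_fc[of t] fc_gev[of t v c "\<lambda>c. c"] eigenvector_gev[of t v c] by (auto simp: diag_lin)

lemma diag_eqI:
  assumes "diag t" "lin f" "lin g" "\<And>c v. t v = c \<cdot> v \<Longrightarrow> f v = g v"
  shows "f = g"
proof (rule eq_on_gev[OF diag_lin[OF assms(1)] assms(2,3)])
  fix c v assume "v \<in> gev t c"
  then have "t v = c \<cdot> v" by (simp add: diag_gev[OF assms(1)])
  then show "f v = g v" by (rule assms(4))
qed

lemma diag_fc_id:
  assumes x: "lin x" shows "diag (fc x (\<lambda>c. c))"
  unfolding diag_def
proof
  have "(\<Union>c. gev x c) \<subseteq> {v. \<exists>c. fc x (\<lambda>c. c) v = c \<cdot> v}" by (auto simp: fc_gev[OF x])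
  from span_mono[OF this] show "span {v. \<exists>c. fc x (\<lambda>c. c) v = c \<cdot> v} = UNIV"
    unfolding span_gev[OF x] by auto
qed (rule lin_fc[OF x])

text \<open>The functional calculus of the indicator function of the values of \<open>c\<close> on
  \<open>B\<close> is the identity, but it would send an eigenvector with any other eigenvalue to
  0.\<close>

lemma evs_fc_subset:
  assumes x: "lin x" and "independent B" "span B = UNIV" and B: "\<And>b. b \<in> B \<Longrightarrow> b \<in> gev x (c b)"
  shows "evs x \<subseteq> c ` B"
proof
  fix d assume "d \<in> evs x"
  then obtain v where v: "v \<noteq> 0" "x v = d \<cdot> v" unfolding evs_def by blast
  let ?\<phi> = "\<lambda>e. if e \<in> c ` B then 1 else 0"
  have "fc x ?\<phi> = (\<lambda>v. v)"
    by (rule lin_eq_on_span[OF lin_fc[OF x] lin_ident assms(3)]) (simp add: fc_gev[OF x B])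
  moreover have "fc x ?\<phi> v = ?\<phi> d \<cdot> v" by (rule fc_gev[OF x eigenvector_gev[of x v d, OF v(2)]])
  ultimately have "v = ?\<phi> d \<cdot> v" by (simp only:)
  then show "d \<in> c ` B" using v(1) by (cases "d \<in> c ` B") auto
qed

lemma finite_evs: "lin x \<Longrightarrow> finite (evs x)" and card_evs: "lin x \<Longrightarrow> card (evs x) \<le> card Basis"
proof -
  assume x: "lin x"
  obtain B c where B: "independent B" "span B = UNIV" "finite B" "\<And>b. b \<in> B \<Longrightarrow> b \<in> gev x (c b)"
    using gev_basis[OF x] by blast
  have sub: "evs x \<subseteq> c ` B" by (rule evs_fc_subset[OF x B(1,2,4)])
  show "finite (evs x)" by (rule finite_subset[OF sub finite_imageI[OF B(3)]])
  have "card (evs x) \<le> card (c ` B)" by (rule card_mono[OF finite_imageI[OF B(3)] sub])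
  also have "\<dots> \<le> card B" by (rule card_image_le[OF B(3)])
  also have "\<dots> \<le> card Basis"
    using independent_span_bound[OF finite_Basis B(1)] by (simp add: span_Basis)
  finally show "card (evs x) \<le> card Basis" .
qed

lemma lin_proj: "lin t \<Longrightarrow> lin (proj t s)"
  unfolding proj_def by (rule lin_fc)

lemma proj_eigen: "\<lbrakk>lin t; t v = c \<cdot> v\<rbrakk> \<Longrightarrow> proj t s v = (if c = s then v else 0)"
  using fc_gev[OF _ eigenvector_gev, of t v c "\<lambda>c. if c = s then 1 else 0"] by (simp add: proj_def)

lemma proj_in_eigenspace:
  assumes "diag t" shows "t (proj t s v) = s \<cdot> proj t s v"
proof -
  note l = diag_lin[OF assms]
  have "(\<lambda>v. t (proj t s v)) = (\<lambda>v. s \<cdot> proj t s v)"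
  proof (rule diag_eqI[OF assms lin_comp[OF l lin_proj[OF l]] lin_smult[OF lin_proj[OF l]]])
    fix c v assume v: "t v = c \<cdot> v"
    show "t (proj t s v) = s \<cdot> proj t s v" by (simp add: proj_eigen[OF l v] v lin_zero[OF l])
  qed
  then show ?thesis by (rule fun_cong)
qed

lemma sum_proj:
  assumes "diag t" shows "(\<Sum>s\<in>evs t. proj t s v) = v"
proof -
  note l = diag_lin[OF assms]
  have "(\<lambda>v. \<Sum>s\<in>evs t. proj t s v) = (\<lambda>v. v)"
  proof (rule diag_eqI[OF assms lin_sum_fun[OF lin_proj[OF l]] lin_ident])
    fix c v assume v: "t v = c \<cdot> v"
    show "(\<Sum>s\<in>evs t. proj t s v) = v"
    proof (cases "v = 0")
      case False
      then have "c \<in> evs t" using v unfolding evs_def by blast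
      then show ?thesis using finite_evs[OF l] by (simp add: proj_eigen[OF l v])
    qed (simp add: lin_zero[OF lin_proj[OF l]])
  qed
  then show ?thesis by (rule fun_cong)
qed

lemma proj_commute: "\<lbrakk>lin t; lin y; \<And>v. t (y v) = y (t v)\<rbrakk> \<Longrightarrow> proj t s (y v) = y (proj t s v)"
  unfolding proj_def by (rule fc_commute)

lemma tr_proj_nonzero:
  assumes t: "diag t" and "s \<in> evs t" shows "tr (proj t s) \<noteq> 0"
proof -
  note l = diag_lin[OF t]
  obtain u where u: "u \<noteq> 0" "t u = s \<cdot> u" using assms(2) unfolding evs_def by blast
  obtain B c where B: "independent B" "span B = UNIV" "finite B" "\<And>b. b \<in> B \<Longrightarrow> b \<in> gev t (c b)"
    using gev_basis[OF l] by blast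
  have pb: "proj t s b = (if c b = s then 1 else 0) \<cdot> b" if "b \<in> B" for b
    using proj_eigen[OF l, of b "c b" s] B(4)[OF that] by (simp add: diag_gev[OF t])
  have "tr (proj t s) = (\<Sum>b\<in>B. if c b = s then 1 else 0)"
    by (rule tr_eigenbasis[OF B(1,2) lin_proj[OF l] pb])
  also have "\<dots> = of_nat (card {b \<in> B. c b = s})"
    using B(3) by (simp add: sum.If_cases Int_def)
  finally have eq: "tr (proj t s) = of_nat (card {b \<in> B. c b = s})" .
  have "{b \<in> B. c b = s} \<noteq> {}"
  proof
    assume e: "{b \<in> B. c b = s} = {}"
    have "proj t s = (\<lambda>v. 0)"
      by (rule lin_eq_on_span[OF lin_proj[OF l] lin_const0 B(2)]) (use e pb in auto)
    moreover have "proj t s u = u" by (simp add: proj_eigen[OF l u(2)])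
    ultimately show False using u(1) by simp
  qed
  then show ?thesis using eq B(3) by simp
qed

lemma fc_id_zero_iff_nilp: "lin x \<Longrightarrow> fc x (\<lambda>c. c) = (\<lambda>v. 0) \<Longrightarrow> nilp x"
  using nilp_minus_fc[of x] by simp

text \<open>Complex conjugation is additive, so for a derivation \<open>x\<close> also \<open>fc x cnj\<close> is one; this makes
  the trace form behave like a positive definite form.\<close>

lemma tr_fc_cnj:
  assumes x: "lin x" and "tr (\<lambda>v. fc x (\<lambda>c. c) (fc x cnj v)) = 0"
  shows "fc x (\<lambda>c. c) = (\<lambda>v. 0)"
proof -
  obtain B c where B: "independent B" "span B = UNIV" "finite B" "\<And>b. b \<in> B \<Longrightarrow> b \<in> gev x (c b)"
    using gev_basis[OF x] by blast
  note l = lin_fc[OF x]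
  have eb: "fc x (\<lambda>c. c) (fc x cnj b) = complex_of_real ((cmod (c b))\<^sup>2) \<cdot> b" if "b \<in> B" for b
    by (simp add: fc_gev[OF x B(4)[OF that]] lin_scale[OF l] complex_norm_square mult.commute del: of_real_power)
  have "tr (\<lambda>v. fc x (\<lambda>c. c) (fc x cnj v)) = (\<Sum>b\<in>B. complex_of_real ((cmod (c b))\<^sup>2))"
    by (rule tr_eigenbasis[OF B(1,2) lin_comp[OF l l] eb])
  then have "complex_of_real (\<Sum>b\<in>B. (cmod (c b))\<^sup>2) = 0" using assms(2) by simp
  then have "(\<Sum>b\<in>B. (cmod (c b))\<^sup>2) = 0" by (simp only: of_real_eq_0_iff)
  then have "\<forall>b\<in>B. (cmod (c b))\<^sup>2 = 0" by (subst (asm) sum_nonneg_eq_0_iff[OF B(3)]) auto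
  then have "fc x (\<lambda>c. c) b = 0" if "b \<in> B" for b
    using that fc_gev[OF x B(4)[OF that], of "\<lambda>c. c"] by simp
  then show ?thesis by (intro lin_eq_on_span[OF l lin_const0 B(2)])
qed

text \<open>For diagonalisable \<open>t\<close>, the part of \<open>y\<close> that raises
  eigenvalues of \<open>t\<close> by \<open>\<rho>\<close>: the eigencomponent of \<open>y\<close>
  for \<open>\<rho>\<close> under the commutator with \<open>t\<close>.\<close>

definition homcomp :: "('a \<Rightarrow> 'a) \<Rightarrow> complex \<Rightarrow> ('a \<Rightarrow> 'a) \<Rightarrow> 'a \<Rightarrow> 'a" where
  "homcomp t \<rho> y v = (\<Sum>s\<in>evs t. proj t (s + \<rho>) (y (proj t s v)))"

lemma lin_homcomp: "\<lbrakk>lin t; lin y\<rbrakk> \<Longrightarrow> lin (homcomp t \<rho> y)"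
  unfolding homcomp_def[abs_def]
  by (rule lin_sum_fun, rule lin_comp[OF lin_proj], assumption, rule lin_comp[OF _ lin_proj])

lemma homcomp_eigen:
  assumes t: "diag t" and y: "lin y" and v: "t v = s \<cdot> v"
  shows "homcomp t \<rho> y v = proj t (s + \<rho>) (y v)"
proof (cases "v = 0")
  case True
  then show ?thesis using lin_zero[OF lin_homcomp[OF diag_lin[OF t] y]] lin_zero[OF y] lin_zero[OF lin_proj[OF diag_lin[OF t]]]
    by simp
next
  case False
  note l = diag_lin[OF t]
  have s: "s \<in> evs t" using v False unfolding evs_def by blast
  have "homcomp t \<rho> y v = (\<Sum>r\<in>evs t. if r = s then proj t (s + \<rho>) (y v) else 0)"
    unfolding homcomp_def
    by (intro sum.cong) (auto simp: proj_eigen[OF l v] lin_zero[OF y] lin_zero[OF lin_proj[OF l]])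
  then show ?thesis using s finite_evs[OF l] by simp
qed

lemma homcomp_degree:
  assumes t: "diag t" and y: "lin y" and v: "t v = s \<cdot> v"
  shows "t (homcomp t \<rho> y v) = (s + \<rho>) \<cdot> homcomp t \<rho> y v"
  by (simp add: homcomp_eigen[OF assms] proj_in_eigenspace[OF t])

text \<open>As \<open>e\<close> raises eigenvalues of \<open>t\<close> by \<open>\<rho>\<close>, the
  diagonal coefficients of the product see only the part of \<open>y\<close> that lowers them by
  \<open>\<rho>\<close>.\<close>

lemma tr_homcomp:
  assumes t: "diag t" and e: "lin e" "\<And>v. t (e v) = e (t v) + \<rho> \<cdot> e v" and y: "lin y"
  shows "tr (\<lambda>v. e (homcomp t (- \<rho>) y v)) = tr (\<lambda>v. e (y v))"
proof -
  note l = diag_lin[OF t]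
  obtain B c where B: "independent B" "span B = UNIV" "finite B" "\<And>b. b \<in> B \<Longrightarrow> b \<in> gev t (c b)"
    using gev_basis[OF l] by blast
  have eig: "t b = c b \<cdot> b" if "b \<in> B" for b using B(4)[OF that] by (simp add: diag_gev[OF t])
  have R1: "proj t s (e v) = e (proj t (s - \<rho>) v)" for s v
  proof -
    have "(\<lambda>v. proj t s (e v)) = (\<lambda>v. e (proj t (s - \<rho>) v))"
    proof (rule diag_eqI[OF t lin_comp[OF lin_proj[OF l] e(1)] lin_comp[OF e(1) lin_proj[OF l]]])
      fix c v assume v: "t v = c \<cdot> v"
      have "t (e v) = (c + \<rho>) \<cdot> e v" by (simp add: e(2) v lin_scale[OF e(1)] scale_left_distrib)
      then show "proj t s (e v) = e (proj t (s - \<rho>) v)"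
        by (auto simp: proj_eigen[OF l v] proj_eigen[OF l, of "e v" "c + \<rho>"] lin_zero[OF e(1)])
    qed
    then show ?thesis by (rule fun_cong)
  qed
  have R2: "representation B (proj t (c b) v) b = representation B v b" if b: "b \<in> B" for b v
  proof -
    have "proj t (c b) v = (\<Sum>b'\<in>B. representation B v b' \<cdot> (if c b' = c b then b' else 0))"
      by (subst expand_basis[OF B(1,2), of v, symmetric])
         (simp add: lin_sum[OF lin_proj[OF l]] lin_scale[OF lin_proj[OF l]] proj_eigen[OF l eig])
    also have "representation B \<dots> b = (\<Sum>b'\<in>B. if b' = b then representation B v b else 0)"
      unfolding representation_sum_UNIV[OF B(1,2)]
      using B b by (intro sum.cong) (auto simp: representation_scale representation_basis representation_zero)
    also have "\<dots> = representation B v b" using b B(3) by simp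
    finally show ?thesis .
  qed
  have "representation B (e (homcomp t (- \<rho>) y b)) b = representation B (e (y b)) b" if b: "b \<in> B" for b
    using R2[OF b, of "e (y b)"] by (simp add: homcomp_eigen[OF t y eig[OF b]] R1)
  then have "trace_on B (\<lambda>v. e (homcomp t (- \<rho>) y v)) = trace_on B (\<lambda>v. e (y v))"
    unfolding trace_on_def by (intro sum.cong) auto
  then show ?thesis
    using tr_on_basis[OF B(1,2) lin_comp[OF e(1) lin_homcomp[OF l y]]] tr_on_basis[OF B(1,2) lin_comp[OF e(1) y]]
    by simp
qed

end

section \<open>Derivations of a simple algebra\<close>

context latke begin

lemma eq_minus_self_iff: "v = - v \<longleftrightarrow> v = (0 :: 'a)"
proof
  assume "v = - v"
  then have "v + v = 0" by (metis add.right_inverse)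
  then have "scale (1 + 1) v = 0" by (simp only: scale_left_distrib scale_one)
  then show "v = 0" by simp
qed simp

lemma br_same [simp]: "br x x z = 0" "br x z z = 0" "br x z x = 0"
proof -
  show 1: "br x x z = 0" for x z using antisym12[of x x z] eq_minus_self_iff by simp
  show "br x z z = 0" using antisym23[of x z z] eq_minus_self_iff by simp
  show "br x z x = 0" using antisym23[of x z x] 1[of x z] by simp
qed

lemma br_rot: "br y z x = br x y z"
  by (metis antisym12 antisym23 minus_minus)

lemma br_perms:
  assumes "br a b d = r"
  shows "br a d b = - r" "br b a d = - r" "br b d a = r" "br d a b = r" "br d b a = - r"
  unfolding assms[symmetric]
  by (rule antisym23, rule antisym12, rule br_rot, rule br_rot[symmetric], subst antisym12, subst br_rot, rule refl)

end

locale fd_latke = latke scale br + fd_space scale Basis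
  for scale :: "complex \<Rightarrow> 'a::ab_group_add \<Rightarrow> 'a" (infixr "\<cdot>" 75)
    and br :: "'a \<Rightarrow> 'a \<Rightarrow> 'a \<Rightarrow> 'a" and Basis :: "'a set"
begin

lemmas br_simps = lin_simps[OF linear1] lin_simps[OF linear2] lin_simps[OF linear3]

definition der :: "('a \<Rightarrow> 'a) set" where
  "der = {x. lin x \<and> (\<forall>a b c. x (br a b c) = br (x a) b c + br a (x b) c + br a b (x c))}"

lemma der_lin: "x \<in> der \<Longrightarrow> lin x"
  and der_br: "x \<in> der \<Longrightarrow> x (br a b c) = br (x a) b c + br a (x b) c + br a b (x c)"
  by (auto simp: der_def)

lemma lin_ad: "lin (ad x y)"
  unfolding ad_def by (rule linear3)

lemma ad_in_der: "ad x y \<in> der"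
  unfolding der_def by (rule CollectI, rule conjI, rule lin_ad, unfold ad_def, intro allI, rule derivation)

lemma ad_swap: "ad y x = (\<lambda>v. - ad x y v)"
  by (simp add: ad_def antisym12[of x y] fun_eq_iff)

lemma der_comm_ad:
  assumes x: "x \<in> der" shows "x (ad a b v) = ad a b (x v) + ad (x a) b v + ad a (x b) v"
  by (simp add: ad_def der_br[OF x] add_ac)

lemma lie_space_der: "lie_space der"
  unfolding lie_space_def
proof (intro conjI ballI allI)
  fix x y :: "'a \<Rightarrow> 'a" and c assume x: "x \<in> der" and y: "y \<in> der"
  note s = br_simps lin_simps[OF der_lin[OF x]] lin_simps[OF der_lin[OF y]] der_br[OF x] der_br[OF y]
  show "(\<lambda>v. x v + y v) \<in> der" unfolding der_def
    by (simp add: s lin_plus[OF der_lin[OF x] der_lin[OF y]])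
  show "(\<lambda>v. c \<cdot> x v) \<in> der" unfolding der_def
    by (simp add: s lin_smult[OF der_lin[OF x]] scale_right_distrib)
  show "op_comm x y \<in> der" unfolding der_def
    using lin_comm[OF der_lin[OF x] der_lin[OF y]] by (simp add: op_comm_def s)
next
  show "(\<lambda>v. 0) \<in> der" unfolding der_def by (simp add: br_simps lin_const0)
qed (rule der_lin)

lemmas der_closed = lie_spaceD[OF lie_space_der] and der_diff = lie_space_diff[OF lie_space_der]

lemma der_on_span:
  assumes f: "lin f" and S: "span S = UNIV"
    and "\<And>a b c. \<lbrakk>a \<in> S; b \<in> S; c \<in> S\<rbrakk> \<Longrightarrow> f (br a b c) = br (f a) b c + br a (f b) c + br a b (f c)"
  shows "f \<in> der"
proof -
  note s = br_simps lin_simps[OF f] scale_right_distrib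
  have 1: "f (br a b c) = br (f a) b c + br a (f b) c + br a b (f c)" if "a \<in> S" "b \<in> S" for a b c
  proof -
    have "(\<lambda>c. f (br a b c)) = (\<lambda>c. br (f a) b c + br a (f b) c + br a b (f c))"
      by (rule lin_eq_on_span[OF _ _ S]) (use that assms(3) in \<open>simp_all add: lin_iff s\<close>)
    then show ?thesis by (rule fun_cong)
  qed
  have 2: "f (br a b c) = br (f a) b c + br a (f b) c + br a b (f c)" if "a \<in> S" for a b c
  proof -
    have "(\<lambda>b. f (br a b c)) = (\<lambda>b. br (f a) b c + br a (f b) c + br a b (f c))"
      by (rule lin_eq_on_span[OF _ _ S]) (use that 1 in \<open>simp_all add: lin_iff s\<close>)
    then show ?thesis by (rule fun_cong)
  qed
  have "f (br a b c) = br (f a) b c + br a (f b) c + br a b (f c)" for a b c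
  proof -
    have "(\<lambda>a. f (br a b c)) = (\<lambda>a. br (f a) b c + br a (f b) c + br a b (f c))"
      by (rule lin_eq_on_span[OF _ _ S]) (use 2 in \<open>simp_all add: lin_iff s\<close>)
    then show ?thesis by (rule fun_cong)
  qed
  then show ?thesis using f unfolding der_def by simp
qed

text \<open>Shifted by \<open>c1 + c2 + c3\<close>, a derivation acts on a bracket as the sum of the
  three shifts in the separate slots. Each lowers one nilpotency exponent, hence the induction on
  their sum.\<close>

lemma gev_br:
  assumes x: "x \<in> der" and u: "u1 \<in> gev x c1" "u2 \<in> gev x c2" "u3 \<in> gev x c3"
  shows "br u1 u2 u3 \<in> gev x (c1 + c2 + c3)"
proof -
  note l = der_lin[OF x]
  have "(shift x c1 ^^ n1) u1 = 0 \<Longrightarrow> (shift x c2 ^^ n2) u2 = 0 \<Longrightarrow> (shift x c3 ^^ n3) u3 = 0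
      \<Longrightarrow> n1 + n2 + n3 \<le> n \<Longrightarrow> br u1 u2 u3 \<in> gev x (c1 + c2 + c3)" for n n1 n2 n3
  proof (induction n arbitrary: n1 n2 n3 u1 u2 u3)
    case 0
    then show ?case using subspace_0[OF subspace_gev[OF l]] by (simp add: br_simps)
  next
    case (Suc n)
    show ?case
    proof (cases "n1 = 0 \<or> n2 = 0 \<or> n3 = 0")
      case True
      then have "br u1 u2 u3 = 0" using Suc.prems by (auto simp: br_simps)
      then show ?thesis using subspace_0[OF subspace_gev[OF l]] by simp
    next
      case False
      then obtain m1 m2 m3 where m: "n1 = Suc m1" "n2 = Suc m2" "n3 = Suc m3"
        by (meson not0_implies_Suc)
      have A: "(shift x c1 ^^ m1) (shift x c1 u1) = 0" "(shift x c2 ^^ m2) (shift x c2 u2) = 0"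
        "(shift x c3 ^^ m3) (shift x c3 u3) = 0"
        using Suc.prems m by (simp_all add: funpow_swap1)
      have "br (shift x c1 u1) u2 u3 \<in> gev x (c1 + c2 + c3)"
        using Suc.prems m by (intro Suc.IH[OF A(1) Suc.prems(2,3)]) simp
      moreover have "br u1 (shift x c2 u2) u3 \<in> gev x (c1 + c2 + c3)"
        using Suc.prems m by (intro Suc.IH[OF Suc.prems(1) A(2) Suc.prems(3)]) simp
      moreover have "br u1 u2 (shift x c3 u3) \<in> gev x (c1 + c2 + c3)"
        using Suc.prems m by (intro Suc.IH[OF Suc.prems(1,2) A(3)]) simp
      moreover have "shift x (c1 + c2 + c3) (br u1 u2 u3) =
          br (shift x c1 u1) u2 u3 + br u1 (shift x c2 u2) u3 + br u1 u2 (shift x c3 u3)"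
        by (simp add: shift_def der_br[OF x] br_simps scale_left_distrib)
      ultimately have "shift x (c1 + c2 + c3) (br u1 u2 u3) \<in> gev x (c1 + c2 + c3)"
        using subspace_gev[OF l] by (simp add: subspace_add)
      then show ?thesis by (simp add: gev_shift_iff[OF l])
    qed
  qed
  then show ?thesis using u unfolding gev_def by blast
qed

text \<open>Brackets add generalised eigenvalues, so on generalised eigenvectors the Leibniz rule is
  the additivity of \<open>\<phi>\<close>.\<close>

lemma fc_der:
  assumes x: "x \<in> der" and add: "\<And>a b. \<phi> (a + b) = \<phi> a + \<phi> b"
  shows "fc x \<phi> \<in> der"
proof (rule der_on_span[OF lin_fc span_gev])
  show l: "lin x" "lin x" by (rule der_lin[OF x])+
  fix a b c assume "a \<in> (\<Union>c. gev x c)" "b \<in> (\<Union>c. gev x c)" "c \<in> (\<Union>c. gev x c)"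
  then obtain c1 c2 c3 where c: "a \<in> gev x c1" "b \<in> gev x c2" "c \<in> gev x c3" by blast
  show "fc x \<phi> (br a b c) = br (fc x \<phi> a) b c + br a (fc x \<phi> b) c + br a b (fc x \<phi> c)"
    by (simp add: fc_gev[OF l(1) gev_br[OF x c]] fc_gev[OF l(1) c(1)] fc_gev[OF l(1) c(2)] fc_gev[OF l(1) c(3)]
        br_simps add scale_left_distrib)
qed

lemma homcomp_der:
  assumes t: "t \<in> der" "diag t" and y: "y \<in> der"
  shows "homcomp t \<rho> y \<in> der"
proof (rule der_on_span[of _ "{v. \<exists>c. t v = c \<cdot> v}"])
  note l = der_lin[OF t(1)]
  show "lin (homcomp t \<rho> y)" by (rule lin_homcomp[OF l der_lin[OF y]])
  show "span {v. \<exists>c. t v = c \<cdot> v} = UNIV" using t(2) unfolding diag_def by simp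
  fix a b c assume "a \<in> {v. \<exists>c. t v = c \<cdot> v}" "b \<in> {v. \<exists>c. t v = c \<cdot> v}" "c \<in> {v. \<exists>c. t v = c \<cdot> v}"
  then obtain p q r where e: "t a = p \<cdot> a" "t b = q \<cdot> b" "t c = r \<cdot> c" by blast
  have tbr: "t (br u v w) = (i + j + k) \<cdot> br u v w" if "t u = i \<cdot> u" "t v = j \<cdot> v" "t w = k \<cdot> w" for u v w i j k
    by (simp add: der_br[OF t(1)] that br_simps scale_left_distrib)
  note lp = lin_proj[OF l]
  \<comment> \<open>Bracketing with two eigenvectors shifts eigenvalues by a constant, so a
    projection of the bracket can be moved into the free slot.\<close>
  have P1: "proj t (p + q + r + \<rho>) (br w b c) = br (proj t (p + \<rho>) w) b c" for w
  proof -
    have "(\<lambda>w. proj t (p + q + r + \<rho>) (br w b c)) = (\<lambda>w. br (proj t (p + \<rho>) w) b c)"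
    proof (rule diag_eqI[OF t(2) lin_comp[OF lp linear1] lin_comp[OF linear1 lp]])
      fix d v assume v: "t v = d \<cdot> v"
      show "proj t (p + q + r + \<rho>) (br v b c) = br (proj t (p + \<rho>) v) b c"
        by (auto simp: proj_eigen[OF l v] proj_eigen[OF l tbr[OF v e(2,3)]] br_simps)
    qed
    then show ?thesis by (rule fun_cong)
  qed
  have P2: "proj t (p + q + r + \<rho>) (br a w c) = br a (proj t (q + \<rho>) w) c" for w
  proof -
    have "(\<lambda>w. proj t (p + q + r + \<rho>) (br a w c)) = (\<lambda>w. br a (proj t (q + \<rho>) w) c)"
    proof (rule diag_eqI[OF t(2) lin_comp[OF lp linear2] lin_comp[OF linear2 lp]])
      fix d v assume v: "t v = d \<cdot> v"
      show "proj t (p + q + r + \<rho>) (br a v c) = br a (proj t (q + \<rho>) v) c"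
        by (auto simp: proj_eigen[OF l v] proj_eigen[OF l tbr[OF e(1) v e(3)]] br_simps)
    qed
    then show ?thesis by (rule fun_cong)
  qed
  have P3: "proj t (p + q + r + \<rho>) (br a b w) = br a b (proj t (r + \<rho>) w)" for w
  proof -
    have "(\<lambda>w. proj t (p + q + r + \<rho>) (br a b w)) = (\<lambda>w. br a b (proj t (r + \<rho>) w))"
    proof (rule diag_eqI[OF t(2) lin_comp[OF lp linear3] lin_comp[OF linear3 lp]])
      fix d v assume v: "t v = d \<cdot> v"
      show "proj t (p + q + r + \<rho>) (br a b v) = br a b (proj t (r + \<rho>) v)"
        by (auto simp: proj_eigen[OF l v] proj_eigen[OF l tbr[OF e(1,2) v]] br_simps)
    qed
    then show ?thesis by (rule fun_cong)
  qed
  note h = homcomp_eigen[OF t(2) der_lin[OF y]]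
  show "homcomp t \<rho> y (br a b c) = br (homcomp t \<rho> y a) b c + br a (homcomp t \<rho> y b) c + br a b (homcomp t \<rho> y c)"
    by (simp add: h[OF e(1)] h[OF e(2)] h[OF e(3)] h[OF tbr[OF e]] der_br[OF y] lin_add[OF lp] P1 P2 P3)
qed

end

locale simple_latke = fd_latke +
  assumes simple: "simple"
begin

lemma irreducible:
  assumes "subspace U" "\<And>x u. \<lbrakk>x \<in> der; u \<in> U\<rbrakk> \<Longrightarrow> x u \<in> U"
  shows "U = {0} \<or> U = UNIV"
proof -
  have "br x y z \<in> U" if "z \<in> U" for x y z
    using assms(2)[OF ad_in_der that] by (simp add: ad_def)
  then have "ideal U" using assms(1) by (simp add: ideal_def subalgebra_def)
  then show ?thesis using simple unfolding simple_def by blast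
qed

lemma nonabelian: "\<exists>x y z. br x y z \<noteq> 0"
  using simple unfolding simple_def abelian_def by blast

lemma UNIV_nontrivial: "(UNIV :: 'a set) \<noteq> {0}"
proof
  assume "(UNIV :: 'a set) = {0}"
  then have "br x y z = 0" for x y z by blast
  then show False using nonabelian by simp
qed

text \<open>The common kernel of \<open>R\<close> is nonzero by Engel's theorem and stable under
  \<open>der\<close> because \<open>R\<close> is an ideal; irreducibility makes it the whole
  space.\<close>

lemma nilp_ideal_zero:
  assumes R: "lie_space R" "\<And>x. x \<in> R \<Longrightarrow> nilp x" "\<And>g x. \<lbrakk>g \<in> der; x \<in> R\<rbrakk> \<Longrightarrow> op_comm x g \<in> R"
    and x: "x \<in> R"
  shows "x = (\<lambda>v. 0)"
proof -
  let ?W = "{v. \<forall>x\<in>R. x v = 0}"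
  note l = lie_spaceD(1)[OF R(1)]
  have "subspace ?W"
  proof (rule subspaceI)
    show "0 \<in> ?W" by (rule CollectI, rule ballI) (rule lin_zero[OF l])
    show "v + w \<in> ?W" if vw: "v \<in> ?W" "w \<in> ?W" for v w
    proof (rule CollectI, rule ballI)
      fix x assume x: "x \<in> R"
      have "x v = 0" "x w = 0"
        by (rule bspec[OF vw(1)[THEN CollectD] x], rule bspec[OF vw(2)[THEN CollectD] x])
      then show "x (v + w) = 0" by (simp add: lin_add[OF l[OF x]])
    qed
    show "c \<cdot> v \<in> ?W" if v: "v \<in> ?W" for c v
    proof (rule CollectI, rule ballI)
      fix x assume x: "x \<in> R"
      have "x v = 0" using v[THEN CollectD] x by (rule bspec)
      then show "x (c \<cdot> v) = 0" by (simp add: lin_scale[OF l[OF x]])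
    qed
  qed
  moreover have "g u \<in> ?W" if g: "g \<in> der" and u: "u \<in> ?W" for g u
  proof (rule CollectI, rule ballI)
    fix y assume y: "y \<in> R"
    have "op_comm y g u = 0" "y u = 0"
      by (rule bspec[OF u[THEN CollectD] R(3)[OF g y]], rule bspec[OF u[THEN CollectD] y])
    then show "y (g u) = 0" using lin_zero[OF der_lin[OF g]] by (simp add: op_comm_def)
  qed
  ultimately have "?W = {0} \<or> ?W = UNIV" by (rule irreducible)
  moreover have "?W \<noteq> {0}"
    using engel_kernel[OF R(1,2) UNIV_nontrivial] by blast
  ultimately have "?W = UNIV" by simp
  then show ?thesis using x by (auto simp: fun_eq_iff)
qed

theorem trace_form_nondegenerate:
  assumes x: "x \<in> der" and orth: "\<And>y. y \<in> der \<Longrightarrow> tr (\<lambda>v. x (y v)) = 0"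
  shows "x = (\<lambda>v. 0)"
proof -
  define R where "R = {x \<in> der. \<forall>y\<in>der. tr (\<lambda>v. x (y v)) = 0}"
  have Rd: "x \<in> der" "y \<in> der \<Longrightarrow> tr (\<lambda>v. x (y v)) = 0" if "x \<in> R" for x y
    using that unfolding R_def by simp_all
  have ideal: "op_comm x g \<in> R" if g: "g \<in> der" and x: "x \<in> R" for g x
    unfolding R_def
  proof (rule CollectI, rule conjI, rule der_closed(5)[OF Rd(1)[OF x] g], rule ballI)
    fix y assume y: "y \<in> der"
    have "tr (\<lambda>v. op_comm x g (y v)) = tr (\<lambda>v. x (op_comm g y v))"
      by (rule tr_comm_mult[OF der_lin[OF Rd(1)[OF x]] der_lin[OF g] der_lin[OF y]])
    also have "\<dots> = 0" by (rule Rd(2)[OF x der_closed(5)[OF g y]])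
    finally show "tr (\<lambda>v. op_comm x g (y v)) = 0" .
  qed
  have "lie_space R" unfolding lie_space_def
  proof (intro conjI ballI allI)
    fix x y c assume x: "x \<in> R" and y: "y \<in> R"
    show "(\<lambda>v. x v + y v) \<in> R" unfolding R_def
      using der_closed(3)[OF Rd(1)[OF x] Rd(1)[OF y]] Rd(2)[OF x] Rd(2)[OF y] by (simp add: tr_add)
    show "(\<lambda>v. c \<cdot> x v) \<in> R" unfolding R_def
      using der_closed(4)[OF Rd(1)[OF x]] Rd(2)[OF x] by (simp add: tr_scale)
    show "op_comm x y \<in> R" by (rule ideal[OF Rd(1)[OF y] x])
  next
    show "(\<lambda>v. 0) \<in> R" unfolding R_def using der_closed(2) by simp
  qed (rule der_lin[OF Rd(1)])
  moreover have "nilp x" if x: "x \<in> R" for x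
  proof -
    note l = der_lin[OF Rd(1)[OF x]]
    let ?s = "fc x (\<lambda>c. c)" and ?c = "fc x cnj"
    have comm: "x (?c v) = ?c (x v)" for v by (rule fc_commute[OF l l, symmetric]) simp
    have comm': "?s (?c v) = ?c (?s v)" for v by (rule fc_commute[OF l lin_fc[OF l] comm])
    \<comment> \<open>\<open>x - ?s\<close> is nilpotent and commutes with \<open>?c\<close>, so
      replacing \<open>x\<close> by \<open>?s\<close> leaves the trace of the product with
      \<open>?c\<close> unchanged.\<close>
    have n: "nilp (\<lambda>v. x (?c v) - ?s (?c v))"
      by (rule nilp_comp_commute[OF lin_fc[OF l] nilp_minus_fc[OF l]])
         (simp add: comm comm' lin_diff[OF lin_fc[OF l]])
    have "tr (\<lambda>v. x (?c v) - ?s (?c v)) = 0"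
      by (rule tr_nilp[OF lin_sub[OF lin_comp[OF l lin_fc[OF l]] lin_comp[OF lin_fc[OF l] lin_fc[OF l]]] n])
    moreover have "tr (\<lambda>v. x (?c v)) = 0" by (rule Rd(2)[OF x fc_der[OF Rd(1)[OF x]]]) simp
    ultimately have "tr (\<lambda>v. ?s (?c v)) = 0" by (simp add: tr_diff)
    then show "nilp x" by (intro fc_id_zero_iff_nilp[OF l] tr_fc_cnj[OF l])
  qed
  moreover have "x \<in> R" using x orth unfolding R_def by simp
  ultimately show ?thesis using ideal by (intro nilp_ideal_zero[of R])
qed

end

section \<open>A maximal torus of derivations\<close>

context fd_space begin

text \<open>The candidates for eigenvalues of the commutator with \<open>t\<close>. Maximising their
  number expresses that \<open>t\<close> is generic.\<close>

definition diffs :: "('a \<Rightarrow> 'a) \<Rightarrow> complex set" where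
  "diffs t = (\<lambda>(a, b). a - b) ` (evs t \<times> evs t)"

lemma finite_diffs: "lin t \<Longrightarrow> finite (diffs t)"
  unfolding diffs_def using finite_evs by auto

lemma card_diffs: "lin t \<Longrightarrow> card (diffs t) \<le> card Basis * card Basis"
proof -
  assume t: "lin t"
  have "card (diffs t) \<le> card (evs t \<times> evs t)"
    unfolding diffs_def using finite_evs[OF t] by (intro card_image_le) auto
  also have "\<dots> \<le> card Basis * card Basis"
    using card_evs[OF t] by (simp add: card_cartesian_product mult_le_mono)
  finally show ?thesis .
qed

lemma diag_zero: "diag (\<lambda>v. 0)"
proof -
  have "{v. \<exists>c. 0 = c \<cdot> v} = UNIV" by (auto intro: exI[of _ 0])
  then show ?thesis by (simp add: diag_def lin_const0)
qed

end

lemma (in fd_latke) exists_maximal_diag: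
  "\<exists>t. (t \<in> der \<and> diag t) \<and> (\<forall>t'. t' \<in> der \<and> diag t' \<longrightarrow> card (diffs t') \<le> card (diffs t))"
proof (rule ex_has_greatest_nat)
  show "(\<lambda>v. 0) \<in> der \<and> diag (\<lambda>v. 0)" using der_closed(2) diag_zero by simp
  show "\<forall>t'. t' \<in> der \<and> diag t' \<longrightarrow> card (diffs t') < Suc (card Basis * card Basis)"
    using card_diffs diag_lin by (simp add: less_Suc_eq_le)
qed

locale torus = simple_latke +
  fixes t :: "'a \<Rightarrow> 'a"
  assumes t_der: "t \<in> der" and t_diag: "diag t"
    and maximal: "\<lbrakk>t' \<in> der; diag t'\<rbrakk> \<Longrightarrow> card (diffs t') \<le> card (diffs t)"
begin

lemmas t_lin = der_lin[OF t_der]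

definition T :: "('a \<Rightarrow> 'a) set" where
  "T = {x \<in> der. \<forall>v. x (t v) = t (x v)}"

definition ss :: "('a \<Rightarrow> 'a) \<Rightarrow> 'a \<Rightarrow> 'a" where
  "ss x = fc x (\<lambda>c. c)"

lemma T_der: "x \<in> T \<Longrightarrow> x \<in> der" and T_comm_t: "x \<in> T \<Longrightarrow> x (t v) = t (x v)"
  by (auto simp: T_def)

lemma T_lin: "x \<in> T \<Longrightarrow> lin x"
  by (intro der_lin T_der)

lemma fc_T:
  assumes x: "x \<in> T" and "\<And>a b. \<phi> (a + b) = \<phi> a + \<phi> b" shows "fc x \<phi> \<in> T"
  unfolding T_def
  using fc_der[OF T_der[OF x] assms(2)] fc_commute[OF T_lin[OF x] t_lin T_comm_t[OF x]] by simp

lemma ss_T: "x \<in> T \<Longrightarrow> ss x \<in> T"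
  unfolding ss_def by (rule fc_T) simp_all

lemma ss_diag: "x \<in> T \<Longrightarrow> diag (ss x)"
  unfolding ss_def by (rule diag_fc_id[OF T_lin])

text \<open>The joint spectrum of \<open>t\<close> and the semisimple part of
  \<open>x\<close>.\<close>

definition J :: "('a \<Rightarrow> 'a) \<Rightarrow> (complex \<times> complex) set" where
  "J x = {(a, r). \<exists>u. u \<noteq> 0 \<and> t u = a \<cdot> u \<and> ss x u = r \<cdot> u}"

lemma ss_component:
  assumes x: "x \<in> T" and u: "t u = a \<cdot> u"
  shows "t (proj (ss x) r u) = a \<cdot> proj (ss x) r u" "ss x (proj (ss x) r u) = r \<cdot> proj (ss x) r u"
proof -
  have c: "ss x (t v) = t (ss x v)" for v by (rule T_comm_t[OF ss_T[OF x]])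
  show "t (proj (ss x) r u) = a \<cdot> proj (ss x) r u"
    using proj_commute[OF T_lin[OF ss_T[OF x]] t_lin c, of r u]
    by (simp add: u lin_scale[OF lin_proj[OF T_lin[OF ss_T[OF x]]]])
  show "ss x (proj (ss x) r u) = r \<cdot> proj (ss x) r u"
    by (rule proj_in_eigenspace[OF ss_diag[OF x]])
qed

lemma evs_J:
  assumes x: "x \<in> T" and "a \<in> evs t" shows "\<exists>r. (a, r) \<in> J x"
proof -
  obtain u where u: "u \<noteq> 0" "t u = a \<cdot> u" using assms(2) unfolding evs_def by blast
  have "\<exists>r\<in>evs (ss x). proj (ss x) r u \<noteq> 0"
  proof (rule ccontr)
    assume "\<not> ?thesis"
    then have "(\<Sum>r\<in>evs (ss x). proj (ss x) r u) = 0" by simp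
    then show False using u(1) sum_proj[OF ss_diag[OF x]] by simp
  qed
  then show ?thesis using ss_component[OF x u(2)] unfolding J_def by blast
qed

lemma J_span:
  assumes x: "x \<in> T"
  shows "span {u. \<exists>a r. t u = a \<cdot> u \<and> ss x u = r \<cdot> u} = UNIV" (is "span ?S = UNIV")
proof -
  have "{v. \<exists>c. t v = c \<cdot> v} \<subseteq> span ?S"
  proof
    fix u assume "u \<in> {v. \<exists>c. t v = c \<cdot> v}"
    then obtain a where u: "t u = a \<cdot> u" by blast
    have "(\<Sum>r\<in>evs (ss x). proj (ss x) r u) \<in> span ?S"
      using ss_component[OF x u] by (intro span_sum span_base) blast
    then show "u \<in> span ?S" by (simp only: sum_proj[OF ss_diag[OF x]])
  qed
  then have "span {v. \<exists>c. t v = c \<cdot> v} \<subseteq> span ?S" by (rule span_minimal[OF _ subspace_span])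
  then show ?thesis using t_diag unfolding diag_def by auto
qed

text \<open>The analogue of \<open>diffs t\<close> for the pair of commuting operators
  \<open>t\<close> and \<open>ss x\<close>.\<close>

definition \<Delta> :: "('a \<Rightarrow> 'a) \<Rightarrow> (complex \<times> complex) set" where
  "\<Delta> x = (\<lambda>((a, r), (b, q)). (a - b, r - q)) ` (J x \<times> J x)"

lemma finite_J: "x \<in> T \<Longrightarrow> finite (J x)"
proof (rule finite_subset)
  show "J x \<subseteq> evs t \<times> evs (ss x)" unfolding J_def evs_def by blast
  assume "x \<in> T" then show "finite (evs t \<times> evs (ss x))"
    using finite_evs[OF t_lin] finite_evs[OF T_lin[OF ss_T]] by simp
qed

text \<open>A generic combination of \<open>t\<close> and \<open>ss x\<close> separates all pairs in \<open>\<Delta> x\<close>, so the maximality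
  of \<open>t\<close> forces the first component to determine the second.\<close>

lemma \<Delta>_fst_inj:
  assumes x: "x \<in> T" shows "inj_on fst (\<Delta> x)"
proof -
  let ?D = "\<Delta> x"
  have finD: "finite ?D" unfolding \<Delta>_def using finite_J[OF x] by simp
  \<comment> \<open>These are the \<open>\<epsilon>\<close> for which
    \<open>d + \<epsilon> * q\<close> can agree at two pairs with different second entries. Pairs
    with equal second entries contribute only 0, the value of a division by zero.\<close>
  define Bad where "Bad = (\<lambda>((d, q), (d', q')). (d' - d) / (q - q')) ` (?D \<times> ?D)"
  have "finite Bad" unfolding Bad_def using finD by simp
  then obtain \<epsilon> where eps: "\<epsilon> \<notin> Bad" using ex_new_if_finite[OF infinite_UNIV_char_0] by blast
  let ?f = "\<lambda>(d, q). d + \<epsilon> * q"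
  have inj: "inj_on ?f ?D"
  proof (rule inj_onI)
    fix p p' assume p: "p \<in> ?D" "p' \<in> ?D" and eq: "?f p = ?f p'"
    obtain d q d' q' where pq: "p = (d, q)" "p' = (d', q')" by (cases p, cases p')
    have "q = q'"
    proof (rule ccontr)
      assume "q \<noteq> q'"
      then have "\<epsilon> = (d' - d) / (q - q')" using eq pq by (simp add: field_simps)
      then have "\<epsilon> \<in> Bad" unfolding Bad_def using p pq by force
      then show False using eps by simp
    qed
    then show "p = p'" using eq pq by simp
  qed
  define t' where "t' = (\<lambda>v. t v + \<epsilon> \<cdot> ss x v)"
  have t'_eig: "t' u = (a + \<epsilon> * r) \<cdot> u" if "t u = a \<cdot> u" "ss x u = r \<cdot> u" for u a r
    using that by (simp add: t'_def scale_left_distrib)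
  have t'_der: "t' \<in> der" unfolding t'_def
    by (rule der_closed(3)[OF t_der der_closed(4)[OF T_der[OF ss_T[OF x]]]])
  have "diag t'" unfolding diag_def
  proof
    show "lin t'" by (rule der_lin[OF t'_der])
    have "{u. \<exists>a r. t u = a \<cdot> u \<and> ss x u = r \<cdot> u} \<subseteq> {v. \<exists>c. t' v = c \<cdot> v}" using t'_eig by blast
    from span_mono[OF this] show "span {v. \<exists>c. t' v = c \<cdot> v} = UNIV" unfolding J_span[OF x] by auto
  qed
  have "?f ` ?D \<subseteq> diffs t'"
  proof
    fix z assume "z \<in> ?f ` ?D"
    then obtain a r b q where J: "(a, r) \<in> J x" "(b, q) \<in> J x" and z: "z = (a - b) + \<epsilon> * (r - q)"
      unfolding \<Delta>_def by auto
    have "a + \<epsilon> * r \<in> evs t'" "b + \<epsilon> * q \<in> evs t'"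
      using J t'_eig unfolding J_def evs_def by blast+
    then show "z \<in> diffs t'" unfolding diffs_def z by (force simp: algebra_simps)
  qed
  then have "card (?f ` ?D) \<le> card (diffs t')"
    by (rule card_mono[OF finite_diffs[OF der_lin[OF t'_der]]])
  then have "card ?D \<le> card (diffs t)"
    using card_image[OF inj] maximal[OF t'_der \<open>diag t'\<close>] by simp
  also have "diffs t \<subseteq> fst ` ?D"
  proof
    fix z assume "z \<in> diffs t"
    then obtain a b where ab: "a \<in> evs t" "b \<in> evs t" "z = a - b" unfolding diffs_def by auto
    then obtain r q where "(a, r) \<in> J x" "(b, q) \<in> J x" using evs_J[OF x] by blast
    then show "z \<in> fst ` ?D" unfolding \<Delta>_def ab(3) by force
  qed
  then have "card (diffs t) \<le> card (fst ` ?D)" using finD by (intro card_mono) auto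
  finally have "card (fst ` ?D) = card ?D" using card_image_le[OF finD, of fst] by simp
  then show ?thesis using finD by (simp add: eq_card_imp_inj_on)
qed

text \<open>The eigenvalue of \<open>ss x\<close> on the \<open>a\<close>-eigenspace of
  \<open>t\<close>, meaningful for \<open>a \<in> evs t\<close>; \<open>J_wt\<close> shows that
  there is only one.\<close>

definition wt :: "('a \<Rightarrow> 'a) \<Rightarrow> complex \<Rightarrow> complex" where
  "wt x a = (SOME r. (a, r) \<in> J x)"

lemma wt_in_J: "\<lbrakk>x \<in> T; a \<in> evs t\<rbrakk> \<Longrightarrow> (a, wt x a) \<in> J x"
  unfolding wt_def by (rule someI_ex[OF evs_J])

text \<open>The first entry of a pair in \<open>\<Delta> x\<close> determines the second. This gives
  an operator that is homogeneous for \<open>t\<close> a well-defined weight under all of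
  \<open>T\<close>.\<close>

lemma J_diff:
  assumes x: "x \<in> T" and "(a, r) \<in> J x" "(b, q) \<in> J x" "(a', r') \<in> J x" "(b', q') \<in> J x" "a - b = a' - b'"
  shows "r - q = r' - q'"
proof -
  have "(a - b, r - q) \<in> \<Delta> x" "(a' - b', r' - q') \<in> \<Delta> x" unfolding \<Delta>_def using assms by force+
  then show ?thesis using \<Delta>_fst_inj[OF x] assms(6) unfolding inj_on_def by fastforce
qed

lemma J_wt: "\<lbrakk>x \<in> T; (a, r) \<in> J x\<rbrakk> \<Longrightarrow> r = wt x a"
proof -
  assume x: "x \<in> T" and J: "(a, r) \<in> J x"
  then have "a \<in> evs t" unfolding J_def evs_def by blast
  from J_diff[OF x J J wt_in_J[OF x this] J] show ?thesis by simp
qed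

lemma ss_eigen:
  assumes x: "x \<in> T" and u: "t u = a \<cdot> u" shows "ss x u = wt x a \<cdot> u"
proof -
  note l = T_lin[OF ss_T[OF x]] and s = sum_proj[OF ss_diag[OF x], of u]
  have "ss x (proj (ss x) r u) = wt x a \<cdot> proj (ss x) r u" for r
  proof (cases "proj (ss x) r u = 0")
    case True then show ?thesis using lin_zero[OF l] by simp
  next
    case False
    then have "(a, r) \<in> J x" using ss_component[OF x u] unfolding J_def by blast
    from J_wt[OF x this] show ?thesis using ss_component(2)[OF x u, of r] by simp
  qed
  then have "ss x (\<Sum>r\<in>evs (ss x). proj (ss x) r u) = wt x a \<cdot> (\<Sum>r\<in>evs (ss x). proj (ss x) r u)"
    by (simp add: lin_sum[OF l] scale_sum_right)
  then show ?thesis by (simp only: s)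
qed

section \<open>Nilpotent elements of the centraliser vanish\<close>

definition nilT :: "('a \<Rightarrow> 'a) set" where
  "nilT = {x \<in> T. nilp x}"

lemma lin_projt: "lin (proj t a)"
  by (rule lin_proj[OF t_lin])

lemma T_comm_proj: "x \<in> T \<Longrightarrow> x (proj t a v) = proj t a (x v)"
  by (rule proj_commute[OF t_lin T_lin, symmetric]) (auto simp: T_comm_t)

text \<open>On each eigenspace of \<open>t\<close> an element of \<open>T\<close> has a single
  eigenvalue, so nilpotency is the vanishing of finitely many traces. This linear description makes
  \<open>nilT\<close> a Lie algebra to which Engel's theorem applies.\<close>

lemma nilp_iff_tr:
  assumes x: "x \<in> T"
  shows "nilp x \<longleftrightarrow> (\<forall>a\<in>evs t. tr (\<lambda>v. x (proj t a v)) = 0)"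
proof
  assume n: "nilp x"
  show "\<forall>a\<in>evs t. tr (\<lambda>v. x (proj t a v)) = 0"
    by (intro ballI tr_nilp lin_comp[OF T_lin[OF x] lin_projt] nilp_comp_commute[OF lin_projt n] T_comm_proj[OF x])
next
  assume z: "\<forall>a\<in>evs t. tr (\<lambda>v. x (proj t a v)) = 0"
  let ?n = "\<lambda>v. x v - ss x v"
  note l = T_lin[OF x] and ls = T_lin[OF ss_T[OF x]]
  have "wt x a = 0" if a: "a \<in> evs t" for a
  proof -
    have "nilp (\<lambda>v. x (proj t a v) - ss x (proj t a v))"
      by (rule nilp_comp_commute[OF lin_projt nilp_minus_fc[OF l, folded ss_def]])
         (simp add: T_comm_proj[OF x] T_comm_proj[OF ss_T[OF x]] lin_diff[OF lin_projt])
    then have "tr (\<lambda>v. x (proj t a v) - ss x (proj t a v)) = 0"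
      by (rule tr_nilp[OF lin_sub[OF lin_comp[OF l lin_projt] lin_comp[OF ls lin_projt]]])
    then have "tr (\<lambda>v. ss x (proj t a v)) = 0" using z a by (simp add: tr_diff)
    then have "wt x a * tr (\<lambda>v. proj t a v) = 0"
      by (simp add: ss_eigen[OF x proj_in_eigenspace[OF t_diag]] tr_scale)
    then show ?thesis using tr_proj_nonzero[OF t_diag a] by simp
  qed
  then have "ss x v = 0" if "t v = a \<cdot> v" for v a
    using ss_eigen[OF x that] that unfolding evs_def by (cases "v = 0") auto
  then have "ss x = (\<lambda>v. 0)" by (rule diag_eqI[OF t_diag ls lin_const0])
  then show "nilp x" unfolding ss_def by (rule fc_id_zero_iff_nilp[OF l])
qed

lemma lie_space_T: "lie_space T"
  unfolding lie_space_def
proof (intro conjI ballI allI)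
  fix x y c assume x: "x \<in> T" and y: "y \<in> T"
  note d = T_der[OF x] T_der[OF y] and s = lin_simps[OF t_lin] T_comm_t[OF x] T_comm_t[OF y]
  show "(\<lambda>v. x v + y v) \<in> T" unfolding T_def using der_closed(3)[OF d] by (simp add: s)
  show "(\<lambda>v. c \<cdot> x v) \<in> T" unfolding T_def using der_closed(4)[OF d(1)] by (simp add: s)
  show "op_comm x y \<in> T" unfolding T_def using der_closed(5)[OF d] by (simp add: s op_comm_def)
next
  show "(\<lambda>v. 0) \<in> T" unfolding T_def using der_closed(2) by (simp add: lin_zero[OF t_lin])
qed (rule T_lin)

lemmas T_closed = lie_spaceD[OF lie_space_T] and T_diff = lie_space_diff[OF lie_space_T]

lemma lie_space_nilT: "lie_space nilT"
  unfolding lie_space_def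
proof (intro conjI ballI allI)
  fix x y c assume "x \<in> nilT" and "y \<in> nilT"
  then have x: "x \<in> T" "nilp x" and y: "y \<in> T" "nilp y" unfolding nilT_def by simp_all
  have tx: "tr (\<lambda>v. x (proj t a v)) = 0" and ty: "tr (\<lambda>v. y (proj t a v)) = 0" if "a \<in> evs t" for a
    using that x y nilp_iff_tr[OF x(1)] nilp_iff_tr[OF y(1)] by blast+
  show "(\<lambda>v. x v + y v) \<in> nilT"
    unfolding nilT_def using T_closed(3)[OF x(1) y(1)] nilp_iff_tr[OF T_closed(3)[OF x(1) y(1)]]
    by (simp add: tr_add tx ty)
  show "(\<lambda>v. c \<cdot> x v) \<in> nilT"
    unfolding nilT_def using T_closed(4)[OF x(1)] nilp_iff_tr[OF T_closed(4)[OF x(1)]]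
    by (simp add: tr_scale tx)
  have "tr (\<lambda>v. op_comm x y (proj t a v)) = 0" for a
  proof -
    have "tr (\<lambda>v. op_comm x y (proj t a v)) = tr (\<lambda>v. x (op_comm y (proj t a) v))"
      by (rule tr_comm_mult[OF T_lin[OF x(1)] T_lin[OF y(1)] lin_projt])
    then show ?thesis by (simp add: op_comm_def T_comm_proj[OF y(1)] lin_zero[OF T_lin[OF x(1)]])
  qed
  then show "op_comm x y \<in> nilT"
    unfolding nilT_def using T_closed(5)[OF x(1) y(1)] nilp_iff_tr[OF T_closed(5)[OF x(1) y(1)]] by simp
next
  show "(\<lambda>v. 0) \<in> nilT" unfolding nilT_def using T_closed(2) unfolding nilp_def
    by (auto intro: exI[of _ 1])
qed (auto simp: nilT_def intro: T_lin)

text \<open>Against \<open>n\<close>, only the part of \<open>y\<close> commuting with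
  \<open>t\<close> contributes to the trace. Its semisimple part is scalar on eigenspaces of
  \<open>t\<close> and so commutes with \<open>n\<close>; its nilpotent part lies in
  \<open>nilT\<close>, where products are nilpotent. So \<open>n\<close> is orthogonal to
  \<open>der\<close>.\<close>

lemma nilT_zero:
  assumes "n \<in> nilT" shows "n = (\<lambda>v. 0)"
proof -
  have n: "n \<in> T" "nilp n" using assms unfolding nilT_def by simp_all
  note ln = T_lin[OF n(1)]
  show ?thesis
  proof (rule trace_form_nondegenerate[OF T_der[OF n(1)]])
    fix y assume y: "y \<in> der"
    let ?y = "homcomp t 0 y"
    have hd: "?y \<in> der" by (rule homcomp_der[OF t_der t_diag y])
    have "(\<lambda>v. ?y (t v)) = (\<lambda>v. t (?y v))"
    proof (rule diag_eqI[OF t_diag lin_comp[OF der_lin[OF hd] t_lin] lin_comp[OF t_lin der_lin[OF hd]]])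
      fix c v assume v: "t v = c \<cdot> v"
      show "?y (t v) = t (?y v)"
        using homcomp_degree[OF t_diag der_lin[OF y] v, of 0] by (simp add: v lin_scale[OF der_lin[OF hd]])
    qed
    then have y0: "?y \<in> T" unfolding T_def using hd by (simp add: fun_eq_iff)
    note ls = T_lin[OF ss_T[OF y0]] and ly = T_lin[OF y0]
    have "tr (\<lambda>v. n (y v)) = tr (\<lambda>v. n (?y v))"
      using tr_homcomp[OF t_diag ln _ der_lin[OF y], of 0] by (simp add: T_comm_t[OF n(1)])
    also have "\<dots> = tr (\<lambda>v. n (?y v - ss ?y v)) + tr (\<lambda>v. n (ss ?y v))"
      by (simp add: lin_diff[OF ln] tr_diff)
    also have "tr (\<lambda>v. n (ss ?y v)) = 0"
    proof (rule tr_nilp[OF lin_comp[OF ln ls]], rule nilp_comp_commute[OF ls n(2)])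
      have "(\<lambda>v. n (ss ?y v)) = (\<lambda>v. ss ?y (n v))"
      proof (rule diag_eqI[OF t_diag lin_comp[OF ln ls] lin_comp[OF ls ln]])
        fix c v assume v: "t v = c \<cdot> v"
        have "t (n v) = c \<cdot> n v" by (simp add: T_comm_t[OF n(1), symmetric] v lin_scale[OF ln])
        from ss_eigen[OF y0 this] show "n (ss ?y v) = ss ?y (n v)"
          by (simp add: ss_eigen[OF y0 v] lin_scale[OF ln])
      qed
      then show "n (ss ?y v) = ss ?y (n v)" for v by (rule fun_cong)
    qed
    also have "tr (\<lambda>v. n (?y v - ss ?y v)) = 0"
    proof (rule tr_nilp[OF lin_comp[OF ln lin_sub[OF ly ls]]])
      have "(\<lambda>v. ?y v - ss ?y v) \<in> nilT"
        unfolding nilT_def using T_diff[OF y0 ss_T[OF y0]] nilp_minus_fc[OF ly] by (simp add: ss_def)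
      from engel_nilp_comp[OF lie_space_nilT _ assms this]
      show "nilp (\<lambda>v. n (?y v - ss ?y v))" by (simp add: nilT_def)
    qed
    finally show "tr (\<lambda>v. n (y v)) = 0" by simp
  qed
qed

lemma T_ss: "x \<in> T \<Longrightarrow> ss x = x"
proof -
  assume x: "x \<in> T"
  have "(\<lambda>v. x v - ss x v) \<in> nilT"
    unfolding nilT_def using T_diff[OF x ss_T[OF x]] nilp_minus_fc[OF T_lin[OF x]] by (simp add: ss_def)
  from nilT_zero[OF this] show ?thesis by (simp add: fun_eq_iff)
qed

lemma T_scalar: "\<lbrakk>x \<in> T; t u = a \<cdot> u\<rbrakk> \<Longrightarrow> x u = wt x a \<cdot> u"
  using ss_eigen T_ss by simp

section \<open>Weight vectors and root vectors\<close>

lemma t_T: "t \<in> T"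
  unfolding T_def using t_der by simp

text \<open>Weights are functions on all operators of which only the values on \<open>T\<close>
  matter, so they are compared on \<open>T\<close> (\<open>wv_cong\<close>). The vector 0 has every
  weight.\<close>

definition wv :: "'a \<Rightarrow> (('a \<Rightarrow> 'a) \<Rightarrow> complex) \<Rightarrow> bool" where
  "wv v \<nu> \<longleftrightarrow> (\<forall>x\<in>T. x v = \<nu> x \<cdot> v)"

text \<open>Here \<open>\<alpha>\<close> may also vanish on \<open>T\<close>; then \<open>e\<close>
  lies in \<open>T\<close> (\<open>rv_T\<close>).\<close>

definition rv :: "('a \<Rightarrow> 'a) \<Rightarrow> (('a \<Rightarrow> 'a) \<Rightarrow> complex) \<Rightarrow> bool" where
  "rv e \<alpha> \<longleftrightarrow> e \<in> der \<and> (\<forall>x\<in>T. \<forall>v. x (e v) = e (x v) + \<alpha> x \<cdot> e v)"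

lemma wvD: "\<lbrakk>wv v \<nu>; x \<in> T\<rbrakk> \<Longrightarrow> x v = \<nu> x \<cdot> v"
  by (simp add: wv_def)

lemma rv_der: "rv e \<alpha> \<Longrightarrow> e \<in> der" and rv_lin: "rv e \<alpha> \<Longrightarrow> lin e"
  and rvD: "\<lbrakk>rv e \<alpha>; x \<in> T\<rbrakk> \<Longrightarrow> x (e v) = e (x v) + \<alpha> x \<cdot> e v"
  by (auto simp: rv_def intro: der_lin)

lemma span_wv: "span {v. \<exists>\<nu>. wv v \<nu>} = UNIV"
proof -
  have "{v. \<exists>c. t v = c \<cdot> v} \<subseteq> {v. \<exists>\<nu>. wv v \<nu>}"
  proof
    fix v assume "v \<in> {v. \<exists>c. t v = c \<cdot> v}"
    then obtain c where "t v = c \<cdot> v" by blast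
    then have "wv v (\<lambda>x. wt x c)" unfolding wv_def by (simp add: T_scalar)
    then show "v \<in> {v. \<exists>\<nu>. wv v \<nu>}" by blast
  qed
  from span_mono[OF this] show ?thesis using t_diag unfolding diag_def by auto
qed

text \<open>Nondegeneracy supplies \<open>y\<close> with nonzero trace against \<open>e\<close>, and
  its part of degree \<open>- \<alpha> t\<close> keeps that trace. By \<open>J_diff\<close> this
  part shifts all weights by one \<open>\<beta>\<close>, and cyclicity of the trace forces
  \<open>\<beta> = - \<alpha>\<close> on \<open>T\<close>.\<close>

lemma opposite_root:
  assumes e: "rv e \<alpha>" and "e \<noteq> (\<lambda>v. 0)"
  obtains f where "rv f (\<lambda>x. - \<alpha> x)" "tr (\<lambda>v. e (f v)) \<noteq> 0"
proof -
  note ed = rv_der[OF e] and le = rv_lin[OF e]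
  obtain y where y: "y \<in> der" "tr (\<lambda>v. e (y v)) \<noteq> 0"
    using trace_form_nondegenerate[OF ed] assms(2) by blast
  define \<rho> where "\<rho> = \<alpha> t"
  define f where "f = homcomp t (- \<rho>) y"
  have fd: "f \<in> der" unfolding f_def by (rule homcomp_der[OF t_der t_diag y(1)])
  note lf = der_lin[OF fd]
  have tr: "tr (\<lambda>v. e (f v)) \<noteq> 0"
    unfolding f_def using tr_homcomp[OF t_diag le _ der_lin[OF y(1)], of \<rho>] rvD[OF e t_T] y(2)
    by (simp add: \<rho>_def)
  have deg: "t (f v) = (a - \<rho>) \<cdot> f v" if "t v = a \<cdot> v" for v a
    unfolding f_def using homcomp_degree[OF t_diag der_lin[OF y(1)] that, of "- \<rho>"] by simp
  have "\<exists>u a. t u = a \<cdot> u \<and> f u \<noteq> 0"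
  proof (rule ccontr)
    assume "\<not> ?thesis"
    then have "f = (\<lambda>v. 0)" by (intro diag_eqI[OF t_diag lf lin_const0]) blast
    then show False using tr by (simp add: lin_zero[OF le])
  qed
  then obtain u0 a0 where u0: "t u0 = a0 \<cdot> u0" "f u0 \<noteq> 0" by blast
  have ev: "a \<in> evs t" "a - \<rho> \<in> evs t" if "t u = a \<cdot> u" "f u \<noteq> 0" for u a
    using that deg[OF that(1)] lin_zero[OF lf] unfolding evs_def by (cases "u = 0"; auto)+
  define \<beta> where "\<beta> x = wt x (a0 - \<rho>) - wt x a0" for x
  have comm: "x (f v) = f (x v) + \<beta> x \<cdot> f v" if x: "x \<in> T" for x v
  proof -
    note lx = T_lin[OF x]
    have "(\<lambda>v. x (f v)) = (\<lambda>v. f (x v) + \<beta> x \<cdot> f v)"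
    proof (rule diag_eqI[OF t_diag lin_comp[OF lx lf] lin_plus[OF lin_comp[OF lf lx] lin_smult[OF lf]]])
      fix a u assume u: "t u = a \<cdot> u"
      show "x (f u) = f (x u) + \<beta> x \<cdot> f u"
      proof (cases "f u = 0")
        case True
        then show ?thesis using u by (simp add: T_scalar[OF x u] lin_scale[OF lf] lin_zero[OF lx])
      next
        case False
        have "wt x (a - \<rho>) - wt x a = \<beta> x"
          unfolding \<beta>_def
          by (rule J_diff[OF x wt_in_J[OF x ev(2)[OF u False]] wt_in_J[OF x ev(1)[OF u False]]
                wt_in_J[OF x ev(2)[OF u0]] wt_in_J[OF x ev(1)[OF u0]]]) simp
        then have "wt x (a - \<rho>) = wt x a + \<beta> x" by (simp add: algebra_simps)
        then show ?thesis
          by (simp add: T_scalar[OF x deg[OF u]] T_scalar[OF x u] lin_scale[OF lf] scale_left_distrib)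
      qed
    qed
    then show ?thesis by (rule fun_cong)
  qed
  have "\<beta> x = - \<alpha> x" if x: "x \<in> T" for x
  proof -
    note lx = T_lin[OF x] and lef = lin_comp[OF le lf]
    have "x (e (f v)) = e (f (x v)) + (\<alpha> x + \<beta> x) \<cdot> e (f v)" for v
      by (simp add: rvD[OF e x] comm[OF x] lin_add[OF le] lin_scale[OF le] scale_left_distrib)
    then have "tr (\<lambda>v. x (e (f v))) = tr (\<lambda>v. e (f (x v))) + (\<alpha> x + \<beta> x) * tr (\<lambda>v. e (f v))"
      by (simp add: tr_add tr_scale)
    moreover have "tr (\<lambda>v. x (e (f v))) = tr (\<lambda>v. e (f (x v)))" by (rule tr_commute[OF lx lef])
    ultimately have "(\<alpha> x + \<beta> x) * tr (\<lambda>v. e (f v)) = 0" by simp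
    then have "\<alpha> x + \<beta> x = 0" using tr by simp
    then show ?thesis by (simp add: eq_neg_iff_add_eq_0 add.commute)
  qed
  then have "rv f (\<lambda>x. - \<alpha> x)" unfolding rv_def using fd comm by simp
  then show ?thesis using that tr by blast
qed

end

section \<open>Roots\<close>

context fd_space begin

definition triple :: "('a \<Rightarrow> 'a) \<Rightarrow> ('a \<Rightarrow> 'a) \<Rightarrow> ('a \<Rightarrow> 'a) \<Rightarrow> bool" where
  "triple e f h \<longleftrightarrow> lin e \<and> lin f \<and> lin h \<and> (\<forall>v. e (f v) = f (e v) + h v) \<and>
     (\<forall>v. h (e v) = e (h v) + 2 \<cdot> e v) \<and> (\<forall>v. h (f v) = f (h v) - 2 \<cdot> f v)"

lemma tripleD:
  assumes "triple e f h"
  shows "lin e" "lin f" "lin h" "e (f v) = f (e v) + h v" "h (e v) = e (h v) + 2 \<cdot> e v"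
    "h (f v) = f (h v) - 2 \<cdot> f v"
  using assms[unfolded triple_def] by blast+

lemma not_all_eigen:
  assumes h: "lin h" and d: "d \<noteq> 0" and eig: "\<And>j. h (w j) = (c + of_nat j * d) \<cdot> w j"
  shows "\<exists>j::nat. w j = 0"
proof (rule ccontr)
  assume "\<not> ?thesis"
  then have "range (\<lambda>j::nat. c + of_nat j * d) \<subseteq> evs h"
    using eig unfolding evs_def by blast
  then have "finite (range (\<lambda>j::nat. c + of_nat j * d))" using finite_evs[OF h] finite_subset by blast
  moreover have "inj (\<lambda>j::nat. c + of_nat j * d)" using d by (intro injI) simp
  ultimately show False using finite_imageD[of _ "UNIV :: nat set"] by auto
qed

text \<open>Unless \<open>c\<close> is natural, the coefficients \<open>(j + 1) * (c - j)\<close>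
  keep the string \<open>(f ^^ j) y\<close> from ending, against finiteness of the spectrum of
  \<open>h\<close>. The form \<open>f (e y) = 0\<close> instead of \<open>e y = 0\<close> serves
  \<open>start_sl2\<close>, where \<open>e\<close> does not kill the vector.\<close>

lemma sl2_nat:
  assumes tr: "triple e f h" and y: "h y = c \<cdot> y" "f (e y) = 0" "y \<noteq> 0"
  shows "c \<in> \<nat>"
proof (rule ccontr)
  assume c: "c \<notin> \<nat>"
  note le = tripleD(1)[OF tr] and lf = tripleD(2)[OF tr] and lh = tripleD(3)[OF tr] and R = tripleD(4-)[OF tr]
  define w where "w j = (f ^^ j) y" for j
  have wS: "w (Suc j) = f (w j)" for j by (simp add: w_def)
  have eig: "h (w j) = (c + of_nat j * (- 2)) \<cdot> w j" for j
  proof (induction j)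
    case 0 then show ?case using y by (simp add: w_def)
  next
    case (Suc j)
    have "h (w (Suc j)) = (c + of_nat j * (- 2)) \<cdot> w (Suc j) - 2 \<cdot> w (Suc j)"
      by (simp only: wS R(3) Suc lin_scale[OF lf])
    then show ?case by (simp only: scale_left_diff_distrib[symmetric]) (simp add: algebra_simps)
  qed
  have up: "e (w (Suc j)) = ((of_nat j + 1) * (c - of_nat j)) \<cdot> w j" for j
  proof (induction j)
    case 0 then show ?case using y by (simp add: w_def R(1))
  next
    case (Suc j)
    have "e (w (Suc (Suc j))) = f (e (w (Suc j))) + h (w (Suc j))" by (simp only: wS[of "Suc j"] R(1))
    also have "\<dots> = ((of_nat j + 1) * (c - of_nat j)) \<cdot> w (Suc j) + (c + of_nat (Suc j) * (- 2)) \<cdot> w (Suc j)"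
      by (simp only: Suc lin_scale[OF lf] eig wS[symmetric])
    also have "\<dots> = ((of_nat (Suc j) + 1) * (c - of_nat (Suc j))) \<cdot> w (Suc j)"
      by (simp only: scale_left_distrib[symmetric]) (simp add: algebra_simps)
    finally show ?case .
  qed
  have "w j \<noteq> 0" for j
  proof (induction j)
    case 0 then show ?case using y by (simp add: w_def)
  next
    case (Suc j)
    have "c \<noteq> of_nat j" using c by auto
    moreover have "of_nat j + 1 \<noteq> (0 :: complex)" by (metis of_nat_Suc of_nat_eq_0_iff add.commute nat.distinct(1))
    ultimately have "e (w (Suc j)) \<noteq> 0" using Suc unfolding up by simp
    then show ?case using lin_zero[OF le] by auto
  qed
  then show False using not_all_eigen[OF lh _ eig] by auto
qed

lemma sl2_highest:
  assumes tr: "triple e f h" and y: "h y = c \<cdot> y" "e y = 0" "y \<noteq> 0" shows "c \<in> \<nat>"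
  by (rule sl2_nat[OF tr y(1) _ y(3)]) (simp add: y(2) lin_zero[OF tripleD(2)[OF tr]])

lemma minus_numeral_not_Nats: "- numeral n \<notin> (\<nat> :: complex set)" "- 1 \<notin> (\<nat> :: complex set)"
proof -
  have "Re z \<ge> 0" if "z \<in> \<nat>" for z :: complex using that by (auto elim!: Nats_cases)
  then show "- numeral n \<notin> (\<nat> :: complex set)" "- 1 \<notin> (\<nat> :: complex set)" by fastforce+
qed

lemma sl2_trivial:
  assumes tr: "triple e f h" and y: "h y = 0" "e y = 0" shows "f y = 0"
proof (rule ccontr)
  assume n: "f y \<noteq> 0"
  have "h (f y) = (- 2) \<cdot> f y" "e (f y) = 0"
    using y by (simp_all add: tripleD(4-)[OF tr] lin_zero[OF tripleD(2)[OF tr]])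
  from sl2_highest[OF tr this n] show False using minus_numeral_not_Nats by simp
qed

text \<open>Raising by \<open>e\<close> ends at a highest weight vector, whose weight is natural and
  differs from \<open>c\<close> by an even integer. In \<open>coroots_equal\<close> reality
  identifies \<open>fc d cnj\<close> with \<open>d\<close>.\<close>

lemma sl2_real:
  assumes tr: "triple e f h" and y: "h y = c \<cdot> y" "y \<noteq> 0"
  shows "c \<in> \<real>"
proof -
  note le = tripleD(1)[OF tr] and lh = tripleD(3)[OF tr] and R = tripleD(4-)[OF tr]
  define w where "w j = (e ^^ j) y" for j
  have wS: "w (Suc j) = e (w j)" for j by (simp add: w_def)
  have eig: "h (w j) = (c + of_nat j * 2) \<cdot> w j" for j
  proof (induction j)
    case 0 then show ?case using y by (simp add: w_def)
  next
    case (Suc j)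
    have "h (w (Suc j)) = (c + of_nat j * 2) \<cdot> w (Suc j) + 2 \<cdot> w (Suc j)"
      by (simp only: wS R(2) Suc lin_scale[OF le])
    then show ?case by (simp only: scale_left_distrib[symmetric]) (simp add: algebra_simps)
  qed
  obtain j where j: "w j = 0" using not_all_eigen[OF lh _ eig] by auto
  define m where "m = (LEAST j. w j = 0)"
  have m: "w m = 0" unfolding m_def using j by (rule LeastI)
  have "m \<noteq> 0" using m y(2) by (cases "m = 0") (simp_all add: w_def)
  then obtain i where i: "m = Suc i" by (rule not0_implies_Suc[THEN exE])
  have "w i \<noteq> 0" using not_less_Least[of i "\<lambda>j. w j = 0"] i unfolding m_def by simp
  moreover have "e (w i) = 0" using m i wS by simp
  ultimately have "c + of_nat i * 2 \<in> \<nat>" using sl2_highest[OF tr eig] by blast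
  then have "c + of_nat i * 2 \<in> \<real>" by (auto elim!: Nats_cases)
  moreover have "of_nat i * 2 \<in> (\<real> :: complex set)" by simp
  ultimately show ?thesis using Reals_diff by fastforce
qed

end

section \<open>sl2-triples of roots and comparison of coroots\<close>

context torus begin

lemma rv_apply:
  assumes e: "rv e \<alpha>" and v: "wv v \<nu>" shows "wv (e v) (\<lambda>x. \<nu> x + \<alpha> x)"
  unfolding wv_def
proof
  fix x assume x: "x \<in> T"
  show "x (e v) = (\<nu> x + \<alpha> x) \<cdot> e v"
    by (simp add: rvD[OF e x] wvD[OF v x] lin_scale[OF rv_lin[OF e]] scale_left_distrib)
qed

lemma rv_ad:
  assumes "wv a \<sigma>" "wv b \<tau>" shows "rv (ad a b) (\<lambda>x. \<sigma> x + \<tau> x)"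
  unfolding rv_def
proof (intro conjI ballI allI ad_in_der)
  fix x v assume x: "x \<in> T"
  show "x (ad a b v) = ad a b (x v) + (\<sigma> x + \<tau> x) \<cdot> ad a b v"
    by (simp add: der_comm_ad[OF T_der[OF x]] wvD[OF assms(1) x] wvD[OF assms(2) x])
       (simp add: ad_def br_simps scale_left_distrib add_ac)
qed

lemma wv_cong: "\<lbrakk>wv v \<nu>; \<And>x. x \<in> T \<Longrightarrow> \<nu> x = \<mu> x\<rbrakk> \<Longrightarrow> wv v \<mu>"
  by (simp add: wv_def)

lemma rv_T:
  assumes "rv x \<alpha>" "\<And>y. y \<in> T \<Longrightarrow> \<alpha> y = 0" shows "x \<in> T"
  using assms(2)[OF t_T] rvD[OF assms(1) t_T] rv_der[OF assms(1)] unfolding T_def by simp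

lemma rv_comm:
  assumes e: "rv e \<alpha>" and f: "rv f \<beta>" shows "rv (op_comm e f) (\<lambda>x. \<alpha> x + \<beta> x)"
  unfolding rv_def
proof (intro conjI ballI allI)
  show "op_comm e f \<in> der" by (rule der_closed(5)[OF rv_der[OF e] rv_der[OF f]])
  fix x v assume x: "x \<in> T"
  note le = rv_lin[OF e] and lf = rv_lin[OF f] and lx = T_lin[OF x]
  show "x (op_comm e f v) = op_comm e f (x v) + (\<alpha> x + \<beta> x) \<cdot> op_comm e f v"
    by (simp add: op_comm_def lin_diff[OF lx] rvD[OF e x] rvD[OF f x] lin_add[OF le] lin_add[OF lf]
        lin_scale[OF le] lin_scale[OF lf] scale_left_distrib scale_right_diff_distrib algebra_simps)
qed

lemma T_eq_on_wv:
  assumes "lin f" "lin g" "\<And>v \<nu>. wv v \<nu> \<Longrightarrow> f v = g v" shows "f = g"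
  by (rule lin_eq_on_span[OF assms(1,2) span_wv]) (use assms(3) in blast)

text \<open>The point is \<open>\<alpha> h0 \<noteq> 0\<close>, which permits rescaling to the value
  2. Otherwise \<open>h0\<close>, and with it \<open>fc h0 cnj\<close>, would commute with
  \<open>e\<close>; then \<open>h0\<close> would be orthogonal to its own conjugate and vanish,
  contradicting its trace against \<open>x0\<close>. Up to the factor \<open>\<kappa>\<close>,
  \<open>h\<close> represents \<open>\<alpha>\<close> in the trace form.\<close>

lemma root_sl2:
  assumes e: "rv e \<alpha>" and nz: "e \<noteq> (\<lambda>v. 0)" and x0: "x0 \<in> T" "\<alpha> x0 \<noteq> 0"
  obtains f h \<kappa> where "rv f (\<lambda>x. - \<alpha> x)" "h \<in> T" "triple e f h" "\<kappa> \<noteq> 0" "\<alpha> h = 2"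
    "\<forall>x\<in>T. tr (\<lambda>v. h (x v)) = \<kappa> * \<alpha> x"
proof -
  note le = rv_lin[OF e]
  obtain f0 where f0: "rv f0 (\<lambda>x. - \<alpha> x)" "tr (\<lambda>v. e (f0 v)) \<noteq> 0" using opposite_root[OF e nz] by blast
  note lf0 = rv_lin[OF f0(1)]
  define \<kappa>0 where "\<kappa>0 = tr (\<lambda>v. e (f0 v))"
  define h0 where "h0 = op_comm e f0"
  have h0T: "h0 \<in> T" unfolding h0_def by (rule rv_T[OF rv_comm[OF e f0(1)]]) simp
  note lh0 = T_lin[OF h0T]
  have trh0: "tr (\<lambda>v. h0 (x v)) = \<kappa>0 * \<alpha> x" if x: "x \<in> T" for x
  proof -
    have "tr (\<lambda>v. h0 (x v)) = tr (\<lambda>v. e (op_comm f0 x v))"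
      unfolding h0_def by (rule tr_comm_mult[OF le lf0 T_lin[OF x]])
    also have "(\<lambda>v. e (op_comm f0 x v)) = (\<lambda>v. \<alpha> x \<cdot> e (f0 v))"
      by (simp add: op_comm_def rvD[OF f0(1) x] lin_scale[OF le] lin_minus[OF le] lin_diff[OF le] lin_add[OF le])
    finally show ?thesis by (simp add: tr_scale \<kappa>0_def)
  qed
  obtain v0 where v0: "e v0 \<noteq> 0" using nz by blast
  have a0: "\<alpha> h0 \<noteq> 0"
  proof
    assume z: "\<alpha> h0 = 0"
    have c: "h0 (e v) = e (h0 v)" for v using rvD[OF e h0T, of v] z by simp
    let ?c = "fc h0 cnj"
    have cT: "?c \<in> T" by (rule fc_T[OF h0T]) simp
    have "?c (e v0) = e (?c v0)" by (rule fc_commute[OF lh0 le c])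
    then have "\<alpha> ?c \<cdot> e v0 = 0" using rvD[OF e cT, of v0] by simp
    then have "\<alpha> ?c = 0" using v0 by simp
    then have "tr (\<lambda>v. h0 (?c v)) = 0" using trh0[OF cT] by simp
    then have "fc h0 (\<lambda>c. c) = (\<lambda>v. 0)"
      using T_ss[OF h0T] by (intro tr_fc_cnj[OF lh0]) (simp add: ss_def)
    then have "h0 = (\<lambda>v. 0)" using T_ss[OF h0T] by (simp add: ss_def)
    then show False using trh0[OF x0(1)] x0(2) f0(2) by (simp add: \<kappa>0_def)
  qed
  define s where "s = 2 / \<alpha> h0"
  define f where "f = (\<lambda>v. s \<cdot> f0 v)"
  define h where "h = (\<lambda>v. s \<cdot> h0 v)"
  have lf: "lin f" unfolding f_def by (rule lin_smult[OF lf0])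
  have hT: "h \<in> T" unfolding h_def by (rule T_closed(4)[OF h0T])
  have rf: "rv f (\<lambda>x. - \<alpha> x)" unfolding rv_def
  proof (intro conjI ballI allI)
    show "f \<in> der" unfolding f_def by (rule der_closed(4)[OF rv_der[OF f0(1)]])
    fix x v assume x: "x \<in> T"
    show "x (f v) = f (x v) + - \<alpha> x \<cdot> f v"
      by (simp add: f_def lin_scale[OF T_lin[OF x]] rvD[OF f0(1) x] scale_right_distrib scale_right_diff_distrib mult.commute)
  qed
  have ef: "e (f v) = f (e v) + h v" for v
    by (simp add: f_def h_def h0_def op_comm_def lin_scale[OF le] scale_right_diff_distrib)
  have he: "h (e v) = e (h v) + 2 \<cdot> e v" for v
    using a0 by (simp add: h_def rvD[OF e h0T] lin_scale[OF le] scale_right_distrib s_def)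
  have "e (h v0) + \<alpha> h \<cdot> e v0 = e (h v0) + 2 \<cdot> e v0" using rvD[OF e hT, of v0] he[of v0] by simp
  then have "(\<alpha> h - 2) \<cdot> e v0 = 0" by (simp add: scale_left_diff_distrib)
  then have ah: "\<alpha> h = 2" using v0 by simp
  have "triple e f h" unfolding triple_def
    using le lf T_lin[OF hT] ef he rvD[OF rf hT] ah by simp
  moreover have "s * \<kappa>0 \<noteq> 0" using a0 f0(2) by (simp add: s_def \<kappa>0_def)
  moreover have "\<forall>x\<in>T. tr (\<lambda>v. h (x v)) = (s * \<kappa>0) * \<alpha> x"
    unfolding h_def tr_scale by (simp add: trh0)
  ultimately show ?thesis by (intro that[OF rf hT _ _ ah])
qed

text \<open>The last hypothesis says that the square of \<open>h - h'\<close> has trace 0.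
  Eigenvalues of coroots are real, so this is a vanishing sum of squares of reals.\<close>

lemma coroots_equal:
  assumes h: "h \<in> T" "triple e f h" and h': "h' \<in> T" "triple e' f' h'"
    and z: "tr (\<lambda>v. h (h v)) - tr (\<lambda>v. h (h' v)) - tr (\<lambda>v. h' (h v)) + tr (\<lambda>v. h' (h' v)) = 0"
  shows "h = h'"
proof -
  define d where "d = (\<lambda>v. h v - h' v)"
  have dT: "d \<in> T" unfolding d_def by (rule T_diff[OF h(1) h'(1)])
  note ld = T_lin[OF dT]
  have "fc d cnj = d"
  proof (rule T_eq_on_wv[OF lin_fc[OF ld] ld])
    fix v \<nu> assume v: "wv v \<nu>"
    show "fc d cnj v = d v"
    proof (cases "v = 0")
      case True then show ?thesis using lin_zero[OF ld] lin_zero[OF lin_fc[OF ld]] by simp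
    next
      case False
      have "\<nu> h \<in> \<real>" "\<nu> h' \<in> \<real>"
        by (rule sl2_real[OF h(2) wvD[OF v h(1)] False], rule sl2_real[OF h'(2) wvD[OF v h'(1)] False])
      then have "cnj (\<nu> h - \<nu> h') = \<nu> h - \<nu> h'" by (simp add: Reals_cnj_iff)
      moreover have dv: "d v = (\<nu> h - \<nu> h') \<cdot> v"
        by (simp add: d_def wvD[OF v h(1)] wvD[OF v h'(1)] scale_left_diff_distrib)
      ultimately show ?thesis using fc_gev[OF ld eigenvector_gev[of d v, OF dv], of cnj] by simp
    qed
  qed
  moreover have "tr (\<lambda>v. d (d v)) = 0"
  proof -
    have "tr (\<lambda>v. d (d v)) = (tr (\<lambda>v. h (h v)) - tr (\<lambda>v. h (h' v))) - (tr (\<lambda>v. h' (h v)) - tr (\<lambda>v. h' (h' v)))"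
      by (simp add: d_def tr_diff lin_diff[OF T_lin[OF h(1)]] lin_diff[OF T_lin[OF h'(1)]])
    then show ?thesis using z by (simp add: algebra_simps)
  qed
  moreover have "fc d (\<lambda>c. c) = d" using T_ss[OF dT] by (simp add: ss_def)
  ultimately have "d = (\<lambda>v. 0)" using tr_fc_cnj[OF ld] by simp
  then show ?thesis by (simp add: d_def fun_eq_iff)
qed

section \<open>Two opposite weight vectors and an eigenvector of their inner derivation\<close>

definition start :: "'a \<Rightarrow> 'a \<Rightarrow> 'a \<Rightarrow> complex \<Rightarrow> (('a \<Rightarrow> 'a) \<Rightarrow> complex) \<Rightarrow> (('a \<Rightarrow> 'a) \<Rightarrow> complex) \<Rightarrow> bool" where
  "start x y z c \<sigma> \<tau> \<longleftrightarrow> wv x \<sigma> \<and> wv y (\<lambda>k. - \<sigma> k) \<and> wv z \<tau> \<and> br x y z = c \<cdot> z \<and> c \<noteq> 0 \<and> z \<noteq> 0"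

lemma startD:
  assumes "start x y z c \<sigma> \<tau>"
  shows "wv x \<sigma>" "wv y (\<lambda>k. - \<sigma> k)" "wv z \<tau>" "br x y z = c \<cdot> z" "c \<noteq> 0" "z \<noteq> 0"
  using assms unfolding start_def by simp_all

lemma start_facts:
  assumes s: "start x y z c \<sigma> \<tau>"
  shows "ad x y \<in> T" "x \<noteq> 0" "y \<noteq> 0" "\<sigma> (ad x y) = 0" "\<tau> (ad x y) = c"
    "rv (ad z x) (\<lambda>k. \<tau> k + \<sigma> k)" "ad z x y = c \<cdot> z"
proof -
  note d = startD[OF s]
  show k: "ad x y \<in> T" by (rule rv_T[OF rv_ad[OF d(1,2)]]) simp
  have "c \<cdot> z \<noteq> 0" using d(5,6) by simp
  then show nz: "x \<noteq> 0" "y \<noteq> 0" using d(4) by (auto simp: br_simps)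
  have "\<sigma> (ad x y) \<cdot> x = 0" using wvD[OF d(1) k] by (simp add: ad_def)
  then show "\<sigma> (ad x y) = 0" using nz by simp
  have "ad x y z = c \<cdot> z" using d(4) by (simp only: ad_def)
  then have "\<tau> (ad x y) \<cdot> z = c \<cdot> z" using wvD[OF d(3) k] by simp
  then show "\<tau> (ad x y) = c" using d(6) by simp
  show "rv (ad z x) (\<lambda>k. \<tau> k + \<sigma> k)" by (rule rv_ad[OF d(3,1)])
  show "ad z x y = c \<cdot> z" using d(4) br_rot[of z x y] br_rot[of y z x] by (simp add: ad_def)
qed

lemma nat_pair_cases:
  assumes "a \<in> \<nat>" "b \<in> \<nat>" "a + b = (2 :: complex)" shows "a = 0 \<or> a = 1 \<or> a = 2"
proof -
  obtain m n where mn: "a = of_nat m" "b = of_nat n" using assms by (auto elim!: Nats_cases)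
  have "of_nat (m + n) = (of_nat 2 :: complex)" using assms(3) mn by simp
  then have "m + n = 2" by (simp only: of_nat_eq_iff)
  then have "m = 0 \<or> m = 1 \<or> m = 2" by arith
  then show ?thesis using mn by auto
qed

text \<open>\<open>ad z x\<close> kills \<open>x\<close> and \<open>z\<close>, so both weights at
  \<open>h\<close> are naturals, with sum 2. If \<open>x\<close> had weight 2, \<open>z\<close>
  would be invariant under the sl2; then \<open>f\<close> kills
  \<open>ad z x y = c \<cdot> z\<close> although \<open>y\<close> has weight -2, contradicting
  \<open>sl2_nat\<close>.\<close>

lemma start_sl2:
  assumes s: "start x y z c \<sigma> \<tau>"
  obtains f h \<kappa> where "rv f (\<lambda>k. - (\<tau> k + \<sigma> k))" "h \<in> T" "triple (ad z x) f h" "\<kappa> \<noteq> 0"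
    "\<forall>k\<in>T. tr (\<lambda>v. h (k v)) = \<kappa> * (\<tau> k + \<sigma> k)"
    "\<sigma> h = 0 \<and> \<tau> h = 2 \<or> \<sigma> h = 1 \<and> \<tau> h = 1"
proof -
  note d = startD[OF s] and F = start_facts[OF s]
  let ?e = "ad z x"
  have nz: "?e \<noteq> (\<lambda>v. 0)"
  proof
    assume "?e = (\<lambda>v. 0)"
    then have "c \<cdot> z = 0" using F(7) by simp
    then show False using d(5,6) by simp
  qed
  have "\<tau> (ad x y) + \<sigma> (ad x y) \<noteq> 0" using F(4,5) d(5) by simp
  then obtain f h \<kappa> where fh: "rv f (\<lambda>k. - (\<tau> k + \<sigma> k))" "h \<in> T" "triple ?e f h" "\<kappa> \<noteq> 0" "\<tau> h + \<sigma> h = 2"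
    "\<forall>k\<in>T. tr (\<lambda>v. h (k v)) = \<kappa> * (\<tau> k + \<sigma> k)"
    by (rule root_sl2[OF F(6) nz F(1)])
  have ex: "?e x = 0" and ez: "?e z = 0" by (simp_all add: ad_def)
  have "\<sigma> h \<in> \<nat>" "\<tau> h \<in> \<nat>"
    by (rule sl2_highest[OF fh(3) wvD[OF d(1) fh(2)] ex F(2)], rule sl2_highest[OF fh(3) wvD[OF d(3) fh(2)] ez d(6)])
  moreover have "\<sigma> h + \<tau> h = 2" using fh(5) by (simp add: add.commute)
  ultimately have cs: "\<sigma> h = 0 \<or> \<sigma> h = 1 \<or> \<sigma> h = 2" by (rule nat_pair_cases)
  have "\<sigma> h \<noteq> 2"
  proof
    assume s2: "\<sigma> h = 2"
    then have "\<tau> h = 0" using fh(5) by simp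
    then have "h z = 0" using wvD[OF d(3) fh(2)] by simp
    from sl2_trivial[OF fh(3) this ez] have "f (?e y) = 0" by (simp add: F(7) lin_scale[OF rv_lin[OF fh(1)]])
    moreover have "h y = (- 2) \<cdot> y" using wvD[OF d(2) fh(2)] s2 by simp
    ultimately have "- 2 \<in> (\<nat> :: complex set)" using sl2_nat[OF fh(3) _ _ F(3)] by blast
    then show False using minus_numeral_not_Nats by simp
  qed
  then have "\<sigma> h = 0 \<and> \<tau> h = 2 \<or> \<sigma> h = 1 \<and> \<tau> h = 1" using cs fh(5) by auto
  from that[OF fh(1-4) fh(6) this] show ?thesis .
qed

text \<open>If \<open>x\<close> were trivial for the \<open>\<ss>\<ll>\<^sub>2\<close> of the root \<open>\<tau> + \<sigma>\<close>, then \<open>x\<close> and \<open>f z\<close> would have weight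
  zero; comparing with the root \<open>\<tau> - \<sigma>\<close> this is impossible.\<close>

lemma start_not_trivial:
  assumes s: "start x y z c \<sigma> \<tau>"
    and f: "rv f (\<lambda>k. - (\<tau> k + \<sigma> k))" and h: "h \<in> T" and tri: "triple (ad z x) f h" and kap: "\<kappa> \<noteq> 0"
    and trh': "\<forall>k\<in>T. tr (\<lambda>v. h (k v)) = \<kappa> * (\<tau> k + \<sigma> k)"
    and m0: "\<sigma> h = 0" "\<tau> h = 2"
  shows False
proof -
  note d = startD[OF s] and F = start_facts[OF s] and R = tripleD(4-)[OF tri] and lf = rv_lin[OF f]
  note trh = bspec[OF trh']
  have ex: "ad z x x = 0" and ez: "ad z x z = 0" by (simp_all add: ad_def)
  have fx: "f x = 0" using wvD[OF d(1) h] m0 by (intro sl2_trivial[OF tri _ ex]) simp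
  define y1 where "y1 = f z"
  have wy1: "wv y1 (\<lambda>k. - \<sigma> k)" unfolding y1_def by (rule wv_cong[OF rv_apply[OF f d(3)]]) simp
  \<comment> \<open>As \<open>f\<close> kills \<open>x\<close>, the derivation rule shows the coroot
    itself to be inner. So \<open>y1\<close>, \<open>x\<close>, \<open>z\<close> form another start,
    with constant -2 and root \<open>\<tau> - \<sigma>\<close>.\<close>
  have h_ad: "h v = ad x y1 v" for v
  proof -
    have "f (ad z x v) = ad z x (f v) + ad y1 x v"
      using der_comm_ad[OF rv_der[OF f], of z x v] fx by (simp add: y1_def ad_def br_simps)
    then have "h v + ad y1 x v = 0" using R(1)[of v] by simp
    then show ?thesis unfolding ad_swap[of x y1] by (simp add: eq_neg_iff_add_eq_0[symmetric])
  qed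
  have hz: "h z = 2 \<cdot> z" using wvD[OF d(3) h] m0 by simp
  have ey1: "ad z x y1 = 2 \<cdot> z" unfolding y1_def using R(1)[of z] hz ez by (simp add: lin_zero[OF lf])
  have y1nz: "y1 \<noteq> 0" using ey1 d(6) by (auto simp: ad_def br_simps)
  have s': "start y1 x z (- 2) (\<lambda>k. - \<sigma> k) \<tau>"
    unfolding start_def using wy1 d hz h_ad[of z] antisym12[of y1 x z] by (simp add: ad_def)
  obtain f' h' \<kappa>' where fh': "rv f' (\<lambda>k. - (\<tau> k + - \<sigma> k))" "h' \<in> T" "triple (ad z y1) f' h'" "\<kappa>' \<noteq> 0"
    "\<forall>k\<in>T. tr (\<lambda>v. h' (k v)) = \<kappa>' * (\<tau> k + - \<sigma> k)"
    "- \<sigma> h' = 0 \<and> \<tau> h' = 2 \<or> - \<sigma> h' = 1 \<and> \<tau> h' = 1"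
    by (rule start_sl2[OF s'])
  note trh2 = bspec[OF fh'(5)]
  have sw: "tr (\<lambda>v. h (h' v)) = tr (\<lambda>v. h' (h v))" by (rule tr_commute[OF T_lin[OF h] T_lin[OF fh'(2)]])
  \<comment> \<open>Both sides compute the trace of the product of \<open>h\<close> and
    \<open>h'\<close>. The doublet alternative for \<open>h'\<close> would make the left side
    0.\<close>
  have "\<kappa> * (\<tau> h' + \<sigma> h') = \<kappa>' * 2"
    using sw trh[OF fh'(2)] trh2[OF h] m0 by simp
  moreover have "\<sigma> h' = - 1 \<Longrightarrow> \<tau> h' \<noteq> 1" using calculation fh'(4) by auto
  moreover have "\<sigma> h' = 0 \<and> \<tau> h' = 2 \<or> \<sigma> h' = - 1 \<and> \<tau> h' = 1"
    using fh'(6) minus_equation_iff[of "\<sigma> h'" 1] by auto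
  ultimately have c: "\<sigma> h' = 0" "\<tau> h' = 2" "\<kappa> = \<kappa>'" by auto
  have "h = h'"
    by (rule coroots_equal[OF h tri fh'(2,3)])
       (simp add: trh[OF h] trh[OF fh'(2)] trh2[OF h] trh2[OF fh'(2)] m0 c)
  then have "\<sigma> k = 0" if "k \<in> T" for k using trh[OF that] trh2[OF that] c(3) kap by (simp add: algebra_simps)
  note s0 = this
  \<comment> \<open>Since \<open>\<sigma>\<close> vanishes on \<open>T\<close>, \<open>u\<close> and
    \<open>z\<close> have opposite weights, so \<open>ad u z\<close> lies in \<open>T\<close> and
    kills \<open>x\<close>. But the derivation rule for \<open>f\<close> gives it the value
    \<open>2 \<cdot> y1\<close> at \<open>x\<close>.\<close>
  define u where "u = f y1"
  have wu: "wv u (\<lambda>k. - \<sigma> k + - (\<tau> k + \<sigma> k))" unfolding u_def by (rule rv_apply[OF f wy1])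
  have "ad u z \<in> T" by (rule rv_T[OF rv_ad[OF wu d(3)]]) (simp add: s0)
  then have "ad u z x = 0" using wvD[OF d(1)] s0 by simp
  moreover have "f (ad y1 z x) = ad u z x"
    using der_comm_ad[OF rv_der[OF f], of y1 z x] fx by (simp add: u_def y1_def[symmetric] ad_def br_simps)
  moreover have "ad y1 z x = 2 \<cdot> z" using hz h_ad[of z] br_rot[of y1 z x] by (simp add: ad_def)
  ultimately have "2 \<cdot> y1 = 0" by (simp add: lin_scale[OF lf] y1_def)
  then show False using y1nz by simp
qed

text \<open>In the doublet case \<open>y - c \<cdot> f z\<close> is killed by \<open>ad z x\<close>
  and has weight -1, hence is 0. The derivation rule for \<open>f\<close> on \<open>ad z x\<close>
  then computes \<open>ad z (f x)\<close>.\<close>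

lemma block:
  assumes s: "start x y z c \<sigma> \<tau>"
  obtains f h \<kappa> where "rv f (\<lambda>k. - (\<tau> k + \<sigma> k))" "h \<in> T" "triple (ad z x) f h" "\<kappa> \<noteq> 0"
    "\<forall>k\<in>T. tr (\<lambda>v. h (k v)) = \<kappa> * (\<tau> k + \<sigma> k)"
    "\<sigma> h = 1" "\<tau> h = 1" "y = c \<cdot> f z" "\<forall>v. ad z (f x) v = (1 / c) \<cdot> ad x y v - h v"
    "wv (f x) (\<lambda>k. - \<tau> k)" "f x \<noteq> 0"
proof -
  note d = startD[OF s] and F = start_facts[OF s]
  obtain f h \<kappa> where fh: "rv f (\<lambda>k. - (\<tau> k + \<sigma> k))" "h \<in> T" "triple (ad z x) f h" "\<kappa> \<noteq> 0"
    "\<forall>k\<in>T. tr (\<lambda>v. h (k v)) = \<kappa> * (\<tau> k + \<sigma> k)"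
    "\<sigma> h = 0 \<and> \<tau> h = 2 \<or> \<sigma> h = 1 \<and> \<tau> h = 1"
    by (rule start_sl2[OF s])
  have m1: "\<sigma> h = 1" "\<tau> h = 1" using start_not_trivial[OF s fh(1-5)] fh(6) by blast+
  note R = tripleD(4-)[OF fh(3)] and lf = rv_lin[OF fh(1)]
  have ex: "ad z x x = 0" and ez: "ad z x z = 0" by (simp_all add: ad_def)
  have hx: "h x = x" and hz: "h z = z" and hy: "h y = - y"
    using wvD[OF d(1) fh(2)] wvD[OF d(3) fh(2)] wvD[OF d(2) fh(2)] m1 by simp_all
  have yz: "y = c \<cdot> f z"
  proof (rule ccontr)
    assume "y \<noteq> c \<cdot> f z"
    then have nz: "y - c \<cdot> f z \<noteq> 0" by simp
    have le: "lin (ad z x)" by (rule lin_ad)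
    have "h (f z) = - f z"
    proof -
      have "h (f z) = 1 \<cdot> f z - 2 \<cdot> f z" by (simp add: R(3) hz)
      then show ?thesis by (simp only: scale_left_diff_distrib[symmetric]) simp
    qed
    then have "h (y - c \<cdot> f z) = (- 1) \<cdot> (y - c \<cdot> f z)"
      by (simp add: lin_diff[OF T_lin[OF fh(2)]] lin_scale[OF T_lin[OF fh(2)]] hy)
    moreover have "ad z x (y - c \<cdot> f z) = 0"
      by (simp add: lin_diff[OF le] lin_scale[OF le] F(7) R(1) ez hz lin_zero[OF lf])
    ultimately show False using sl2_highest[OF fh(3) _ _ nz] minus_numeral_not_Nats by simp
  qed
  have ad_u: "ad z (f x) v = (1 / c) \<cdot> ad x y v - h v" for v
  proof -
    have "f (ad z x v) = ad z x (f v) + ad (f z) x v + ad z (f x) v"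
      by (rule der_comm_ad[OF rv_der[OF fh(1)]])
    then have "ad z (f x) v + ad (f z) x v + h v = 0" using R(1)[of v] by (simp add: add_ac)
    then have "ad z (f x) v = - ad (f z) x v - h v" by (simp only: eq_diff_eq eq_neg_iff_add_eq_0 add_ac)
    also have "- ad (f z) x v = (1 / c) \<cdot> ad x y v"
      using d(5) by (simp add: yz ad_def br_simps antisym12[of x "f z"])
    finally show ?thesis .
  qed
  have wu: "wv (f x) (\<lambda>k. - \<tau> k)" by (rule wv_cong[OF rv_apply[OF fh(1) d(1)]]) simp
  have "ad z x (f x) = x" by (simp add: R(1) ex hx lin_zero[OF lf])
  then have "f x \<noteq> 0" using F(2) by (auto simp: ad_def br_simps)
  from that[OF fh(1-5) m1 yz allI[OF ad_u] wu this] show ?thesis .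
qed

end

section \<open>Classification\<close>

context torus begin

lemma evs_bound:
  assumes "lin k" obtains R :: nat where "\<forall>a\<in>evs k. Re (a / c) \<le> real R"
proof -
  have "finite ((\<lambda>a. Re (a / c)) ` evs k)" using finite_evs[OF assms] by simp
  then obtain M where M: "\<forall>r\<in>(\<lambda>a. Re (a / c)) ` evs k. r \<le> M"
    using bdd_above_finite unfolding bdd_above_def by blast
  obtain R :: nat where "M \<le> real R" using real_arch_simple by blast
  then have "\<forall>a\<in>evs k. Re (a / c) \<le> real R" using M by force
  then show ?thesis by (rule that)
qed

lemma ad_weight_nonzero:
  "\<lbrakk>wv v \<nu>; v \<noteq> 0; k \<in> T\<rbrakk> \<Longrightarrow> \<nu> k \<in> evs k"
  using wvD unfolding evs_def by blast

text \<open>Both \<open>c' / c\<close> and \<open>c / c'\<close> are highest weights of an \<open>\<ss>\<ll>\<^sub>2\<close>, hence natural numbers. Once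
  \<open>c = c'\<close>, the coroots of \<open>\<tau> + \<sigma>\<close> and \<open>\<nu> + \<sigma>\<close> have equal scalar products with each other and
  with themselves, so they coincide.\<close>

lemma extremal_weight:
  assumes s: "start x y z c \<sigma> \<tau>" and p: "wv p \<nu>" "p \<noteq> 0" "\<nu> (ad x y) \<noteq> 0"
    and sum: "c + \<nu> (ad x y) \<noteq> 0" and up: "br z x p = 0" "br z y p = 0"
  shows "\<nu> (ad x y) = c \<and> (\<exists>a. p = a \<cdot> z)"
proof -
  define c' where "c' = \<nu> (ad x y)"
  note d = startD[OF s] and F = start_facts[OF s]
  have kp: "br x y p = c' \<cdot> p" using wvD[OF p(1) F(1)] by (simp add: c'_def ad_def)
  have s': "start x y p c' \<sigma> \<nu>"
    unfolding start_def using d(1,2) p kp by (simp add: c'_def)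
  note F' = start_facts[OF s']
  have up': "br z p x = 0" "br z p y = 0" using up antisym23[of z x p] antisym23[of z y p] by simp_all
  \<comment> \<open>\<open>ad z p\<close> kills \<open>x\<close> and \<open>y\<close>, so it
    commutes with \<open>ad x y\<close>; but it has weight \<open>c + c'\<close> under
    \<open>ad x y\<close>, and this is not 0.\<close>
  have zp: "br z p v = 0" for v
  proof -
    have "ad x y (ad z p v) = ad z p (ad x y v) + c \<cdot> ad z p v + c' \<cdot> ad z p v"
      using der_comm_ad[OF ad_in_der[of x y], of z p v] d(4) kp by (simp add: ad_def br_simps)
    moreover have "ad z p (ad x y v) = ad x y (ad z p v)"
      using der_comm_ad[OF ad_in_der[of z p], of x y v] up' by (simp add: ad_def br_simps)
    ultimately have "c \<cdot> ad z p v + c' \<cdot> ad z p v = 0" by (simp add: add_ac)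
    then have "(c + c') \<cdot> ad z p v = 0" by (simp only: scale_left_distrib)
    then show ?thesis using sum by (simp add: c'_def ad_def)
  qed
  have pz: "br p z v = 0" for v using zp[of v] antisym12[of p z v] by simp
  obtain f h \<kappa> where fh: "rv f (\<lambda>k. - (\<tau> k + \<sigma> k))" "h \<in> T" "triple (ad z x) f h" "\<kappa> \<noteq> 0"
    "\<forall>k\<in>T. tr (\<lambda>v. h (k v)) = \<kappa> * (\<tau> k + \<sigma> k)" "\<sigma> h = 1" "\<tau> h = 1" "y = c \<cdot> f z"
    "\<forall>v. ad z (f x) v = (1 / c) \<cdot> ad x y v - h v" "wv (f x) (\<lambda>k. - \<tau> k)" "f x \<noteq> 0"
    by (rule block[OF s])
  obtain g h' \<kappa>' where gh: "rv g (\<lambda>k. - (\<nu> k + \<sigma> k))" "h' \<in> T" "triple (ad p x) g h'" "\<kappa>' \<noteq> 0"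
    "\<forall>k\<in>T. tr (\<lambda>v. h' (k v)) = \<kappa>' * (\<nu> k + \<sigma> k)" "\<sigma> h' = 1" "\<nu> h' = 1" "y = c' \<cdot> g p"
    "\<forall>v. ad p (g x) v = (1 / c') \<cdot> ad x y v - h' v" "wv (g x) (\<lambda>k. - \<nu> k)" "g x \<noteq> 0"
    by (rule block[OF s'])
  \<comment> \<open>The formula for \<open>ad z (f x)\<close> from \<open>block\<close>, evaluated
    at \<open>p\<close>, gives \<open>\<nu> h\<close>; with the roles of \<open>z\<close> and
    \<open>p\<close> exchanged it gives the reciprocal \<open>\<tau> h'\<close>.\<close>
  have "ad z (f x) p = 0" using zp[of "f x"] antisym23[of z p "f x"] by (simp add: ad_def)
  then have "(1 / c) \<cdot> c' \<cdot> p - \<nu> h \<cdot> p = 0"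
    using fh(9)[rule_format, of p] kp wvD[OF p(1) fh(2)] by (simp add: ad_def)
  then have "(c' / c - \<nu> h) \<cdot> p = 0" by (simp add: scale_left_diff_distrib)
  then have n1: "\<nu> h = c' / c" using p(2) by simp
  have "ad p (g x) z = 0" using pz[of "g x"] antisym23[of p z "g x"] by (simp add: ad_def)
  then have "(1 / c') \<cdot> c \<cdot> z - \<tau> h' \<cdot> z = 0"
    using gh(9)[rule_format, of z] d(4) wvD[OF d(3) gh(2)] by (simp add: ad_def)
  then have "(c / c' - \<tau> h') \<cdot> z = 0" by (simp add: scale_left_diff_distrib)
  then have n2: "\<tau> h' = c / c'" using d(6) by simp
  have "\<nu> h \<in> \<nat>" using up(1) by (intro sl2_highest[OF fh(3) wvD[OF p(1) fh(2)] _ p(2)]) (simp add: ad_def)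
  moreover have "\<tau> h' \<in> \<nat>"
    using pz[of x] antisym23[of p z x] by (intro sl2_highest[OF gh(3) wvD[OF d(3) gh(2)] _ d(6)]) (simp add: ad_def)
  ultimately obtain m n where mn: "\<nu> h = of_nat m" "\<tau> h' = of_nat n" by (auto elim!: Nats_cases)
  have cc': "c' \<noteq> 0" using p(3) by (simp add: c'_def)
  have "\<nu> h * \<tau> h' = 1" using n1 n2 cc' d(5) by simp
  then have "of_nat (m * n) = (of_nat 1 :: complex)" using mn by simp
  then have "m * n = 1" by (simp only: of_nat_eq_iff)
  then have one: "\<nu> h = 1" "\<tau> h' = 1" using mn by simp_all
  then have c: "c' = c" using n1 d(5) by simp
  have sw: "tr (\<lambda>v. h (h' v)) = tr (\<lambda>v. h' (h v))" by (rule tr_commute[OF T_lin[OF fh(2)] T_lin[OF gh(2)]])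
  note t1 = bspec[OF fh(5)] and t2 = bspec[OF gh(5)]
  have "\<kappa> = \<kappa>'" using sw t1[OF gh(2)] t2[OF fh(2)] fh(6) gh(6) one by simp
  then have "h = h'"
    by (intro coroots_equal[OF fh(2,3) gh(2,3)])
       (simp add: t1[OF fh(2)] t1[OF gh(2)] t2[OF fh(2)] t2[OF gh(2)] fh(6,7) gh(6,7) one)
  then have nt: "\<nu> k = \<tau> k" if "k \<in> T" for k
    using t1[OF that] t2[OF that] fh(4) \<open>\<kappa> = \<kappa>'\<close> by simp
  \<comment> \<open>As \<open>\<nu> = \<tau>\<close> on \<open>T\<close>, this commutator has weight
    0, lies in \<open>T\<close> and is scalar on \<open>z\<close>. Computed directly, it sends
    \<open>z\<close> to \<open>- p\<close>.\<close>
  have XT: "op_comm f (ad p x) \<in> T"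
    by (rule rv_T[OF rv_comm[OF fh(1) rv_ad[OF p(1) d(1)]]]) (simp add: nt)
  have Ez: "ad p x z = 0" using pz[of x] antisym23[of p z x] by (simp add: ad_def)
  have "f z = (1 / c) \<cdot> y" using d(5) by (simp add: fh(8))
  then have "ad p x (f z) = (1 / c) \<cdot> ad p x y" by (simp add: lin_scale[OF lin_ad])
  also have "\<dots> = p" using F'(7) c d(5) by simp
  finally have "op_comm f (ad p x) z = - p"
    by (simp add: op_comm_def Ez lin_zero[OF rv_lin[OF fh(1)]])
  moreover have "op_comm f (ad p x) z = \<tau> (op_comm f (ad p x)) \<cdot> z" by (rule wvD[OF d(3) XT])
  ultimately have "p = (- \<tau> (op_comm f (ad p x))) \<cdot> z" by (simp add: minus_equation_iff)
  then have "\<exists>a. p = a \<cdot> z" by (rule exI)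
  then show ?thesis using c by (simp add: c'_def)
qed

text \<open>Induction downwards from a bound \<open>R\<close> on the real part of weights divided by
  \<open>c\<close>, which \<open>ad z x\<close> and \<open>ad z y\<close> raise by 1. A nonzero
  image would have weight \<open>c\<close> by induction, leaving weight 0 for \<open>p\<close>. So
  both operators kill \<open>p\<close>, and \<open>extremal_weight\<close> applies.\<close>

lemma positive_weight:
  assumes s: "start x y z c \<sigma> \<tau>" and p: "wv p \<nu>" "p \<noteq> 0" "\<nu> (ad x y) \<noteq> 0" "Re (\<nu> (ad x y) / c) \<ge> 0"
  shows "\<nu> (ad x y) = c \<and> (\<exists>a. p = a \<cdot> z)"
proof -
  note d = startD[OF s] and F = start_facts[OF s]
  let ?k = "ad x y"
  obtain R :: nat where R: "\<forall>a\<in>evs ?k. Re (a / c) \<le> real R" by (rule evs_bound[OF lin_ad])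
  have ee: "rv (ad z x) (\<lambda>k. \<tau> k + \<sigma> k)" "rv (ad z y) (\<lambda>k. \<tau> k + - \<sigma> k)"
    by (rule rv_ad[OF d(3,1)], rule rv_ad[OF d(3,2)])
  have "wv p \<nu> \<Longrightarrow> p \<noteq> 0 \<Longrightarrow> \<nu> ?k \<noteq> 0 \<Longrightarrow> Re (\<nu> ?k / c) \<ge> 0 \<Longrightarrow> Re (\<nu> ?k / c) \<ge> real R - real n
      \<Longrightarrow> \<nu> ?k = c \<and> (\<exists>a. p = a \<cdot> z)" for n
  proof (induction n arbitrary: p \<nu>)
    case (0 p \<nu>)
    have nopos: "e p = 0" if e: "rv e \<alpha>" "\<alpha> ?k = c" for e \<alpha>
    proof (rule ccontr)
      assume "e p \<noteq> 0"
      from ad_weight_nonzero[OF rv_apply[OF e(1) 0(1)] this F(1)]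
      have "\<nu> ?k + c \<in> evs ?k" using e(2) by simp
      then have "Re ((\<nu> ?k + c) / c) \<le> real R" using R by blast
      then show False using 0(5) d(5) by (simp add: add_divide_distrib)
    qed
    have sum: "c + \<nu> ?k \<noteq> 0"
    proof
      assume "c + \<nu> ?k = 0"
      then have "\<nu> ?k = - c" by (simp add: eq_neg_iff_add_eq_0 add.commute)
      then show False using 0(4) d(5) by simp
    qed
    have "br z x p = 0" "br z y p = 0" using nopos[OF ee(1)] nopos[OF ee(2)] F(4,5) by (simp_all add: ad_def)
    then show ?case by (rule extremal_weight[OF s 0(1-3) sum])
  next
    case (Suc n p \<nu>)
    have nopos: "e p = 0" if e: "rv e \<alpha>" "\<alpha> ?k = c" for e \<alpha>
    proof (rule ccontr)
      assume nz: "e p \<noteq> 0"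
      have re: "Re ((\<nu> ?k + c) / c) = Re (\<nu> ?k / c) + 1" using d(5) by (simp add: add_divide_distrib)
      have "\<nu> ?k + c \<noteq> 0" using re Suc.prems(4) by (cases "\<nu> ?k + c = 0") simp_all
      then have "\<nu> ?k + \<alpha> ?k = c"
        using Suc.IH[OF rv_apply[OF e(1) Suc.prems(1)] nz] re Suc.prems(4,5) e(2) by simp
      then show False using Suc.prems(3) e(2) by simp
    qed
    have sum: "c + \<nu> ?k \<noteq> 0"
    proof
      assume "c + \<nu> ?k = 0"
      then have "\<nu> ?k = - c" by (simp add: eq_neg_iff_add_eq_0 add.commute)
      then show False using Suc.prems(4) d(5) by simp
    qed
    have "br z x p = 0" "br z y p = 0" using nopos[OF ee(1)] nopos[OF ee(2)] F(4,5) by (simp_all add: ad_def)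
    then show ?case by (rule extremal_weight[OF s Suc.prems(1-3) sum])
  qed
  from this[of R] show ?thesis using p by simp
qed

text \<open>Otherwise a nonzero \<open>ad x y\<close> has a root that is nonzero on
  \<open>T\<close>. The opposite root vector \<open>f\<close> takes each of \<open>x\<close>,
  \<open>y\<close> to a vector of weight opposite to the other, so \<open>f\<close> commutes with
  \<open>ad x y\<close> and the coroot is 0, which is impossible. All brackets would vanish.\<close>

lemma opposite_start: "\<exists>x y \<sigma>. wv x \<sigma> \<and> wv y (\<lambda>k. - \<sigma> k) \<and> ad x y \<noteq> (\<lambda>v. 0)"
proof (rule ccontr)
  assume none: "\<not> ?thesis"
  have none': "\<forall>x y \<sigma>. wv x \<sigma> \<longrightarrow> wv y (\<lambda>k. - \<sigma> k) \<longrightarrow> ad x y = (\<lambda>v. 0)"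
    using none unfolding not_ex de_Morgan_conj not_not imp_conv_disj .
  have opp: "ad x y = (\<lambda>v. 0)" if "wv x \<sigma>" "wv y \<tau>" "\<forall>k\<in>T. \<sigma> k + \<tau> k = 0" for x y \<sigma> \<tau>
  proof -
    have wy: "wv y (\<lambda>k. - \<sigma> k)"
      using that(3) by (intro wv_cong[OF that(2)]) (simp add: eq_neg_iff_add_eq_0 add.commute)
    show ?thesis by (rule none'[rule_format, OF that(1) wy])
  qed
  have all: "ad x y = (\<lambda>v. 0)" if x: "wv x \<sigma>" and y: "wv y \<tau>" for x y \<sigma> \<tau>
  proof (rule ccontr)
    assume nz: "ad x y \<noteq> (\<lambda>v. 0)"
    note e = rv_ad[OF x y]
    obtain k where k: "k \<in> T" "\<sigma> k + \<tau> k \<noteq> 0" using opp[OF x y] nz by blast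
    obtain f h \<kappa> where fh: "rv f (\<lambda>k. - (\<sigma> k + \<tau> k))" "h \<in> T" "triple (ad x y) f h" "\<kappa> \<noteq> 0" "\<sigma> h + \<tau> h = 2"
      "\<forall>k\<in>T. tr (\<lambda>v. h (k v)) = \<kappa> * (\<sigma> k + \<tau> k)"
      by (rule root_sl2[OF e nz, OF k])
    have "ad (f x) y = (\<lambda>v. 0)" by (rule opp[OF rv_apply[OF fh(1) x] y]) simp
    moreover have "ad x (f y) = (\<lambda>v. 0)" by (rule opp[OF x rv_apply[OF fh(1) y]]) simp
    ultimately have "f (ad x y v) = ad x y (f v)" for v
      using der_comm_ad[OF rv_der[OF fh(1)], of x y v] by simp
    then have "h v = 0" for v using tripleD(4)[OF fh(3), of v] by simp
    then have "tr (\<lambda>v. h (k v)) = 0" by simp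
    then show False using fh(4,6) k by simp
  qed
  have "br x y z = 0" for x y z
  proof -
    have 1: "br x y z = 0" if "wv x \<sigma>" for x y z \<sigma>
    proof -
      have "(\<lambda>y. br x y z) = (\<lambda>y. 0)"
        by (rule T_eq_on_wv[OF linear2 lin_const0]) (use all[OF that] in \<open>simp add: ad_def fun_eq_iff\<close>)
      then show ?thesis by (rule fun_cong)
    qed
    have "(\<lambda>x. br x y z) = (\<lambda>x. 0)" by (rule T_eq_on_wv[OF linear1 lin_const0]) (rule 1)
    then show ?thesis by (rule fun_cong)
  qed
  then show False using nonabelian by blast
qed

lemma exists_start: "\<exists>x y z c \<sigma> \<tau>. start x y z c \<sigma> \<tau>"
proof -
  obtain x y \<sigma> where xy: "wv x \<sigma>" "wv y (\<lambda>k. - \<sigma> k)" "ad x y \<noteq> (\<lambda>v. 0)"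
    using opposite_start by (elim exE conjE)
  have k: "ad x y \<in> T" by (rule rv_T[OF rv_ad[OF xy(1,2)]]) simp
  obtain z \<tau> where z: "wv z \<tau>" "ad x y z \<noteq> 0"
    using T_eq_on_wv[OF lin_ad[of x y] lin_const0] xy(3) by blast
  have "br x y z = \<tau> (ad x y) \<cdot> z" using wvD[OF z(1) k] by (simp add: ad_def)
  moreover have "\<tau> (ad x y) \<noteq> 0" "z \<noteq> 0" using z(2) wvD[OF z(1) k] by auto
  ultimately have "start x y z (\<tau> (ad x y)) \<sigma> \<tau>" unfolding start_def using xy(1,2) z(1) by simp
  then show ?thesis by (intro exI)
qed

text \<open>The start with constant \<open>- c\<close> covers the weights in the other half
  plane.\<close>

lemma weight_trichotomy:
  assumes s: "start x y z c \<sigma> \<tau>" and u: "start x y u (- c) \<sigma> \<mu>" and p: "wv p \<nu>" "p \<noteq> 0"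
  shows "\<nu> (ad x y) = 0 \<or> (\<exists>a. p = a \<cdot> z) \<or> (\<exists>a. p = a \<cdot> u)"
proof (cases "\<nu> (ad x y) = 0")
  case False
  show ?thesis
  proof (cases "Re (\<nu> (ad x y) / c) \<ge> 0")
    case True
    then show ?thesis using positive_weight[OF s p False] by blast
  next
    case neg: False
    then have "Re (\<nu> (ad x y) / (- c)) \<ge> 0" by simp
    then show ?thesis using positive_weight[OF u p False] by blast
  qed
qed simp

theorem classification:
  "\<exists>x y z u c. c \<noteq> 0 \<and> span {x, y, z, u} = UNIV \<and>
     (\<forall>a b d g. a \<cdot> x + b \<cdot> y + d \<cdot> z + g \<cdot> u = 0 \<longrightarrow> a = 0 \<and> b = 0 \<and> d = 0 \<and> g = 0) \<and>
     br x y z = c \<cdot> z \<and> br x y u = - (c \<cdot> u) \<and> br z u x = - x \<and> br z u y = y"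
proof -
  obtain x y z c \<sigma> \<tau> where s: "start x y z c \<sigma> \<tau>" using exists_start by (elim exE)
  note d = startD[OF s] and F = start_facts[OF s]
  obtain f h \<kappa> where fh: "rv f (\<lambda>k. - (\<tau> k + \<sigma> k))" "h \<in> T" "triple (ad z x) f h" "\<kappa> \<noteq> 0"
    "\<forall>k\<in>T. tr (\<lambda>v. h (k v)) = \<kappa> * (\<tau> k + \<sigma> k)" "\<sigma> h = 1" "\<tau> h = 1" "y = c \<cdot> f z"
    "\<forall>v. ad z (f x) v = (1 / c) \<cdot> ad x y v - h v" "wv (f x) (\<lambda>k. - \<tau> k)" "f x \<noteq> 0"
    by (rule block[OF s])
  define u where "u = f x"
  note wu = fh(10)[folded u_def] and unz = fh(11)[folded u_def]
  have hx: "h x = x" and hy: "h y = - y"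
    using wvD[OF d(1) fh(2)] wvD[OF d(2) fh(2)] fh(6) by simp_all
  have b1: "br x y z = c \<cdot> z" by (rule d(4))
  have b2: "br x y u = - (c \<cdot> u)" using wvD[OF wu F(1)] F(5) by (simp add: ad_def)
  have zu: "ad z u v = (1 / c) \<cdot> ad x y v - h v" for v using fh(9) by (simp add: u_def)
  have b3: "br z u x = - x" using zu[of x] hx by (simp add: ad_def)
  have b4: "br z u y = y" using zu[of y] hy by (simp add: ad_def)
  have s2: "start x y u (- c) \<sigma> (\<lambda>k. - \<tau> k)"
    unfolding start_def using d wu unz b2 by simp
  have s3: "start z u x (- 1) \<tau> \<sigma>" unfolding start_def using d wu b3 F(2) by simp
  have s4: "start z u y (- (- 1)) \<tau> (\<lambda>k. - \<sigma> k)" unfolding start_def using d wu b4 F(3) by simp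
  let ?k = "ad x y" and ?k' = "ad z u"
  have kT: "?k \<in> T" and k'T: "?k' \<in> T" by (rule F(1), rule start_facts(1)[OF s3])
  have kz': "?k' z = 0" "?k' u = 0" "?k x = 0" "?k y = 0" by (simp_all add: ad_def)
  have wts: "\<sigma> ?k = 0" "\<tau> ?k = c" "\<tau> ?k' = 0" "\<sigma> ?k' = - 1"
    using F(4,5) start_facts(4,5)[OF s3] by simp_all
  \<comment> \<open>By the trichotomy for \<open>?k\<close>, such a \<open>q\<close> is a multiple
    of \<open>z\<close> or \<open>u\<close>, and \<open>?k'\<close> kills both.\<close>
  have both: "q = 0" if q: "wv q \<nu>" "\<nu> ?k \<noteq> 0" "\<nu> ?k' \<noteq> 0" for q \<nu>
  proof (rule ccontr)
    assume nz: "q \<noteq> 0"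
    then have "(\<exists>a. q = a \<cdot> z) \<or> (\<exists>a. q = a \<cdot> u)" using weight_trichotomy[OF s s2 q(1)] q(2) by blast
    then have "?k' q = 0" using kz' lin_scale[OF lin_ad[of z u]] by auto
    then have "\<nu> ?k' \<cdot> q = 0" using wvD[OF q(1) k'T] by simp
    then show False using nz q(3) by simp
  qed
  let ?W = "span {x, y, z, u}"
  define N where "N = {p. \<forall>w\<in>{x, y, z, u}. \<forall>v. br p w v = 0}"
  have killed: "p \<in> N" if p: "wv p \<nu>" "\<nu> ?k = 0" "\<nu> ?k' = 0" for p \<nu>
  proof -
    have k0: "?k p = 0" "?k' p = 0" using wvD[OF p(1) kT] wvD[OF p(1) k'T] p(2,3) by simp_all
    \<comment> \<open>Each of these vectors has nonzero weight under both \<open>?k\<close> and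
      \<open>?k'\<close>.\<close>
    have z: "br z x p = 0" "br z y p = 0" "br u x p = 0" "br u y p = 0"
      using both[OF rv_apply[OF rv_ad[OF d(3,1)] p(1)]] both[OF rv_apply[OF rv_ad[OF d(3,2)] p(1)]]
        both[OF rv_apply[OF rv_ad[OF wu d(1)] p(1)]] both[OF rv_apply[OF rv_ad[OF wu d(2)] p(1)]]
        p(2,3) wts d(5) by (simp_all add: ad_def)
    \<comment> \<open>\<open>ad p w\<close> kills \<open>a\<close> and \<open>b\<close>, so it
      commutes with \<open>ad a b\<close>, under which it has the nonzero weight
      \<open>s\<close>.\<close>
    have key: "br p w v = 0"
      if k: "ad a b p = 0" "br a b w = s \<cdot> w" "s \<noteq> 0" and zero: "br p w a = 0" "br p w b = 0" for a b w s v
    proof -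
      have "ad a b (ad p w v) = ad p w (ad a b v) + s \<cdot> ad p w v"
        using der_comm_ad[OF ad_in_der[of a b], of p w v] k(1,2) by (simp add: ad_def br_simps)
      moreover have "ad p w (ad a b v) = ad a b (ad p w v)"
        using der_comm_ad[OF ad_in_der[of p w], of a b v] zero by (simp add: ad_def br_simps)
      ultimately have "s \<cdot> ad p w v = 0" by simp
      then show ?thesis using k(3) by (simp add: ad_def)
    qed
    note zp = br_perms[OF z(1)] br_perms[OF z(2)] br_perms[OF z(3)] br_perms[OF z(4)]
    have "br p x v = 0" for v by (rule key[OF k0(2), of _ "- 1"]) (simp_all add: b3 zp)
    moreover have "br p y v = 0" for v by (rule key[OF k0(2), of _ 1]) (simp_all add: b4 zp)
    moreover have "br p z v = 0" for v by (rule key[OF k0(1), of _ c]) (simp_all add: b1 zp d(5))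
    moreover have "br p u v = 0" for v by (rule key[OF k0(1), of _ "- c"]) (simp_all add: b2 zp d(5))
    ultimately show ?thesis unfolding N_def by blast
  qed
  have mem: "x \<in> ?W" "y \<in> ?W" "z \<in> ?W" "u \<in> ?W" by (auto intro: span_base)
  have N0: "br n w v = 0" if n: "n \<in> N" and w: "w \<in> ?W" for n w v
    using w
  proof (induction rule: span_induct_alt)
    case (step c w' w'')
    then show ?case using n unfolding N_def by (auto simp: br_simps)
  qed (simp add: br_simps)
  have subN: "subspace N" unfolding N_def by (rule subspaceI) (auto simp: br_simps)
  have "p \<in> span (?W \<union> N)" if p: "wv p \<nu>" for p \<nu>
  proof (cases "p \<in> ?W")
    case True then show ?thesis by (auto intro: span_base)
  next
    case False
    have nz: "p \<noteq> 0" using False span_zero by blast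
    have mult: "\<not> (\<exists>a. p = a \<cdot> w)" if "w \<in> ?W" for w using False span_scale[OF that] by blast
    have "\<nu> ?k = 0" using weight_trichotomy[OF s s2 p nz] mult mem by blast
    moreover have "\<nu> ?k' = 0" using weight_trichotomy[OF s3 s4 p nz] mult mem by blast
    ultimately show ?thesis using killed[OF p] by (auto intro: span_base)
  qed
  then have "span {v. \<exists>\<nu>. wv v \<nu>} \<subseteq> span (?W \<union> N)" by (intro span_minimal) auto
  then have dec: "\<exists>w n. v = w + n \<and> w \<in> ?W \<and> n \<in> N" for v
    unfolding span_wv span_Un span_span using subN by (auto simp: span_eq_iff[THEN iffD2])
  note perms = br_perms[OF b1] br_perms[OF b2] br_perms[OF b3] br_perms[OF b4]
  have gen: "br a b w \<in> ?W" if "a \<in> {x, y, z, u}" "b \<in> {x, y, z, u}" "w \<in> {x, y, z, u}" for a b w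
    using that by (auto simp: b1 b2 b3 b4 perms mem span_neg span_scale span_zero)
  have W1: "br a b w \<in> ?W" if "a \<in> {x, y, z, u}" "b \<in> {x, y, z, u}" "w \<in> ?W" for a b w
    using that(3) by (induction rule: span_induct_alt)
      (use gen[OF that(1,2)] in \<open>auto simp: br_simps intro!: span_zero span_add span_scale\<close>)
  have W2: "br a b w \<in> ?W" if "a \<in> {x, y, z, u}" "b \<in> ?W" "w \<in> ?W" for a b w
    using that(2) by (induction rule: span_induct_alt)
      (use W1[OF that(1) _ that(3)] in \<open>auto simp: br_simps intro!: span_zero span_add span_scale\<close>)
  have W3: "br a b w \<in> ?W" if "a \<in> ?W" "b \<in> ?W" "w \<in> ?W" for a b w
    using that(1) by (induction rule: span_induct_alt)
      (use W2[OF _ that(2,3)] in \<open>auto simp: br_simps intro!: span_zero span_add span_scale\<close>)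
  have ideal: "br a b w \<in> ?W" if w: "w \<in> ?W" for a b w
  proof -
    obtain w1 n1 where a: "a = w1 + n1" "w1 \<in> ?W" "n1 \<in> N" using dec by blast
    obtain w2 n2 where b: "b = w2 + n2" "w2 \<in> ?W" "n2 \<in> N" using dec by blast
    have "br n1 b w = 0" using br_perms(1)[OF N0[OF a(3) w, of b]] by simp
    moreover have "br w1 n2 w = 0" using br_perms(2)[OF N0[OF b(3) a(2), of w]] by simp
    ultimately have "br a b w = br w1 w2 w" unfolding a(1) using b(1) by (simp add: br_simps)
    then show ?thesis using W3[OF a(2) b(2) w] by simp
  qed
  then have "ideal ?W" unfolding ideal_def subalgebra_def by simp
  then have "?W = {0} \<or> ?W = UNIV" using simple unfolding simple_def by blast
  then have full: "?W = UNIV" using mem(1) F(2) by blast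
  have indep: "a = 0 \<and> b = 0 \<and> g = 0 \<and> i = 0" if rel: "a \<cdot> x + b \<cdot> y + g \<cdot> z + i \<cdot> u = 0" for a b g i
  proof -
    have pair: "a = 0 \<and> b = 0" if r: "a \<cdot> v + b \<cdot> w = 0" "L v = s \<cdot> v" "L w = - (s \<cdot> w)" "lin L" "s \<noteq> 0" "v \<noteq> 0" "w \<noteq> 0"
      for a b s v w L
    proof -
      have "L (a \<cdot> v + b \<cdot> w) = 0" using r(1) lin_zero[OF r(4)] by simp
      then have "s \<cdot> (a \<cdot> v - b \<cdot> w) = 0"
        by (simp add: lin_add[OF r(4)] lin_scale[OF r(4)] r(2,3) scale_right_diff_distrib mult.commute)
      then have e: "a \<cdot> v = b \<cdot> w" using r(5) by simp
      then have "2 \<cdot> (b \<cdot> w) = 0" using r(1) scale_left_distrib[of 1 1 "b \<cdot> w"] by simp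
      then have "b = 0" using r(7) by simp
      then show ?thesis using e r(6) by simp
    qed
    have l: "lin (ad p q)" for p q by (rule lin_ad)
    \<comment> \<open>\<open>?k\<close> kills \<open>x\<close> and \<open>y\<close> while
      \<open>?k'\<close> kills \<open>z\<close> and \<open>u\<close>, so the relation splits into
      two, each between eigenvectors of opposite eigenvalues.\<close>
    have "?k (a \<cdot> x + b \<cdot> y + g \<cdot> z + i \<cdot> u) = 0" "?k' (a \<cdot> x + b \<cdot> y + g \<cdot> z + i \<cdot> u) = 0"
      by (simp_all add: rel lin_zero[OF l])
    then have r1: "(g * c) \<cdot> z + (- i * c) \<cdot> u = 0" and r2: "(- a) \<cdot> x + b \<cdot> y = 0"
      by (simp_all add: ad_def br_simps b1 b2 b3 b4)
    have "g * c = 0 \<and> - i * c = 0"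
      by (rule pair[OF r1, of ?k c]) (use b1 b2 d(5,6) unz l in \<open>simp_all add: ad_def\<close>)
    moreover have "- a = 0 \<and> b = 0"
      by (rule pair[OF r2, of ?k' "- 1"]) (use b3 b4 F(2,3) l in \<open>simp_all add: ad_def\<close>)
    ultimately show ?thesis using d(5) by simp
  qed
  show ?thesis
    by (intro exI[of _ x] exI[of _ y] exI[of _ z] exI[of _ u] exI[of _ c] conjI allI impI d(5) full b1 b2 b3 b4)
       (use indep in blast)+
qed

end

theorem (in simple_latke) exists_standard_basis:
  "\<exists>x y z u c. c \<noteq> 0 \<and> span {x, y, z, u} = UNIV \<and>
     (\<forall>a b d g. a \<cdot> x + b \<cdot> y + d \<cdot> z + g \<cdot> u = 0 \<longrightarrow> a = 0 \<and> b = 0 \<and> d = 0 \<and> g = 0) \<and>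
     br x y z = c \<cdot> z \<and> br x y u = - (c \<cdot> u) \<and> br z u x = - x \<and> br z u y = y"
proof -
  obtain t where t: "t \<in> der" "diag t" "\<forall>t'. t' \<in> der \<and> diag t' \<longrightarrow> card (diffs t') \<le> card (diffs t)"
    using exists_maximal_diag by blast
  interpret torus scale br Basis t by unfold_locales (use t in auto)
  show ?thesis by (rule classification)
qed

section \<open>The algebra on four generators\<close>

lemma L3_nth:
  "L3 x y z $ 1 = minor3 x y z 2 3 4" "L3 x y z $ 2 = - minor3 x y z 1 3 4"
  "L3 x y z $ 3 = minor3 x y z 1 2 4" "L3 x y z $ 4 = - minor3 x y z 1 2 3"
  by (simp_all add: L3_def L3_e_def axis_def)

lemma L3_e_nth: "L3_e i $ j = (if j = i then 1 else 0)"
  by (simp add: L3_e_def axis_def)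

lemma vec4_eq_iff: "(x :: complex^4) = y \<longleftrightarrow> x$1 = y$1 \<and> x$2 = y$2 \<and> x$3 = y$3 \<and> x$4 = y$4"
  by (simp add: vec_eq_iff forall_4)

lemma vector_space_vec: "vector_space ((*s) :: complex \<Rightarrow> complex^'n \<Rightarrow> complex^'n)"
  by (rule vec.vector_space_axioms)

lemma L3_derivation:
  "L3 x y (L3 a b c) = L3 (L3 x y a) b c + L3 a (L3 x y b) c + L3 a b (L3 x y c)"
  unfolding vec4_eq_iff vector_add_component L3_nth minor3_def by (intro conjI; algebra)

lemma latke_L3: "latke (*s) L3"
proof (intro latke.intro latke_axioms.intro)
  show "vector_space ((*s) :: complex \<Rightarrow> complex^4 \<Rightarrow> complex^4)" by (rule vector_space_vec)
  fix x y z z1 z2 z3 :: "complex^4"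
  show "Vector_Spaces.linear (*s) (*s) (\<lambda>x. L3 x y z)"
    "Vector_Spaces.linear (*s) (*s) (\<lambda>y. L3 x y z)"
    "Vector_Spaces.linear (*s) (*s) (\<lambda>z. L3 x y z)"
    using vector_space_vec[where 'n = 4]
    by (auto simp: Vector_Spaces.linear_iff vec4_eq_iff L3_nth minor3_def algebra_simps)
  show "L3 y x z = - L3 x y z" "L3 x z y = - L3 x y z"
    by (simp_all add: vec4_eq_iff L3_nth minor3_def algebra_simps)
  show "L3 x y (L3 z1 z2 z3) = L3 (L3 x y z1) z2 z3 + L3 z1 (L3 x y z2) z3 + L3 z1 z2 (L3 x y z3)"
    by (rule L3_derivation)
qed

interpretation L3: latke "(*s)" L3
  by (rule latke_L3)

lemma L3_e_brackets:
  "L3 (L3_e 1) (L3_e 2) (L3_e 3) = - L3_e 4" "L3 (L3_e 1) (L3_e 2) (L3_e 4) = L3_e 3"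
  "L3 (L3_e 1) (L3_e 3) (L3_e 4) = - L3_e 2" "L3 (L3_e 2) (L3_e 3) (L3_e 4) = L3_e 1"
  by (simp_all add: vec4_eq_iff L3_nth minor3_def L3_e_nth)

lemma L3_e_expand: "(v :: complex^4) = v$1 *s L3_e 1 + v$2 *s L3_e 2 + v$3 *s L3_e 3 + v$4 *s L3_e 4"
  by (simp add: vec4_eq_iff L3_e_nth)

lemma spanning_basis4:
  fixes a b c d :: "complex^4"
  assumes "vec.span {a, b, c, d} = UNIV"
  shows "card {a, b, c, d} = 4" "vec.independent {a, b, c, d}"
proof -
  have dim: "vec.dim (UNIV :: (complex^4) set) = 4" by (subst vec_dim_card) simp
  have "vec.dim (UNIV :: (complex^4) set) \<le> card {a, b, c, d}"
    using assms by (intro vec.dim_le_card) auto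
  moreover have "card {a, b, c, d} \<le> 4"
    using card_length[of "[a, b, c, d]"] by simp
  ultimately show c: "card {a, b, c, d} = 4" using dim by simp
  show "vec.independent {a, b, c, d}"
    by (rule vec.card_le_dim_spanning[of _ UNIV]) (use assms c dim in auto)
qed

lemma span_e: "vec.span {L3_e 1, L3_e 2, L3_e 3, L3_e 4} = UNIV"
proof -
  have "v \<in> vec.span {L3_e 1, L3_e 2, L3_e 3, L3_e 4}" for v :: "complex^4"
    by (subst L3_e_expand) (intro vec.span_add vec.span_scale vec.span_base, auto)
  then show ?thesis by auto
qed

lemma sqrt2_sq: "complex_of_real (sqrt 2) * complex_of_real (sqrt 2) = 2"
  by (metis of_real_mult of_real_numeral real_sqrt_mult_self abs_numeral)

lemma L3_HXY_nth:
  "L3_H1 $ j = (if j = 2 then - \<i> else 0)" "L3_H2 $ j = (if j = 3 then 1 else 0)"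
  "L3_X $ j = (1 / complex_of_real (sqrt 2)) * (if j = 1 then 1 else if j = 4 then \<i> else 0)"
  "L3_Y $ j = (1 / complex_of_real (sqrt 2)) * (if j = 1 then 1 else if j = 4 then - \<i> else 0)"
  by (simp_all add: L3_H1_def L3_H2_def L3_X_def L3_Y_def L3_e_nth)

lemma L3_HXY_brackets:
  "L3 L3_H1 L3_H2 L3_X = L3_X" "L3 L3_H1 L3_H2 L3_Y = - L3_Y"
  "L3 L3_H1 L3_X L3_Y = L3_H2" "L3 L3_H2 L3_X L3_Y = L3_H1"
  by (simp_all add: vec4_eq_iff L3_nth minor3_def L3_HXY_nth sqrt2_sq field_simps)

lemma span_HXY: "vec.span {L3_H1, L3_H2, L3_X, L3_Y} = UNIV"
proof -
  let ?s = "1 / complex_of_real (sqrt 2)"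
  have "v \<in> vec.span {L3_H1, L3_H2, L3_X, L3_Y}" for v :: "complex^4"
  proof -
    have "v = (\<i> * v$2) *s L3_H1 + v$3 *s L3_H2 + (?s * (v$1 - \<i> * v$4)) *s L3_X
        + (?s * (v$1 + \<i> * v$4)) *s L3_Y"
      by (simp add: vec4_eq_iff L3_HXY_nth sqrt2_sq field_simps)
    moreover have "\<dots> \<in> vec.span {L3_H1, L3_H2, L3_X, L3_Y}"
      by (intro vec.span_add vec.span_scale vec.span_base) auto
    ultimately show ?thesis by (simp only:)
  qed
  then show ?thesis by auto
qed

lemma L3_simple: "L3.simple"
  unfolding L3.simple_def
proof (intro conjI allI impI)
  have "L3 (L3_e 1) (L3_e 2) (L3_e 4) $ 3 \<noteq> 0" unfolding L3_e_brackets by (simp add: L3_e_nth)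
  then show "\<not> L3.abelian" unfolding L3.abelian_def by (metis zero_index)
  fix I assume I: "L3.ideal I"
  then have sub: "vec.subspace I" and cl: "\<And>x y z. z \<in> I \<Longrightarrow> L3 x y z \<in> I"
    unfolding L3.ideal_def L3.subalgebra_def by auto
  have sc: "v \<in> I" if "c *s v \<in> I" "c \<noteq> 0" for c and v :: "complex^4"
    using vec.subspace_scale[OF sub that(1), of "inverse c"] that(2) by simp
  have ng: "v \<in> I" if "- v \<in> I" for v using vec.subspace_neg[OF sub that] by simp
  have "I = UNIV" if ne: "I \<noteq> {0}"
  proof -
    obtain x where x: "x \<in> I" "x \<noteq> 0" using ne vec.subspace_0[OF sub] by blast
    note cc = cl[OF cl[OF x(1)]]
    \<comment> \<open>Two brackets with suitable basis vectors turn \<open>x\<close> into a nonzero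
      coordinate times a basis vector.\<close>
    have "L3_e 3 \<in> I \<or> L3_e 2 \<in> I"
    proof -
      consider "x$1 \<noteq> 0" | "x$2 \<noteq> 0" | "x$3 \<noteq> 0" | "x$4 \<noteq> 0" using x(2) by (auto simp: vec4_eq_iff)
      then show ?thesis
      proof cases
        case 1
        have "L3 (L3_e 1) (L3_e 2) (L3 (L3_e 2) (L3_e 3) x) = (- x$1) *s L3_e 3"
          by (simp add: vec4_eq_iff L3_nth minor3_def L3_e_nth)
        then show ?thesis using cc[of "L3_e 1" "L3_e 2" "L3_e 2" "L3_e 3"] sc 1 by (metis neg_equal_0_iff_equal)
      next
        case 2
        have "L3 (L3_e 2) (L3_e 1) (L3 (L3_e 1) (L3_e 3) x) = (- x$2) *s L3_e 3"
          by (simp add: vec4_eq_iff L3_nth minor3_def L3_e_nth)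
        then show ?thesis using cc[of "L3_e 2" "L3_e 1" "L3_e 1" "L3_e 3"] sc 2 by (metis neg_equal_0_iff_equal)
      next
        case 3
        have "L3 (L3_e 3) (L3_e 1) (L3 (L3_e 1) (L3_e 2) x) = (- x$3) *s L3_e 2"
          by (simp add: vec4_eq_iff L3_nth minor3_def L3_e_nth)
        then show ?thesis using cc[of "L3_e 3" "L3_e 1" "L3_e 1" "L3_e 2"] sc 3 by (metis neg_equal_0_iff_equal)
      next
        case 4
        have "L3 (L3_e 4) (L3_e 1) (L3 (L3_e 1) (L3_e 2) x) = (- x$4) *s L3_e 2"
          by (simp add: vec4_eq_iff L3_nth minor3_def L3_e_nth)
        then show ?thesis using cc[of "L3_e 4" "L3_e 1" "L3_e 1" "L3_e 2"] sc 4 by (metis neg_equal_0_iff_equal)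
      qed
    qed
    moreover have "L3_e 2 \<in> I" if "L3_e 3 \<in> I"
    proof -
      have "L3 (L3_e 1) (L3_e 4) (L3_e 3) = L3_e 2"
        by (simp add: vec4_eq_iff L3_nth minor3_def L3_e_nth)
      then show ?thesis using cl[OF that, of "L3_e 1" "L3_e 4"] by simp
    qed
    ultimately have e2: "L3_e 2 \<in> I" by blast
    have "L3 (L3_e 3) (L3_e 4) (L3_e 2) = L3_e 1" "L3 (L3_e 4) (L3_e 1) (L3_e 2) = L3_e 3"
      "L3 (L3_e 1) (L3_e 3) (L3_e 2) = L3_e 4"
      by (simp_all add: vec4_eq_iff L3_nth minor3_def L3_e_nth)
    then have "{L3_e 1, L3_e 2, L3_e 3, L3_e 4} \<subseteq> I"
      using cl[OF e2, of "L3_e 3" "L3_e 4"] cl[OF e2, of "L3_e 4" "L3_e 1"] cl[OF e2, of "L3_e 1" "L3_e 3"] e2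
      by simp
    then show ?thesis using vec.span_minimal[OF _ sub] span_e by blast
  qed
  then show "I = {0} \<or> I = UNIV" by blast
qed

section \<open>The Lie algebra of inner derivations\<close>

lemma vector_space_op_scale: "vector_space (op_scale :: complex \<Rightarrow> ('a \<Rightarrow> complex^'n) \<Rightarrow> 'a \<Rightarrow> complex^'n)"
  by unfold_locales (auto simp: op_scale_def fun_eq_iff vec_eq_iff algebra_simps)

lemma vector_space_mat_scale: "vector_space (mat_scale :: complex \<Rightarrow> complex^'n^'n \<Rightarrow> complex^'n^'n)"
  by unfold_locales (auto simp: mat_scale_def vec_eq_iff algebra_simps)

lemma vector_space_pair_scale: "vector_space pair_scale"
  by unfold_locales (auto simp: pair_scale_def mat_scale_def vec_eq_iff prod_eq_iff algebra_simps)

lemma mat_scale_mult: "mat_scale c A ** B = mat_scale c (A ** B)" "A ** mat_scale c B = mat_scale c (A ** B)"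
  by (auto simp: mat_scale_def matrix_matrix_mult_def vec_eq_iff sum_distrib_left algebra_simps)

lemma mat_scale_diff: "mat_scale c (A - B) = mat_scale c A - mat_scale c B"
  by (auto simp: mat_scale_def vec_eq_iff algebra_simps)

lemma matrix_mult_distribs:
  "(A + B) ** C = A ** C + B ** (C :: complex^'n^'n)" "C ** (A + B) = C ** A + C ** (B :: complex^'n^'n)"
  "(A - B) ** C = A ** C - B ** (C :: complex^'n^'n)" "C ** (A - B) = C ** A - C ** (B :: complex^'n^'n)"
  by (simp_all add: matrix_matrix_mult_def vec_eq_iff sum.distrib sum_subtractf algebra_simps)

lemma mat_comm_add:
  "mat_comm (A + B) C = mat_comm A C + mat_comm B C" "mat_comm C (A + B) = mat_comm C A + mat_comm C B"
  by (simp_all add: mat_comm_def matrix_mult_distribs)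

lemma mat_comm_scale:
  "mat_comm (mat_scale c A) B = mat_scale c (mat_comm A B)" "mat_comm A (mat_scale c B) = mat_scale c (mat_comm A B)"
  by (simp_all add: mat_comm_def mat_scale_mult mat_scale_diff)

lemma mat_comm_self: "mat_comm A A = 0"
  by (simp add: mat_comm_def)

lemma mat_comm_jacobi:
  "mat_comm A (mat_comm B C) + mat_comm B (mat_comm C A) + mat_comm C (mat_comm A B) = 0"
  by (simp add: mat_comm_def matrix_mult_distribs matrix_mul_assoc)

lemma transpose_add: "transpose (A + B) = transpose A + (transpose B :: 'a::plus^'n^'m)"
  by (simp add: transpose_def vec_eq_iff)

lemma transpose_diff: "transpose (A - B) = transpose A - (transpose B :: 'a::minus^'n^'m)"
  by (simp add: transpose_def vec_eq_iff)

lemma transpose_mat_scale: "transpose (mat_scale c A) = mat_scale c (transpose A)"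
  by (simp add: transpose_def mat_scale_def vec_eq_iff)

lemma lie_algebra_so4: "lie_algebra mat_scale so4 mat_comm"
proof (intro lie_algebra.intro lie_algebra_axioms.intro vector_space_mat_scale)
  interpret m: vector_space "mat_scale :: complex \<Rightarrow> complex^4^4 \<Rightarrow> complex^4^4" by (rule vector_space_mat_scale)
  show "m.subspace so4"
    by (rule m.subspaceI)
       (auto simp: so4_def transpose_add transpose_mat_scale m.scale_minus_right, simp add: transpose_def vec_eq_iff)
  fix A B :: "complex^4^4" assume "A \<in> so4" "B \<in> so4"
  then show "mat_comm A B \<in> so4"
    by (simp add: so4_def mat_comm_def transpose_diff matrix_transpose_mul)
       (simp add: matrix_matrix_mult_def vec_eq_iff)
qed (auto simp: mat_comm_add mat_comm_scale mat_comm_self mat_comm_jacobi)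

lemma trace_mat_comm: "trace (mat_comm A (B :: complex^'n^'n)) = 0"
  unfolding mat_comm_def trace_sub trace_mul_sym[of A B] by simp

lemma lie_algebra_sl2_sl2: "lie_algebra pair_scale (sl2 \<times> sl2) pair_comm"
proof (intro lie_algebra.intro lie_algebra_axioms.intro vector_space_pair_scale)
  interpret m: vector_space pair_scale by (rule vector_space_pair_scale)
  show "m.subspace (sl2 \<times> sl2)"
    by (rule m.subspaceI) (auto simp: sl2_def trace_def sum_2 pair_scale_def mat_scale_def add_eq_0_iff zero_prod_def)
  fix A B :: "(complex^2^2) \<times> (complex^2^2)" assume "A \<in> sl2 \<times> sl2" "B \<in> sl2 \<times> sl2"
  then show "pair_comm A B \<in> sl2 \<times> sl2"
    by (auto simp: sl2_def pair_comm_def trace_mat_comm)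
qed (auto simp: pair_comm_def pair_scale_def mat_comm_add mat_comm_scale mat_comm_self mat_comm_jacobi prod_eq_iff)

lemma so4_nth:
  assumes "A \<in> so4"
  shows "A$i$j = - A$j$i"
proof -
  have "transpose A $ j $ i = (- A) $ j $ i" using assms unfolding so4_def by simp
  then show ?thesis by (simp only: transpose_def vec_lambda_beta uminus_vec_def)
qed

lemma so4_diag: "A \<in> so4 \<Longrightarrow> A$i$i = 0"
  using so4_nth[of A i i] by simp

text \<open>Bracketing with two basis vectors generates the rotation in the plane of the other two,
  hence the complementary indices.\<close>

lemma so4_as_ad:
  assumes "A \<in> so4"
  shows "A *v z = A$3$4 *s L3 (L3_e 1) (L3_e 2) z - A$2$4 *s L3 (L3_e 1) (L3_e 3) z + A$2$3 *s L3 (L3_e 1) (L3_e 4) z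
    + A$1$4 *s L3 (L3_e 2) (L3_e 3) z - A$1$3 *s L3 (L3_e 2) (L3_e 4) z + A$1$2 *s L3 (L3_e 3) (L3_e 4) z"
  using so4_nth[OF assms, of 2 1] so4_nth[OF assms, of 3 1] so4_nth[OF assms, of 4 1]
    so4_nth[OF assms, of 3 2] so4_nth[OF assms, of 4 2] so4_nth[OF assms, of 4 3]
  by (simp add: vec4_eq_iff matrix_vector_mult_def sum_4 so4_diag[OF assms] L3_nth minor3_def L3_e_nth)

lemma ad_as_so4: "\<exists>A\<in>so4. L3.ad x y = (\<lambda>z. A *v z)"
proof
  let ?A = "\<chi> i j. L3 x y (L3_e j) $ i"
  show "?A \<in> so4"
    unfolding so4_def
    by (simp add: vec_eq_iff forall_4 transpose_def L3_nth minor3_def L3_e_nth)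
  show "L3.ad x y = (\<lambda>z. ?A *v z)"
    by (rule ext) (simp add: vec4_eq_iff L3.ad_def matrix_vector_mult_def sum_4 L3_nth minor3_def L3_e_nth algebra_simps)
qed

lemma inner_derivations_L3: "L3.inner_derivations = (\<lambda>A z. A *v z) ` so4"
proof -
  interpret op: vector_space "op_scale :: complex \<Rightarrow> (complex^4 \<Rightarrow> complex^4) \<Rightarrow> _" by (rule vector_space_op_scale)
  interpret so: lie_algebra mat_scale so4 mat_comm by (rule lie_algebra_so4)
  have eq: "L3.inner_derivations = op.span {L3.ad x y | x y. True}"
    unfolding L3.inner_derivations_def op_scale_def[abs_def] ..
  have "op.span {L3.ad x y | x y. True} \<subseteq> (\<lambda>A z. A *v z) ` so4"
  proof (rule op.span_minimal)
    show "{L3.ad x y | x y. True} \<subseteq> (\<lambda>A z. A *v z) ` so4" using ad_as_so4 by blast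
    show "op.subspace ((\<lambda>A z. A *v z) ` so4)"
    proof (rule op.subspaceI)
      show "0 \<in> (\<lambda>A z. A *v z) ` so4"
        using so.subspace_0[OF so.subspace] by (intro image_eqI[of _ _ 0]) (auto simp: fun_eq_iff)
      fix f g c assume "f \<in> (\<lambda>A z. A *v z) ` so4" "g \<in> (\<lambda>A z. A *v z) ` so4"
      then obtain A B where AB: "A \<in> so4" "B \<in> so4" "f = (\<lambda>z. A *v z)" "g = (\<lambda>z. B *v z)" by blast
      show "f + g \<in> (\<lambda>A z. A *v z) ` so4"
        using so.subspace_add[OF so.subspace AB(1,2)] AB(3,4)
        by (intro image_eqI[of _ _ "A + B"]) (auto simp: fun_eq_iff matrix_vector_mult_add_rdistrib)
      show "op_scale c f \<in> (\<lambda>A z. A *v z) ` so4"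
        using so.subspace_scale[OF so.subspace AB(1)] AB(3)
        by (intro image_eqI[of _ _ "mat_scale c A"])
           (auto simp: fun_eq_iff op_scale_def mat_scale_def matrix_vector_mult_def vec_eq_iff sum_distrib_left mult.assoc)
    qed
  qed
  moreover have "(\<lambda>z. A *v z) \<in> op.span {L3.ad x y | x y. True}" if A: "A \<in> so4" for A
  proof -
    let ?g = "\<lambda>i j. L3.ad (L3_e i) (L3_e j)"
    have "(\<lambda>z. A *v z) = op_scale (A$3$4) (?g 1 2) - op_scale (A$2$4) (?g 1 3) + op_scale (A$2$3) (?g 1 4)
        + op_scale (A$1$4) (?g 2 3) - op_scale (A$1$3) (?g 2 4) + op_scale (A$1$2) (?g 3 4)"
      unfolding fun_eq_iff so4_as_ad[OF A] by (simp add: op_scale_def L3.ad_def)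
    also have "\<dots> \<in> op.span {L3.ad x y | x y. True}"
      by (intro op.span_add op.span_diff op.span_scale op.span_base) auto
    finally show ?thesis .
  qed
  ultimately show ?thesis unfolding eq by blast
qed

lemma mat_comm_vector: "mat_comm A B *v z = A *v (B *v z) - B *v (A *v z)"
  by (simp add: mat_comm_def matrix_vector_mult_diff_rdistrib matrix_vector_mul_assoc)

lemma lie_algebra_inner: "lie_algebra op_scale L3.inner_derivations op_comm"
  unfolding inner_derivations_L3
proof (intro lie_algebra.intro lie_algebra_axioms.intro vector_space_op_scale)
  interpret op: vector_space "op_scale :: complex \<Rightarrow> (complex^4 \<Rightarrow> complex^4) \<Rightarrow> _" by (rule vector_space_op_scale)
  interpret so: lie_algebra mat_scale so4 mat_comm by (rule lie_algebra_so4)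
  show "op.subspace ((\<lambda>A z. A *v z) ` so4)"
    using op.subspace_span[of "{L3.ad x y | x y. True}"] inner_derivations_L3
    unfolding L3.inner_derivations_def op_scale_def[abs_def] by simp
  fix f g h :: "complex^4 \<Rightarrow> complex^4" and c
  let ?S = "(\<lambda>A z. A *v z) ` so4"
  { assume "f \<in> ?S" "g \<in> ?S"
    then obtain A B where AB: "A \<in> so4" "B \<in> so4" "f = (\<lambda>z. A *v z)" "g = (\<lambda>z. B *v z)" by blast
    show "op_comm f g \<in> ?S"
      using so.closed[OF AB(1,2)] AB(3,4) by (intro image_eqI[of _ _ "mat_comm A B"]) (auto simp: op_comm_def fun_eq_iff mat_comm_vector)
    show "op_comm (op_scale c f) g = op_scale c (op_comm f g)" "op_comm f (op_scale c g) = op_scale c (op_comm f g)"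
      by (auto simp: AB op_comm_def op_scale_def fun_eq_iff vec.scale_right_diff_distrib matrix_vector_mult_scaleR
          vector_scalar_commute) }
  { assume "f \<in> ?S" "g \<in> ?S" "h \<in> ?S"
    then obtain A B C where AB: "f = (\<lambda>z. A *v z)" "g = (\<lambda>z. B *v z)" "h = (\<lambda>z. C *v z)" by blast
    show "op_comm (f + g) h = op_comm f h + op_comm g h" "op_comm h (f + g) = op_comm h f + op_comm h g"
      "op_comm f (op_comm g h) + op_comm g (op_comm h f) + op_comm h (op_comm f g) = 0"
      by (auto simp: AB op_comm_def fun_eq_iff matrix_vector_right_distrib matrix_vector_mult_diff_distrib) }
  show "op_comm f f = 0" by (simp add: op_comm_def fun_eq_iff)
qed

lemma inner_derivations_iso_so4: "lie_isomorphic op_scale L3.inner_derivations op_comm mat_scale so4 mat_comm"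
  unfolding lie_isomorphic_def
proof (intro conjI lie_algebra_inner lie_algebra_so4 exI[of _ matrix])
  have m: "matrix (\<lambda>z. A *v z) = A" for A :: "complex^4^4" by (rule matrix_of_matrix_vector_mul)
  show "bij_betw matrix L3.inner_derivations so4"
    unfolding inner_derivations_L3 by (rule bij_betw_byWitness[where f' = "\<lambda>A z. A *v z"]) (auto simp: m)
  show "\<forall>x\<in>L3.inner_derivations. \<forall>y\<in>L3.inner_derivations. matrix (x + y) = matrix x + matrix y"
    "\<forall>c. \<forall>x\<in>L3.inner_derivations. matrix (op_scale c x) = mat_scale c (matrix x)"
    by (auto simp: matrix_def vec_eq_iff op_scale_def mat_scale_def)
  show "\<forall>x\<in>L3.inner_derivations. \<forall>y\<in>L3.inner_derivations. matrix (op_comm x y) = mat_comm (matrix x) (matrix y)"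
  proof (intro ballI)
    fix x y assume "x \<in> L3.inner_derivations" "y \<in> L3.inner_derivations"
    then obtain A B where AB: "x = (\<lambda>z. A *v z)" "y = (\<lambda>z. B *v z)" unfolding inner_derivations_L3 by blast
    have "op_comm x y = (\<lambda>z. mat_comm A B *v z)" by (simp add: AB op_comm_def mat_comm_vector)
    then show "matrix (op_comm x y) = mat_comm (matrix x) (matrix y)" by (simp add: m AB)
  qed
qed

text \<open>With \<open>u\<close> the rotation part and \<open>w\<close> the last column of a skew matrix, \<open>u + w\<close> and \<open>u - w\<close> span two
  commuting copies of \<open>\<complex>\<^sup>3\<close> with the cross product, and \<open>su2\<close> maps the cross product to the commutator.\<close>

definition mat2 :: "complex \<Rightarrow> complex \<Rightarrow> complex \<Rightarrow> complex \<Rightarrow> complex^2^2" where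
  "mat2 a b c d = (\<chi> i j. if i = 1 then (if j = 1 then a else b) else (if j = 1 then c else d))"

text \<open>This is \<open>- \<i> / 2\<close> times the combination of the three Pauli matrices with
  coefficients \<open>p\<close>, \<open>q\<close>, \<open>r\<close>.\<close>

definition su2 :: "complex \<Rightarrow> complex \<Rightarrow> complex \<Rightarrow> complex^2^2" where
  "su2 p q r = mat2 (- (\<i> * r) / 2) (- (\<i> * p + q) / 2) (- (\<i> * p - q) / 2) (\<i> * r / 2)"

definition so4_split :: "complex^4^4 \<Rightarrow> (complex^2^2) \<times> (complex^2^2)" where
  "so4_split A = (su2 (A$3$2 + A$1$4) (A$1$3 + A$2$4) (A$2$1 + A$3$4),
                  su2 (A$3$2 - A$1$4) (A$1$3 - A$2$4) (A$2$1 - A$3$4))"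

definition so4_join :: "(complex^2^2) \<times> (complex^2^2) \<Rightarrow> complex^4^4" where
  "so4_join P = (let M = fst P; N = snd P;
     p = (\<lambda>M::complex^2^2. \<i> * (M$1$2 + M$2$1)); q = (\<lambda>M::complex^2^2. M$2$1 - M$1$2); r = (\<lambda>M::complex^2^2. 2 * \<i> * M$1$1);
     u1 = (p M + p N) / 2; u2 = (q M + q N) / 2; u3 = (r M + r N) / 2;
     w1 = (p M - p N) / 2; w2 = (q M - q N) / 2; w3 = (r M - r N) / 2
   in vector [vector [0, - u3, u2, w1], vector [u3, 0, - u1, w2], vector [- u2, u1, 0, w3], vector [- w1, - w2, - w3, 0]])"

lemma vector4_nth: "(vector [a, b, c, d] :: 'x::zero^4) $ 1 = a" "(vector [a, b, c, d] :: 'x^4) $ 2 = b"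
  "(vector [a, b, c, d] :: 'x^4) $ 3 = c" "(vector [a, b, c, d] :: 'x^4) $ 4 = d"
  by (simp_all add: vector_def)

lemma mat2_nth: "mat2 a b c d $ 1 $ 1 = a" "mat2 a b c d $ 1 $ 2 = b" "mat2 a b c d $ 2 $ 1 = c" "mat2 a b c d $ 2 $ 2 = d"
  by (simp_all add: mat2_def)

lemma mat22_eq_iff: "(M :: complex^2^2) = N \<longleftrightarrow> M$1$1 = N$1$1 \<and> M$1$2 = N$1$2 \<and> M$2$1 = N$2$1 \<and> M$2$2 = N$2$2"
  by (auto simp: vec_eq_iff forall_2)

lemma so4_iso_sl2_sl2: "lie_isomorphic mat_scale so4 mat_comm pair_scale (sl2 \<times> sl2) pair_comm"
  unfolding lie_isomorphic_def
proof (intro conjI lie_algebra_sl2_sl2 lie_algebra_so4 exI[of _ so4_split])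
  show "bij_betw so4_split so4 (sl2 \<times> sl2)"
  proof (rule bij_betw_byWitness[where f' = so4_join])
    show "\<forall>A\<in>so4. so4_join (so4_split A) = A"
    proof
      fix A assume A: "A \<in> so4"
      show "so4_join (so4_split A) = A"
        using so4_nth[OF A, of 1 2] so4_nth[OF A, of 3 1] so4_nth[OF A, of 4 1]
          so4_nth[OF A, of 2 3] so4_nth[OF A, of 4 2] so4_nth[OF A, of 4 3]
        by (simp add: so4_join_def so4_split_def su2_def Let_def mat2_nth vec_eq_iff forall_4 vector4_nth so4_diag[OF A] field_simps)
    qed
    show "\<forall>P\<in>sl2 \<times> sl2. so4_split (so4_join P) = P"
      by (auto simp: sl2_def trace_def sum_2 so4_join_def so4_split_def su2_def Let_def mat2_nth mat22_eq_iff vector4_nth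
          prod_eq_iff field_simps add_eq_0_iff)
    show "so4_split ` so4 \<subseteq> sl2 \<times> sl2"
      by (auto simp: so4_split_def su2_def sl2_def trace_def sum_2 mat2_nth)
    show "so4_join ` (sl2 \<times> sl2) \<subseteq> so4"
      by (auto simp: so4_def so4_join_def Let_def transpose_def vec_eq_iff forall_4 vector4_nth)
  qed
  show "\<forall>x\<in>so4. \<forall>y\<in>so4. so4_split (x + y) = so4_split x + so4_split y"
    "\<forall>c. \<forall>x\<in>so4. so4_split (mat_scale c x) = pair_scale c (so4_split x)"
    by (auto simp: so4_split_def su2_def mat2_nth mat22_eq_iff pair_scale_def mat_scale_def field_simps)
  show "\<forall>x\<in>so4. \<forall>y\<in>so4. so4_split (mat_comm x y) = pair_comm (so4_split x) (so4_split y)"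
  proof (intro ballI)
    fix A B assume A: "A \<in> so4" and B: "B \<in> so4"
    note n = so4_nth[OF A, of 1 2] so4_nth[OF A, of 3 1] so4_nth[OF A, of 4 1]
          so4_nth[OF A, of 2 3] so4_nth[OF A, of 4 2] so4_nth[OF A, of 4 3]
          so4_nth[OF B, of 1 2] so4_nth[OF B, of 3 1] so4_nth[OF B, of 4 1]
          so4_nth[OF B, of 2 3] so4_nth[OF B, of 4 2] so4_nth[OF B, of 4 3] so4_diag[OF A] so4_diag[OF B]
    show "so4_split (mat_comm A B) = pair_comm (so4_split A) (so4_split B)"
      by (simp add: so4_split_def su2_def mat2_nth mat22_eq_iff pair_comm_def mat_comm_def matrix_matrix_mult_def sum_4 sum_2 n field_simps)
  qed
qed

section \<open>Cartan subalgebras and roots\<close>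

definition cdot :: "complex^4 \<Rightarrow> complex^4 \<Rightarrow> complex" where
  "cdot x y = x$1 * y$1 + x$2 * y$2 + x$3 * y$3 + x$4 * y$4"

lemma L3_skew: "cdot (L3 a b x) y = - cdot x (L3 a b y)"
  unfolding cdot_def L3_nth minor3_def by algebra

text \<open>\<open>L3 a b\<close> is the skew operator dual to the bivector of \<open>a\<close> and
  \<open>b\<close>, of rank at most 2; the coefficient is minus the Gram determinant of
  \<open>a\<close> and \<open>b\<close>.\<close>

lemma L3_cube:
  "L3 a b (L3 a b (L3 a b x)) = ((cdot a b)^2 - cdot a a * cdot b b) *s L3 a b x"
  unfolding vec4_eq_iff vector_smult_component L3_nth minor3_def cdot_def
  by (intro conjI; algebra)

lemma L3_combination:
  "L3 (p *s a + q *s b) (r *s a + s *s b) x = (p * s - q * r) *s L3 a b x"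
  unfolding vec4_eq_iff vector_smult_component vector_add_component L3_nth minor3_def by (intro conjI; algebra)

lemma in_span_pair: "p \<in> vec.span {a, b} \<longleftrightarrow> (\<exists>r s. p = r *s a + s *s b)"
proof -
  have "p \<in> vec.span {a, b} \<longleftrightarrow> (\<exists>r s. p - r *s a = s *s b)"
    by (simp add: vec.span_breakdown_eq vec.span_singleton image_iff)
  also have "\<dots> \<longleftrightarrow> (\<exists>r s. p = r *s a + s *s b)" by (simp add: diff_eq_eq add.commute)
  finally show ?thesis .
qed

lemma nonzero_minor:
  fixes a b :: "complex^4"
  assumes "a \<noteq> 0" "b \<notin> vec.span {a}"
  shows "\<exists>i j. a$i * b$j - a$j * b$i \<noteq> 0"
proof (rule ccontr)
  assume "\<not> ?thesis"
  then have z: "a$i * b$j = a$j * b$i" for i j by simp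
  obtain i where i: "a$i \<noteq> 0" using assms(1) by (auto simp: vec_eq_iff)
  have "b = (b$i / a$i) *s a" using i z[of i] by (simp add: vec_eq_iff field_simps)
  then have "b \<in> vec.span {a}" unfolding vec.span_singleton by blast
  then show False using assms(2) by simp
qed

lemma minors_vanish:
  assumes "L3 a b p = 0" shows "minor3 a b p i j k = 0"
proof -
  have M: "minor3 a b p 2 3 4 = 0" "minor3 a b p 1 3 4 = 0" "minor3 a b p 1 2 4 = 0" "minor3 a b p 1 2 3 = 0"
    using assms unfolding vec4_eq_iff L3_nth by simp_all
  have sw: "minor3 a b p j i k = - minor3 a b p i j k" "minor3 a b p i k j = - minor3 a b p i j k"
    "minor3 a b p i i k = 0" "minor3 a b p k i i = 0" for i j k
    by (simp_all add: minor3_def algebra_simps)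
  have sw': "minor3 a b p j k i = minor3 a b p i j k" "minor3 a b p k i j = minor3 a b p i j k"
    "minor3 a b p k j i = - minor3 a b p i j k" "minor3 a b p i k i = 0" for i j k
    by (simp_all add: minor3_def algebra_simps)
  have P: "minor3 a b p l n m = 0 \<and> minor3 a b p m l n = 0 \<and> minor3 a b p m n l = 0 \<and> minor3 a b p n l m = 0
      \<and> minor3 a b p n m l = 0" if "minor3 a b p l m n = 0" for l m n
    using that sw(1,2)[where i = l and j = m and k = n] sw'(1-3)[where i = l and j = m and k = n] by simp
  have "\<forall>i j k. minor3 a b p i j k = 0"
    unfolding forall_4 using M P[OF M(1)] P[OF M(2)] P[OF M(3)] P[OF M(4)] by (simp add: sw(3,4) sw'(4))
  then show ?thesis by blast
qed

text \<open>All 3 by 3 minors of \<open>a\<close>, \<open>b\<close>, \<open>p\<close> vanish, and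
  Cramer's rule applies with the nonzero 2 by 2 minor.\<close>

lemma L3_kernel:
  assumes m: "a$i * b$j - a$j * b$i \<noteq> 0" and "L3 a b p = 0"
  shows "p \<in> vec.span {a, b}"
proof -
  let ?m = "a$i * b$j - a$j * b$i"
  have eq: "?m * p$k = (p$i * b$j - p$j * b$i) * a$k + (a$i * p$j - a$j * p$i) * b$k" for k
    using minors_vanish[OF assms(2), of i j k] unfolding minor3_def by algebra
  have pk: "p$k = (p$i * b$j - p$j * b$i) / ?m * a$k + (a$i * p$j - a$j * p$i) / ?m * b$k" for k
  proof -
    have "p$k = ?m * p$k / ?m" using m by simp
    then show ?thesis unfolding eq add_divide_distrib by simp
  qed
  have "p = ((p$i * b$j - p$j * b$i) / ?m) *s a + ((a$i * p$j - a$j * p$i) / ?m) *s b"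
    unfolding vec_eq_iff vector_add_component vector_smult_component by (rule allI) (rule pk)
  then show ?thesis unfolding in_span_pair by blast
qed

lemma span_pair_proper:
  fixes a b :: "complex^4" shows "\<exists>p. p \<notin> vec.span {a, b}"
proof (rule ccontr)
  assume "\<not> ?thesis"
  then have "vec.dim (UNIV :: (complex^4) set) \<le> card {a, b}" by (intro vec.dim_le_card) auto
  moreover have "card {a, b} \<le> 2" using card_length[of "[a, b]"] by simp
  moreover have "vec.dim (UNIV :: (complex^4) set) = 4" by (subst vec_dim_card) simp
  ultimately show False by linarith
qed

lemma commuting_span_pair: "L3.commuting (vec.span {a, b})" and subalgebra_span_pair: "L3.subalgebra (vec.span {a, b})"
proof -
  have "L3 x y z = 0" if mem: "x \<in> vec.span {a, b}" "y \<in> vec.span {a, b}" "z \<in> vec.span {a, b}" for x y z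
  proof -
    obtain p q r s m n where "x = p *s a + q *s b" "y = r *s a + s *s b" and z: "z = m *s a + n *s b"
      using mem unfolding in_span_pair by blast
    then have "L3 x y z = (p * s - q * r) *s L3 a b z" by (simp only: L3_combination)
    moreover have "L3 a b z = 0"
      unfolding z vec4_eq_iff L3_nth minor3_def vector_add_component vector_smult_component by (simp add: algebra_simps)
    ultimately show ?thesis by simp
  qed
  then show c: "L3.commuting (vec.span {a, b})" unfolding L3.commuting_def by blast
  then show "L3.subalgebra (vec.span {a, b})"
    unfolding L3.subalgebra_def L3.commuting_def by (simp add: vec.span_zero)
qed

text \<open>Every plane is a commuting subalgebra, so a maximal one is not contained in a line; by
  \<open>L3_kernel\<close> it cannot exceed a plane.\<close>

lemma cartan_span_pair:
  assumes C: "L3.cartan_subalgebra \<hh>"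
  obtains a b i j where "\<hh> = vec.span {a, b}" "a$i * b$j - a$j * b$i \<noteq> 0"
proof -
  have sub: "vec.subspace \<hh>" and com: "L3.commuting \<hh>"
    and maxi: "\<And>\<kk>. L3.subalgebra \<kk> \<Longrightarrow> L3.commuting \<kk> \<Longrightarrow> \<hh> \<subseteq> \<kk> \<Longrightarrow> \<kk> = \<hh>"
    using C unfolding L3.cartan_subalgebra_def L3.subalgebra_def by blast+
  have "\<exists>a\<in>\<hh>. \<exists>b\<in>\<hh>. a \<noteq> 0 \<and> b \<notin> vec.span {a}"
  proof (rule ccontr)
    assume none: "\<not> ?thesis"
    obtain a where a: "a \<noteq> 0" "\<hh> \<subseteq> vec.span {a}"
    proof (cases "\<hh> \<subseteq> {0}")
      case True
      have "L3_e 1 \<noteq> 0" by (simp add: vec4_eq_iff L3_e_nth)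
      then show ?thesis using that[of "L3_e 1"] True vec.span_zero[of "{L3_e 1}"] by blast
    next
      case False
      then show ?thesis using that none by blast
    qed
    obtain b where b: "b \<notin> vec.span {a, a}" using span_pair_proper by blast
    have "vec.span {a} \<subseteq> vec.span {a, b}" by (rule vec.span_mono) simp
    then have "vec.span {a, b} = \<hh>"
      using a(2) by (intro maxi commuting_span_pair subalgebra_span_pair) simp
    moreover have "a \<in> vec.span {a, b}" "b \<in> vec.span {a, b}" by (simp_all add: vec.span_base)
    ultimately show False using none a(1) b by auto
  qed
  then obtain a b where ab: "a \<in> \<hh>" "b \<in> \<hh>" "a \<noteq> 0" "b \<notin> vec.span {a}" by blast
  then obtain i j where m: "a$i * b$j - a$j * b$i \<noteq> 0" using nonzero_minor by blast
  have "\<hh> \<subseteq> vec.span {a, b}"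
  proof
    fix p assume "p \<in> \<hh>"
    then have "L3 a b p = 0" using com ab unfolding L3.commuting_def by blast
    then show "p \<in> vec.span {a, b}" by (rule L3_kernel[OF m])
  qed
  moreover have "vec.span {a, b} \<subseteq> \<hh>" using ab by (intro vec.span_minimal sub) simp
  ultimately show ?thesis using that m by blast
qed

lemma L3_linear3: "L3 a b (x + y) = L3 a b x + L3 a b y" "L3 a b (c *s x) = c *s L3 a b x"
  "L3 a b (x - y) = L3 a b x - L3 a b y" "L3 a b 0 = 0"
  by (simp_all add: vec4_eq_iff L3_nth minor3_def algebra_simps)

lemma cartan_eigenvalue:
  assumes C: "L3.cartan_subalgebra \<hh>" and h: "\<hh> = vec.span {a, b}" and m: "a$i * b$j - a$j * b$i \<noteq> 0"
  obtains v \<mu> where "v \<noteq> 0" "\<mu> \<noteq> 0" "L3 a b v = \<mu> *s v"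
proof -
  have "L3.acts_diagonally \<hh>" using C unfolding L3.cartan_subalgebra_def by (elim conjE)
  then obtain B where B: "vec.independent B" "vec.span B = UNIV"
    "\<forall>v\<in>B. \<forall>h1\<in>\<hh>. \<forall>h2\<in>\<hh>. \<exists>c. L3.ad h1 h2 v = c *s v"
    unfolding L3.acts_diagonally_def by (elim exE conjE)
  have ab: "a \<in> \<hh>" "b \<in> \<hh>" unfolding h by (simp_all add: vec.span_base)
  have "\<exists>v\<in>B. L3 a b v \<noteq> 0"
  proof (rule ccontr)
    assume "\<not> ?thesis"
    then have "B \<subseteq> {v. L3 a b v = 0}" by blast
    then have "vec.span B \<subseteq> {v. L3 a b v = 0}"
      by (rule vec.span_minimal) (auto intro!: vec.subspaceI simp: L3_linear3)
    moreover obtain p where "p \<notin> vec.span {a, b}" using span_pair_proper by blast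
    ultimately show False using L3_kernel[OF m, of p] B(2) by blast
  qed
  then obtain v where v: "v \<in> B" "L3 a b v \<noteq> 0" by blast
  then obtain \<mu> where mu: "L3 a b v = \<mu> *s v" using bspec[OF bspec[OF bspec[OF B(3) v(1)] ab(1)] ab(2)] unfolding L3.ad_def by (elim exE)
  have "v \<noteq> 0" "\<mu> \<noteq> 0" using v(2) mu by auto
  then show ?thesis using that mu by blast
qed

lemma L3_eigenvalue_sq:
  assumes "v \<noteq> 0" "\<mu> \<noteq> 0" "L3 a b v = \<mu> *s v"
  shows "\<mu>^2 = (cdot a b)^2 - cdot a a * cdot b b"
proof -
  have "(\<mu> * (\<mu> * \<mu>)) *s v = (((cdot a b)^2 - cdot a a * cdot b b) * \<mu>) *s v"
    using L3_cube[of a b v] by (simp add: assms(3) L3_linear3)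
  then have "\<mu> * (\<mu> * \<mu>) = ((cdot a b)^2 - cdot a a * cdot b b) * \<mu>"
    using assms(1) vec.scale_cancel_right by blast
  then show ?thesis using assms(2) by (simp add: power2_eq_square)
qed

text \<open>With \<open>A = L3 a b\<close>, the vector \<open>A (A x) - \<mu> *s A x\<close> is as
  required by \<open>L3_cube\<close>, provided it is nonzero for some \<open>x\<close>. Otherwise an
  operator symmetric for \<open>cdot\<close> would equal \<open>\<mu>\<close> times a skew one,
  forcing \<open>A = 0\<close>.\<close>

lemma L3_opposite_eigenvector:
  assumes v: "v \<noteq> 0" "\<mu> \<noteq> 0" "L3 a b v = \<mu> *s v"
  shows "\<exists>w. w \<noteq> 0 \<and> L3 a b w = (- \<mu>) *s w"
proof -
  let ?A = "L3 a b"
  have "\<exists>x. ?A (?A x) - \<mu> *s ?A x \<noteq> 0"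
  proof (rule ccontr)
    assume "\<not> ?thesis"
    then have sq: "?A (?A x) = \<mu> *s ?A x" for x by simp
    have sc: "cdot (c *s x) y = c * cdot x y" "cdot x (c *s y) = c * cdot x y" for c x y
      by (simp_all add: cdot_def algebra_simps)
    have "\<mu> * cdot (?A x) y = - (\<mu> * cdot (?A x) y)" for x y
    proof -
      have "\<mu> * cdot (?A x) y = cdot (?A (?A x)) y" by (simp add: sq sc)
      also have "\<dots> = cdot x (?A (?A y))" by (simp add: L3_skew)
      also have "\<dots> = \<mu> * cdot x (?A y)" by (simp add: sq sc)
      also have "\<dots> = - (\<mu> * cdot (?A x) y)" by (simp add: L3_skew)
      finally show ?thesis .
    qed
    then have z: "cdot (?A v) y = 0" for y using v(2) by (simp add: eq_neg_iff_add_eq_0 mult_2[symmetric])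
    have "?A v = 0"
      using z[of "L3_e 1"] z[of "L3_e 2"] z[of "L3_e 3"] z[of "L3_e 4"]
      by (simp add: cdot_def L3_e_nth vec4_eq_iff)
    then show False using v by simp
  qed
  then obtain x where x: "?A (?A x) - \<mu> *s ?A x \<noteq> 0" by blast
  have mu2: "\<mu> * \<mu> = (cdot a b)^2 - cdot a a * cdot b b"
    using L3_eigenvalue_sq[OF v] by (simp add: power2_eq_square)
  have "?A (?A (?A x) - \<mu> *s ?A x) = (\<mu> * \<mu>) *s ?A x - \<mu> *s ?A (?A x)"
    by (simp only: L3_linear3 L3_cube mu2)
  also have "\<dots> = (- \<mu>) *s (?A (?A x) - \<mu> *s ?A x)"
    by (simp add: vec_eq_iff algebra_simps)
  finally show ?thesis using x by blast
qed

section \<open>Alternating forms on a plane and the two roots\<close>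

lemma alt_forms_combination:
  assumes \<alpha>: "\<alpha> \<in> L3.alt_forms (vec.span {a, b})"
  shows "\<alpha> (p *s a + q *s b) (r *s a + s *s b) = (p * s - q * r) * \<alpha> a b"
proof -
  let ?h = "vec.span {a, b}"
  have ab: "a \<in> ?h" "b \<in> ?h" by (simp_all add: vec.span_base)
  have mem: "c *s x \<in> ?h" "y \<in> ?h \<Longrightarrow> x + y \<in> ?h" if "x \<in> ?h" for c x y
    using that by (simp_all add: vec.span_scale vec.span_add)
  have add: "\<alpha> (x + y) z = \<alpha> x z + \<alpha> y z" "\<alpha> z (x + y) = \<alpha> z x + \<alpha> z y" if "x \<in> ?h" "y \<in> ?h" "z \<in> ?h" for x y z
    using \<alpha> that unfolding L3.alt_forms_def by blast+
  have sc: "\<alpha> (c *s x) y = c * \<alpha> x y" "\<alpha> x (c *s y) = c * \<alpha> x y" if "x \<in> ?h" "y \<in> ?h" for c x y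
    using \<alpha> that unfolding L3.alt_forms_def by blast+
  have alt: "\<alpha> x x = 0" if "x \<in> ?h" for x using \<alpha> that unfolding L3.alt_forms_def by blast
  have "\<alpha> (a + b) (a + b) = \<alpha> b a + \<alpha> a b"
    by (simp add: add(1)[OF ab mem(2)[OF ab]] add(2)[OF ab ab(1)] add(2)[OF ab ab(2)] alt ab)
  then have ba: "\<alpha> b a = - \<alpha> a b"
    using alt[OF mem(2)[OF ab]] by (simp add: eq_neg_iff_add_eq_0)
  show ?thesis by (simp add: add sc ab mem alt ba algebra_simps)
qed

lemma alt_forms_eqI:
  assumes "\<alpha> \<in> L3.alt_forms (vec.span {a, b})" "\<beta> \<in> L3.alt_forms (vec.span {a, b})" "\<alpha> a b = \<beta> a b"
  shows "\<alpha> = \<beta>"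
proof (intro ext)
  fix x y
  show "\<alpha> x y = \<beta> x y"
  proof (cases "x \<in> vec.span {a, b} \<and> y \<in> vec.span {a, b}")
    case True
    then obtain p q r s where "x = p *s a + q *s b" "y = r *s a + s *s b" unfolding in_span_pair by blast
    then show ?thesis using assms by (simp only: alt_forms_combination)
  next
    case False
    then have "\<alpha> x y = 0" "\<beta> x y = 0" using assms(1,2) unfolding L3.alt_forms_def by blast+
    then show ?thesis by simp
  qed
qed

lemma cartan_roots:
  assumes C: "L3.cartan_subalgebra \<hh>"
  obtains a b \<alpha> where "L3.roots \<hh> = {\<alpha>, - \<alpha>}" "\<alpha> \<in> L3.alt_forms \<hh>" "- \<alpha> \<in> L3.alt_forms \<hh>" "\<alpha> a b \<noteq> 0"
proof -
  obtain a b i j where h: "\<hh> = vec.span {a, b}" and m: "a$i * b$j - a$j * b$i \<noteq> 0"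
    using cartan_span_pair[OF C] by blast
  obtain v \<mu> where v: "v \<noteq> 0" "\<mu> \<noteq> 0" "L3 a b v = \<mu> *s v" using cartan_eigenvalue[OF C h m] by blast
  obtain k where k: "v$k \<noteq> 0" using v(1) by (auto simp: vec_eq_iff)
  obtain w where w: "w \<noteq> 0" "L3 a b w = (- \<mu>) *s w" using L3_opposite_eigenvector[OF v] by blast
  have ab: "a \<in> \<hh>" "b \<in> \<hh>" unfolding h by (simp_all add: vec.span_base)
  have sub: "vec.subspace \<hh>" unfolding h by (rule vec.subspace_span)
  \<comment> \<open>The eigenvalue of \<open>L3 x y\<close> at \<open>v\<close>, read off at a
    coordinate where \<open>v\<close> does not vanish, so that bilinearity is inherited from
    \<open>L3\<close>.\<close>
  define \<alpha> where "\<alpha> x y = (if x \<in> \<hh> \<and> y \<in> \<hh> then L3 x y v $ k / v$k else 0)" for x y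
  have nth: "L3 (x + y) z v = L3 x z v + L3 y z v" "L3 z (x + y) v = L3 z x v + L3 z y v"
    "L3 (c *s x) y v = c *s L3 x y v" "L3 x (c *s y) v = c *s L3 x y v" "L3 x x v = 0" for x y z c
    by (simp_all add: vec4_eq_iff L3_nth minor3_def algebra_simps)
  have alt: "\<alpha> \<in> L3.alt_forms \<hh>"
    unfolding L3.alt_forms_def \<alpha>_def
    by (auto simp: nth vec.subspace_add[OF sub] vec.subspace_scale[OF sub] add_divide_distrib)
  then have alt': "- \<alpha> \<in> L3.alt_forms \<hh>" unfolding L3.alt_forms_def by (auto simp: algebra_simps)
  have \<alpha>ab: "\<alpha> a b = \<mu>" using ab k v(3) by (simp add: \<alpha>_def)
  have act: "L3 x y u = \<beta> x y *s u" if "x \<in> \<hh>" "y \<in> \<hh>" "\<beta> \<in> L3.alt_forms \<hh>" "L3 a b u = \<beta> a b *s u" for x y u \<beta>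
  proof -
    obtain p q r s where "x = p *s a + q *s b" "y = r *s a + s *s b" using \<open>x \<in> \<hh>\<close> \<open>y \<in> \<hh>\<close> unfolding h in_span_pair by blast
    then show ?thesis using that(3,4) unfolding h by (simp add: L3_combination alt_forms_combination)
  qed
  have nz: "\<alpha> \<noteq> 0" "- \<alpha> \<noteq> 0" using \<alpha>ab v(2) by auto
  have r1: "\<alpha> \<in> L3.roots \<hh>" unfolding L3.roots_def
    using alt nz v act[OF _ _ alt, of _ _ v] \<alpha>ab by (intro CollectI conjI exI[of _ v] ballI) simp_all
  have r2: "- \<alpha> \<in> L3.roots \<hh>" unfolding L3.roots_def
    using alt' nz w act[OF _ _ alt', of _ _ w] \<alpha>ab by (intro CollectI conjI exI[of _ w] ballI) simp_all
  have "\<beta> = \<alpha> \<or> \<beta> = - \<alpha>" if "\<beta> \<in> L3.roots \<hh>" for \<beta>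
  proof -
    have b: "\<beta> \<in> L3.alt_forms \<hh>" "\<beta> \<noteq> 0" using that unfolding L3.roots_def by blast+
    have "\<exists>u. u \<noteq> 0 \<and> (\<forall>x\<in>\<hh>. \<forall>y\<in>\<hh>. L3 x y u = \<beta> x y *s u)"
      using that unfolding L3.roots_def mem_Collect_eq by (elim conjE)
    then obtain u where u0: "u \<noteq> 0" "\<forall>x\<in>\<hh>. \<forall>y\<in>\<hh>. L3 x y u = \<beta> x y *s u" by (elim exE conjE)
    then have u: "u \<noteq> 0" "L3 a b u = \<beta> a b *s u" using bspec[OF bspec[OF u0(2) ab(1)] ab(2)] by simp_all
    have "(0 :: complex^4 \<Rightarrow> complex^4 \<Rightarrow> complex) \<in> L3.alt_forms \<hh>" unfolding L3.alt_forms_def by simp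
    then have nz: "\<beta> a b \<noteq> 0" using alt_forms_eqI[of \<beta> a b 0] b unfolding h by auto
    have "(\<beta> a b)^2 = \<mu>^2" using L3_eigenvalue_sq[OF u(1) nz u(2)] L3_eigenvalue_sq[OF v] by simp
    then have "\<beta> a b = \<mu> \<or> \<beta> a b = - \<mu>" by (simp add: power2_eq_iff)
    then show ?thesis
      using alt_forms_eqI[of \<beta> a b \<alpha>] alt_forms_eqI[of \<beta> a b "- \<alpha>"] alt alt' b(1) \<alpha>ab unfolding h by auto
  qed
  then have "L3.roots \<hh> = {\<alpha>, - \<alpha>}" using r1 r2 by blast
  then show ?thesis using that[OF _ alt alt', of a b] \<alpha>ab v(2) by simp
qed

lemma direction_exists:
  assumes "L3.cartan_subalgebra \<hh>" shows "\<exists>l. L3.direction \<hh> l"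
proof -
  obtain a b \<alpha> where R: "L3.roots \<hh> = {\<alpha>, - \<alpha>}" "\<alpha> \<in> L3.alt_forms \<hh>" "- \<alpha> \<in> L3.alt_forms \<hh>" "\<alpha> a b \<noteq> 0"
    by (rule cartan_roots[OF assms])
  \<comment> \<open>Normalised to take the values 1 and -1 on the two roots.\<close>
  have "L3.direction \<hh> (\<lambda>\<beta>. Re (\<beta> a b / \<alpha> a b))"
    unfolding L3.direction_def R(1) using R(4)
    by (auto simp: add_divide_distrib Re_complex_of_real mult.assoc[symmetric] times_divide_eq_right[symmetric] simp del: times_divide_eq_right)
  then show ?thesis by blast
qed

lemma one_node:
  assumes "L3.cartan_subalgebra \<hh>" and l: "L3.direction \<hh> l"
  shows "card (L3.dynkin_nodes \<hh> l) = 1"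
proof -
  obtain a b \<alpha> where R: "L3.roots \<hh> = {\<alpha>, - \<alpha>}" "\<alpha> \<in> L3.alt_forms \<hh>" "- \<alpha> \<in> L3.alt_forms \<hh>" "\<alpha> a b \<noteq> 0"
    by (rule cartan_roots[OF assms(1)])
  have add: "l (\<beta> + \<gamma>) = l \<beta> + l \<gamma>" if "\<beta> \<in> L3.alt_forms \<hh>" "\<gamma> \<in> L3.alt_forms \<hh>" for \<beta> \<gamma>
    using l that unfolding L3.direction_def by blast
  have "(0 :: complex^4 \<Rightarrow> complex^4 \<Rightarrow> complex) \<in> L3.alt_forms \<hh>" unfolding L3.alt_forms_def by simp
  then have "l 0 = 0" using add[of 0 0] by simp
  moreover have "\<alpha> + - \<alpha> = 0" by simp
  ultimately have neg: "l (- \<alpha>) = - l \<alpha>" using add[OF R(2,3)] by simp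
  have nz0: "\<alpha> \<noteq> 0" "- \<alpha> \<noteq> 0" using R(4) by auto
  have nz: "l \<alpha> \<noteq> 0" using l R(1) unfolding L3.direction_def by blast
  have "\<exists>\<beta>. \<beta> \<noteq> 0 \<and> L3.positive_roots \<hh> l = {\<beta>}"
  proof (cases "l \<alpha> > 0")
    case True
    then have "L3.positive_roots \<hh> l = {\<alpha>}" unfolding L3.positive_roots_def R(1) using neg by auto
    then show ?thesis using nz0(1) by (intro exI[of _ \<alpha>] conjI)
  next
    case False
    then have "L3.positive_roots \<hh> l = {- \<alpha>}" unfolding L3.positive_roots_def R(1) using neg nz by auto
    then show ?thesis using nz0(2) by (intro exI[of _ "- \<alpha>"] conjI)
  qed
  then obtain \<beta> where b: "\<beta> \<noteq> 0" "L3.positive_roots \<hh> l = {\<beta>}" by (elim exE conjE)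
  have "L3.dynkin_nodes \<hh> l = {\<beta>}"
    unfolding L3.dynkin_nodes_def L3.simple_roots_def b(2) using b(1) by auto
  then show ?thesis by simp
qed

lemma cartan_exists: "L3.cartan_subalgebra (vec.span {L3_H1, L3_H2})"
  unfolding L3.cartan_subalgebra_def
proof (intro conjI allI impI subalgebra_span_pair commuting_span_pair)
  have m: "L3_H1$2 * L3_H2$3 - L3_H1$3 * L3_H2$2 \<noteq> 0" by (simp add: L3_HXY_nth)
  fix \<kk> assume k: "L3.subalgebra \<kk> \<and> L3.commuting \<kk> \<and> vec.span {L3_H1, L3_H2} \<subseteq> \<kk>"
  have H: "L3_H1 \<in> \<kk>" "L3_H2 \<in> \<kk>" using k vec.span_base[of _ "{L3_H1, L3_H2}"] by blast+
  have "\<kk> \<subseteq> vec.span {L3_H1, L3_H2}"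
  proof
    fix p assume "p \<in> \<kk>"
    then have "L3 L3_H1 L3_H2 p = 0" using k H unfolding L3.commuting_def by blast
    then show "p \<in> vec.span {L3_H1, L3_H2}" by (rule L3_kernel[OF m])
  qed
  then show "\<kk> = vec.span {L3_H1, L3_H2}" using k by blast
next
  have z: "L3 L3_H1 L3_H2 L3_H1 = 0" "L3 L3_H1 L3_H2 L3_H2 = 0"
    by (simp_all add: vec4_eq_iff L3_nth minor3_def algebra_simps)
  have eig: "\<exists>c. L3 L3_H1 L3_H2 v = c *s v" if "v \<in> {L3_H1, L3_H2, L3_X, L3_Y}" for v
    using that
  proof (elim insertE emptyE)
    assume "v = L3_Y" then show ?thesis by (intro exI[of _ "- 1"]) (simp add: L3_HXY_brackets)
  qed (auto simp: z L3_HXY_brackets intro: exI[of _ 0] exI[of _ 1])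
  then have "\<exists>c. L3 h1 h2 v = c *s v"
    if vmem: "v \<in> {L3_H1, L3_H2, L3_X, L3_Y}" "h1 \<in> vec.span {L3_H1, L3_H2}" "h2 \<in> vec.span {L3_H1, L3_H2}" for v h1 h2
  proof -
    obtain p q r s where "h1 = p *s L3_H1 + q *s L3_H2" "h2 = r *s L3_H1 + s *s L3_H2"
      using vmem(2,3) unfolding in_span_pair by blast
    moreover obtain c where "L3 L3_H1 L3_H2 v = c *s v"
      using eig[OF vmem(1)] by blast
    ultimately have "L3 h1 h2 v = ((p * s - q * r) * c) *s v" by (simp add: L3_combination)
    then show ?thesis by blast
  qed
  then show "L3.acts_diagonally (vec.span {L3_H1, L3_H2})"
    unfolding L3.acts_diagonally_def L3.ad_def
    by (intro exI[of _ "{L3_H1, L3_H2, L3_X, L3_Y}"] conjI span_HXY spanning_basis4(2)[OF span_HXY] ballI)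
qed

section \<open>Invariant polynomials\<close>

text \<open>Averaging needs the degree of each term, so polynomials are rewritten as sums of
  monomials, a monomial being a list of variable indices.\<close>

inductive_set monomial_sums :: "((complex^'n) \<Rightarrow> complex) set" where
  mono: "(\<lambda>x. c * (\<Prod>i\<leftarrow>ms. x$i)) \<in> monomial_sums"
| add: "\<lbrakk>f \<in> monomial_sums; g \<in> monomial_sums\<rbrakk> \<Longrightarrow> (\<lambda>x. f x + g x) \<in> monomial_sums"

lemma monomial_sums_mult:
  assumes "f \<in> monomial_sums" "g \<in> monomial_sums" shows "(\<lambda>x. f x * g x) \<in> monomial_sums"
  using assms(1)
proof induction
  case (mono c ms)
  show ?case using assms(2)
  proof induction
    case (mono d js)
    have "(\<lambda>x. c * (\<Prod>i\<leftarrow>ms. x$i) * (d * (\<Prod>i\<leftarrow>js. x$i))) = (\<lambda>x. (c * d) * (\<Prod>i\<leftarrow>ms @ js. x$i))"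
      by (simp add: mult_ac)
    then show ?case using monomial_sums.mono by metis
  next
    case (add f g)
    then show ?case unfolding distrib_left by (intro monomial_sums.add)
  qed
next
  case (add f g)
  then show ?case unfolding distrib_right by (intro monomial_sums.add)
qed

lemma polys_monomial_sums: "f \<in> polys \<Longrightarrow> f \<in> monomial_sums"
  unfolding polys_def
proof (induction rule: alg_gen.induct)
  case (const c)
  show ?case using monomial_sums.mono[of c "[]"] by simp
next
  case (gen f)
  then obtain i where "f = (\<lambda>x. x$i)" by blast
  then show ?case using monomial_sums.mono[of 1 "[i]"] by simp
qed (auto intro: monomial_sums.add monomial_sums_mult)

abbreviation cubic_algebra :: "((complex^3) \<Rightarrow> complex) set" where
  "cubic_algebra \<equiv> alg_gen (range (\<lambda>i x. cubics x $ i))"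

lemma cubic_in_cubic_algebra: "(\<lambda>x. x$i * x$j * x$k) \<in> cubic_algebra"
  by (rule alg_gen.gen) (auto simp: cubics_def intro!: image_eqI[of _ _ "(i, j, k)"])

lemma monomial_in_cubic_algebra: "length ms = 3 * n \<Longrightarrow> (\<lambda>x. \<Prod>i\<leftarrow>ms. x$i) \<in> cubic_algebra"
proof (induction n arbitrary: ms)
  case 0
  then show ?case using alg_gen.const[of 1] by simp
next
  case (Suc n)
  then obtain i j k js where ms: "ms = i # j # k # js" "length js = 3 * n"
    by (auto simp: length_Suc_conv numeral_3_eq_3)
  have "(\<lambda>x. (x$i * x$j * x$k) * (\<Prod>i\<leftarrow>js. x$i)) \<in> cubic_algebra"
    by (rule alg_gen.mult[OF cubic_in_cubic_algebra Suc.IH[OF ms(2)]])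
  then show ?case unfolding ms(1) by (simp add: mult.assoc)
qed

lemma prod_list_scale: "(\<Prod>i\<leftarrow>ms. (c *s (x::complex^'n))$i) = c ^ length ms * (\<Prod>i\<leftarrow>ms. x$i)"
  by (induction ms) (simp_all add: mult_ac)

lemma cube_root_sum:
  fixes \<epsilon> :: complex assumes "\<epsilon> ^ 3 = 1" "\<epsilon> \<noteq> 1" shows "1 + \<epsilon> + \<epsilon>^2 = 0"
proof -
  have "(\<epsilon> - 1) * (1 + \<epsilon> + \<epsilon>^2) = \<epsilon>^3 - 1" by algebra
  then show ?thesis using assms by simp
qed

text \<open>The group average keeps monomials of degree divisible by 3, which group into cubics, and
  kills the others because the three cube roots of unity have sum 0.\<close>

lemma average_in_cubic_algebra:
  fixes \<epsilon> :: complex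
  assumes e: "\<epsilon> ^ 3 = 1" "\<epsilon> \<noteq> 1" and "f \<in> monomial_sums"
  shows "(\<lambda>x. (f x + f (\<epsilon> *s x) + f (\<epsilon>^2 *s x)) / 3) \<in> cubic_algebra"
  using assms(3)
proof induction
  case (mono c ms)
  let ?n = "length ms" let ?s = "1 + \<epsilon>^?n + (\<epsilon>^2)^?n"
  have eq: "(\<lambda>x. (c * (\<Prod>i\<leftarrow>ms. x$i) + c * (\<Prod>i\<leftarrow>ms. (\<epsilon> *s x)$i) + c * (\<Prod>i\<leftarrow>ms. (\<epsilon>^2 *s x)$i)) / 3)
      = (\<lambda>x. (c * ?s / 3) * (\<Prod>i\<leftarrow>ms. x$i))"
    unfolding prod_list_scale by (simp add: field_simps)
  have p: "\<epsilon> ^ (3 * m + r) = \<epsilon> ^ r" for m r by (simp add: power_add power_mult e)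
  show ?case unfolding eq
  proof (cases "?n mod 3 = 0")
    case True
    then obtain m where m: "?n = 3 * m" by auto
    have "(\<lambda>x. (\<lambda>_. c * ?s / 3) x * (\<Prod>i\<leftarrow>ms. x$i)) \<in> cubic_algebra"
      by (rule alg_gen.mult[OF alg_gen.const monomial_in_cubic_algebra[OF m]])
    then show "(\<lambda>x. (c * ?s / 3) * (\<Prod>i\<leftarrow>ms. x$i)) \<in> cubic_algebra" by simp
  next
    case False
    obtain m r where mr: "?n = 3 * m + r" "r = 1 \<or> r = 2"
      using False mult_div_mod_eq[of 3 ?n] by (intro that[of "?n div 3" "?n mod 3"]) auto
    have en: "\<epsilon>^?n = \<epsilon>^r" unfolding mr(1) by (rule p)
    have "(\<epsilon>^2)^?n = (\<epsilon>^?n)^2" by (simp add: power_mult[symmetric] mult.commute)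
    also have "\<dots> = \<epsilon>^(2 * r)" unfolding en by (simp add: power_mult[symmetric] mult.commute)
    finally have "?s = 1 + \<epsilon>^r + \<epsilon>^(2 * r)" using en by simp
    also have "\<dots> = 0"
      using mr(2) cube_root_sum[OF e] p[of 1 1] by (auto simp: eval_nat_numeral algebra_simps)
    finally have "(\<lambda>x::complex^3. (c * ?s / 3) * (\<Prod>i\<leftarrow>ms. x$i)) = (\<lambda>_. 0)" by simp
    then show "(\<lambda>x. (c * ?s / 3) * (\<Prod>i\<leftarrow>ms. x$i)) \<in> cubic_algebra" using alg_gen.const by metis
  qed
next
  case (add f g)
  have "(\<lambda>x. (f x + g x + (f (\<epsilon> *s x) + g (\<epsilon> *s x)) + (f (\<epsilon>^2 *s x) + g (\<epsilon>^2 *s x))) / 3)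
     = (\<lambda>x. (f x + f (\<epsilon> *s x) + f (\<epsilon>^2 *s x)) / 3 + (g x + g (\<epsilon> *s x) + g (\<epsilon>^2 *s x)) / 3)"
    by (simp add: fun_eq_iff field_simps)
  then show ?case using alg_gen.add[OF add.IH] by simp
qed

lemma polys_nth: "(\<lambda>x. x$i) \<in> polys"
  unfolding polys_def by (rule alg_gen.gen) blast

lemma polys_mult: "\<lbrakk>f \<in> polys; g \<in> polys\<rbrakk> \<Longrightarrow> (\<lambda>x. f x * g x) \<in> polys"
  unfolding polys_def by (rule alg_gen.mult)

lemma cubics_nth: "cubics x $ (i, j, k) = x$i * x$j * x$k"
  by (simp add: cubics_def)

lemma cubics_nth': "cubics x $ m = x $ fst m * x $ fst (snd m) * x $ snd (snd m)"
  by (simp add: cubics_def)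

lemma cubics_polys: "(\<lambda>x. cubics x $ m) \<in> polys"
  unfolding cubics_nth' by (intro polys_mult polys_nth)

lemma cubics_scale: "cubics (c *s x) = c^3 *s cubics x"
  by (simp add: vec_eq_iff cubics_nth' power3_eq_cube)

lemma cubics_eq_0_iff: "cubics x = 0 \<longleftrightarrow> x = 0"
proof
  assume "cubics x = 0"
  then have "cubics x $ (i, i, i) = 0" for i by simp
  then show "x = 0" by (simp add: vec_eq_iff cubics_nth)
qed (simp add: vec_eq_iff cubics_nth')

lemma cubics_proportional:
  assumes "cubics y = c *s cubics x" "x \<noteq> 0" "y \<noteq> 0"
  obtains \<mu> i where "y = \<mu> *s x" "x$i \<noteq> 0" "\<mu>^3 = c" "\<mu> \<noteq> 0"
proof -
  obtain i where i: "y$i \<noteq> 0" using assms(3) by (auto simp: vec_eq_iff)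
  have r: "y$j * y$k * y$l = c * (x$j * x$k * x$l)" for j k l
    using assms(1) cubics_nth[of y j k l] cubics_nth[of x j k l] by (metis vector_smult_component)
  have xi: "c \<noteq> 0" "x$i \<noteq> 0" using r[of i i i] i by auto
  \<comment> \<open>From \<open>y$i * y$i * y$j = c * (x$i * x$i * x$j)\<close>, solved for
    \<open>y$j\<close>.\<close>
  define \<mu> where "\<mu> = c * x$i * x$i / (y$i * y$i)"
  have "y$j = \<mu> * x$j" for j using r[of i i j] i by (simp add: \<mu>_def field_simps)
  then have y: "y = \<mu> *s x" by (simp add: vec_eq_iff)
  moreover have "\<mu>^3 * (x$i * x$i * x$i) = c * (x$i * x$i * x$i)"
    using r[of i i i] y by (simp add: power3_eq_cube mult_ac)
  then have "\<mu>^3 = c" using xi by simp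
  moreover have "\<mu> \<noteq> 0" using y assms(3) by auto
  ultimately show ?thesis using that xi by blast
qed

lemma quotient_map_cubics:
  assumes e: "\<epsilon> ^ 3 = 1" "\<epsilon> \<noteq> 1" shows "quotient_map_by \<epsilon> cubics"
  unfolding quotient_map_by_def
proof (intro conjI allI)
  show "{f \<in> polys. \<forall>x. f (\<epsilon> *s x) = f x} = cubic_algebra"
  proof (intro subset_antisym subsetI)
    fix f :: "complex^3 \<Rightarrow> complex" assume "f \<in> {f \<in> polys. \<forall>x. f (\<epsilon> *s x) = f x}"
    then have f: "f \<in> polys" "\<And>x. f (\<epsilon> *s x) = f x" by blast+
    have "f (\<epsilon>^2 *s x) = f x" for x
      using f(2)[of "\<epsilon> *s x"] f(2)[of x] by (simp add: power2_eq_square)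
    then have "(\<lambda>x. (f x + f (\<epsilon> *s x) + f (\<epsilon>^2 *s x)) / 3) = f" by (simp add: f(2))
    then show "f \<in> cubic_algebra"
      using average_in_cubic_algebra[OF e polys_monomial_sums[OF f(1)]] by simp
  next
    fix f :: "complex^3 \<Rightarrow> complex" assume "f \<in> cubic_algebra"
    then have "f \<in> polys \<and> (\<forall>x. f (\<epsilon> *s x) = f x)"
    proof (induction rule: alg_gen.induct)
      case (const c)
      show ?case unfolding polys_def by (simp add: alg_gen.const)
    next
      case (gen f)
      then obtain m where m: "f = (\<lambda>x. cubics x $ m)" by blast
      show ?case unfolding m using cubics_polys by (simp add: cubics_scale e)
    next
      case (add f g)
      then show ?case unfolding polys_def by (simp add: alg_gen.add)
    next
      case (mult f g)
      then show ?case unfolding polys_def by (simp add: alg_gen.mult)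
    qed
    then show "f \<in> {f \<in> polys. \<forall>x. f (\<epsilon> *s x) = f x}" by blast
  qed
  fix x y :: "complex^3"
  show "cubics x = cubics y \<longleftrightarrow> (\<exists>k::nat. y = \<epsilon> ^ k *s x)"
  proof
    assume eq: "cubics x = cubics y"
    show "\<exists>k::nat. y = \<epsilon> ^ k *s x"
    proof (cases "x = 0")
      case True
      then have "y = 0" using eq cubics_eq_0_iff by metis
      then show ?thesis using True by simp
    next
      case False
      then have "y \<noteq> 0" using eq cubics_eq_0_iff by metis
      then obtain \<mu> where l: "y = \<mu> *s x" "\<mu>^3 = 1"
        using cubics_proportional[of y 1 x] eq False by auto
      have "(\<mu> - 1) * (\<mu> - \<epsilon>) * (\<mu> - \<epsilon>^2) = \<mu>^3 - \<mu>^2 * (1 + \<epsilon> + \<epsilon>^2) + \<mu> * (\<epsilon> * (1 + \<epsilon> + \<epsilon>^2)) - \<epsilon>^3"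
        by algebra
      then have "(\<mu> - 1) * (\<mu> - \<epsilon>) * (\<mu> - \<epsilon>^2) = 0" using l(2) e cube_root_sum[OF e] by simp
      then have "\<mu> = \<epsilon>^0 \<or> \<mu> = \<epsilon>^1 \<or> \<mu> = \<epsilon>^2" by auto
      then show ?thesis using l(1) by blast
    qed
  next
    assume "\<exists>k::nat. y = \<epsilon> ^ k *s x"
    then obtain k where "y = \<epsilon> ^ k *s x" by blast
    moreover have "(\<epsilon>^k)^3 = 1" using e(1) by (metis power_mult mult.commute power_one)
    ultimately show "cubics x = cubics y" by (simp add: cubics_scale)
  qed
qed

section \<open>The exceptional divisor\<close>

lemma proj_pt_eq: "proj_pt v = range (\<lambda>c. c *s v)"
  unfolding proj_pt_def by (rule vec.span_singleton)

lemma proj_pt_scale: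
  assumes "c \<noteq> 0" shows "proj_pt (c *s v) = proj_pt v"
  unfolding proj_pt_eq
proof (intro subset_antisym subsetI)
  fix x assume "x \<in> range (\<lambda>d. d *s v)"
  then obtain d where "x = d *s v" by blast
  then have "x = (d / c) *s (c *s v)" using assms by simp
  then show "x \<in> range (\<lambda>d. d *s (c *s v))" by blast
next
  fix x assume "x \<in> range (\<lambda>d. d *s (c *s v))"
  then obtain d where "x = d *s (c *s v)" by blast
  then have "x = (d * c) *s v" by simp
  then show "x \<in> range (\<lambda>d. d *s v)" by blast
qed

lemma self_in_proj_pt: "v \<in> proj_pt v"
  unfolding proj_pt_def by (simp add: vec.span_base)

lemma proj_pt_unique: "\<lbrakk>x \<in> proj_pt v; x \<noteq> 0\<rbrakk> \<Longrightarrow> proj_pt v = proj_pt x"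
  using proj_pt_scale[of _ v] unfolding proj_pt_eq[of v, THEN eqset_imp_iff] by auto

lemma polys2_snd: "(\<lambda>p. snd p $ i) \<in> polys2"
  unfolding polys2_def by (rule alg_gen.gen) blast

lemma polys2_mult: "\<lbrakk>f \<in> polys2; g \<in> polys2\<rbrakk> \<Longrightarrow> (\<lambda>p. f p * g p) \<in> polys2"
  unfolding polys2_def by (rule alg_gen.mult)

lemma polys2_diff: "\<lbrakk>f \<in> polys2; g \<in> polys2\<rbrakk> \<Longrightarrow> (\<lambda>p. f p - g p) \<in> polys2"
  unfolding polys2_def using alg_gen.add[OF _ alg_gen.mult[OF alg_gen.const[of "-1"]], of f _ g] by simp

lemma complex_cube_root: "\<exists>c. c^3 = (z::complex)"
proof (cases "z = 0")
  case False
  have "exp (Ln z / 3) ^ 3 = exp (of_nat 3 * (Ln z / 3))" by (rule exp_of_nat_mult[symmetric])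
  then have "exp (Ln z / 3) ^ 3 = z" using False by simp
  then show ?thesis by blast
qed auto

lemma poly_vanishing:
  fixes P :: "complex poly"
  assumes "\<And>s. s \<noteq> 0 \<Longrightarrow> poly P s = 0" shows "poly P 0 = 0"
proof (rule ccontr)
  assume "poly P 0 \<noteq> 0"
  then have "finite {s. poly P s = 0}" by (intro poly_roots_finite) auto
  moreover have "UNIV - {0} \<subseteq> {s. poly P s = 0}" using assms by blast
  ultimately have "finite (UNIV - {0 :: complex})" by (rule finite_subset[rotated])
  then show False using infinite_UNIV_char_0[where 'a = complex] by simp
qed

text \<open>On the cone over the cubic monomials the relations \<open>v\<^sub>i\<^sub>i\<^sub>j v\<^sub>i\<^sub>i\<^sub>k v\<^sub>i\<^sub>i\<^sub>l = v\<^sub>i\<^sub>i\<^sub>i\<^sup>2 v\<^sub>j\<^sub>k\<^sub>l\<close> and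
  \<open>v\<^sub>j\<^sub>k\<^sub>l\<^sup>3 = v\<^sub>j\<^sub>j\<^sub>j v\<^sub>k\<^sub>k\<^sub>k v\<^sub>l\<^sub>l\<^sub>l\<close> hold; conversely they allow to extract a cube root of \<open>v\<close>.\<close>

lemma exceptional_divisor_cubics: "exceptional_divisor C3_mod_Z3 = {proj_pt (cubics u) | u. u \<noteq> 0}"
proof (intro subset_antisym subsetI)
  fix L assume "L \<in> exceptional_divisor C3_mod_Z3"
  then obtain v where L: "L = proj_pt v" and v: "(0, v) \<in> blow_up C3_mod_Z3"
    unfolding exceptional_divisor_def by blast
  have v0: "v \<noteq> 0" using v unfolding blow_up_def by simp
  have eqn: "f (0, v) = 0" if "f \<in> polys2" "\<And>x t. f (cubics x, t *s cubics x) = 0" for f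
  proof -
    have "\<forall>f\<in>polys2. (\<forall>x\<in>C3_mod_Z3. \<forall>t. x \<noteq> 0 \<and> t \<noteq> 0 \<longrightarrow> f (x, t *s x) = 0) \<longrightarrow> f (0, v) = 0"
      using v unfolding blow_up_def by simp
    moreover have "\<forall>x\<in>C3_mod_Z3. \<forall>t. x \<noteq> 0 \<and> t \<noteq> 0 \<longrightarrow> f (x, t *s x) = 0"
      using that(2) unfolding C3_mod_Z3_def by blast
    ultimately show ?thesis using that(1) by blast
  qed
  have R1: "v$(i,i,j) * v$(i,i,k) * v$(i,i,l) = v$(i,i,i) * v$(i,i,i) * v$(j,k,l)" for i j k l
    using eqn[of "\<lambda>p. snd p $ (i,i,j) * snd p $ (i,i,k) * snd p $ (i,i,l) - snd p $ (i,i,i) * snd p $ (i,i,i) * snd p $ (j,k,l)"]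
    by (simp add: polys2_diff polys2_mult polys2_snd cubics_nth mult_ac)
  have R2: "v$(i,j,k) * v$(i,j,k) * v$(i,j,k) = v$(i,i,i) * v$(j,j,j) * v$(k,k,k)" for i j k
    using eqn[of "\<lambda>p. snd p $ (i,j,k) * snd p $ (i,j,k) * snd p $ (i,j,k) - snd p $ (i,i,i) * snd p $ (j,j,j) * snd p $ (k,k,k)"]
    by (simp add: polys2_diff polys2_mult polys2_snd cubics_nth mult_ac)
  obtain m where "v$m \<noteq> 0" using v0 by (auto simp: vec_eq_iff)
  then obtain i j k where "v$(i,j,k) \<noteq> 0" by (cases m) auto
  then have vi: "v$(i,i,i) \<noteq> 0" using R2[of i j k] by auto
  obtain c where c: "c^3 = v$(i,i,i)" using complex_cube_root by blast
  then have c0: "c \<noteq> 0" using vi by auto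
  \<comment> \<open>Dividing by \<open>c^2\<close>, where \<open>c^3 = v$(i,i,i)\<close>, makes
    coordinate \<open>i\<close> of \<open>u\<close> equal to \<open>c\<close>.\<close>
  define u where "u = (\<chi> j. v$(i,i,j) / c^2)"
  have "cubics u $ (j,k,l) = v$(j,k,l)" for j k l
  proof -
    have "cubics u $ (j,k,l) = (v$(i,i,j) * v$(i,i,k) * v$(i,i,l)) / (c^3 * c^3)"
      by (simp add: cubics_nth u_def power2_eq_square power3_eq_cube mult_ac)
    then show ?thesis unfolding R1 c using vi by simp
  qed
  then have "cubics u = v" by (simp add: vec_eq_iff)
  then show "L \<in> {proj_pt (cubics u) | u. u \<noteq> 0}" using L v0 cubics_eq_0_iff by blast
next
  fix L assume "L \<in> {proj_pt (cubics u) | u. u \<noteq> 0}"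
  then obtain u where u: "L = proj_pt (cubics u)" "u \<noteq> 0" by blast
  let ?w = "cubics u"
  have w0: "?w \<noteq> 0" using u(2) cubics_eq_0_iff by blast
  have "f (0, ?w) = 0" if f: "f \<in> polys2" and van: "\<forall>x\<in>C3_mod_Z3. \<forall>t. x \<noteq> 0 \<and> t \<noteq> 0 \<longrightarrow> f (x, t *s x) = 0" for f
  proof -
    \<comment> \<open>The curve of points \<open>(r^3 *s ?w, ?w)\<close> approaches
      \<open>(0, ?w)\<close>. For nonzero \<open>r\<close> its first entry is
      \<open>cubics (r *s u)\<close>, so \<open>f\<close> vanishes there; a polynomial in
      \<open>r\<close> then vanishes at 0 too.\<close>
    have "\<exists>P. \<forall>r. f (r^3 *s ?w, ?w) = poly P r"
      using f unfolding polys2_def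
    proof (induction rule: alg_gen.induct)
      case (const c)
      show ?case by (rule exI[of _ "[:c:]"]) simp
    next
      case (gen f)
      then consider m where "f = (\<lambda>p. fst p $ m)" | m where "f = (\<lambda>p. snd p $ m)" by blast
      then show ?case
      proof cases
        case (1 m)
        then show ?thesis by (intro exI[of _ "monom (?w $ m) 3"]) (simp add: poly_monom mult.commute)
      next
        case (2 m)
        then show ?thesis by (intro exI[of _ "[:?w $ m:]"]) simp
      qed
    next
      case (add f g)
      then obtain P Q where "\<forall>r. f (r^3 *s ?w, ?w) = poly P r" "\<forall>r. g (r^3 *s ?w, ?w) = poly Q r" by blast
      then show ?case by (intro exI[of _ "P + Q"]) simp
    next
      case (mult f g)
      then obtain P Q where "\<forall>r. f (r^3 *s ?w, ?w) = poly P r" "\<forall>r. g (r^3 *s ?w, ?w) = poly Q r" by blast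
      then show ?case by (intro exI[of _ "P * Q"]) simp
    qed
    then obtain P where P: "\<And>r. f (r^3 *s ?w, ?w) = poly P r" by blast
    have "poly P r = 0" if r: "r \<noteq> 0" for r
    proof -
      have "r^3 *s ?w \<in> C3_mod_Z3" unfolding C3_mod_Z3_def cubics_scale[symmetric] by blast
      moreover have "r^3 *s ?w \<noteq> 0" "inverse (r^3) \<noteq> 0" using r w0 by simp_all
      ultimately have "f (r^3 *s ?w, inverse (r^3) *s (r^3 *s ?w)) = 0" using van by blast
      then show ?thesis using r P[of r] by simp
    qed
    then have "poly P 0 = 0" by (rule poly_vanishing)
    then show ?thesis using P[of 0] by simp
  qed
  then have "(0, ?w) \<in> blow_up C3_mod_Z3" unfolding blow_up_def using w0 by simp
  then show "L \<in> exceptional_divisor C3_mod_Z3" unfolding exceptional_divisor_def u(1) by blast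
qed

section \<open>Irreducibility of the exceptional divisor\<close>

lemma polys_on_line:
  assumes "f \<in> polys" shows "\<exists>P. \<forall>s. f (cubics (a + s *s b)) = poly P s"
  using assms unfolding polys_def
proof (induction rule: alg_gen.induct)
  case (const c)
  show ?case by (rule exI[of _ "[:c:]"]) simp
next
  case (gen f)
  then obtain m where m: "f = (\<lambda>x. x$m)" by blast
  let ?l = "\<lambda>i. [:a$i, b$i:]"
  show ?case unfolding m
    by (rule exI[of _ "?l (fst m) * ?l (fst (snd m)) * ?l (snd (snd m))"]) (simp add: cubics_nth' algebra_simps)
next
  case (add f g)
  then obtain P Q where "\<forall>s. f (cubics (a + s *s b)) = poly P s" "\<forall>s. g (cubics (a + s *s b)) = poly Q s" by blast
  then show ?case by (intro exI[of _ "P + Q"]) simp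
next
  case (mult f g)
  then obtain P Q where "\<forall>s. f (cubics (a + s *s b)) = poly P s" "\<forall>s. g (cubics (a + s *s b)) = poly Q s" by blast
  then show ?case by (intro exI[of _ "P * Q"]) simp
qed

lemma proj_closed_separates:
  assumes "proj_closed A" "v \<noteq> 0" "proj_pt v \<notin> A"
  obtains f where "f \<in> polys" "f v \<noteq> 0" "\<And>w. proj_pt w \<in> A \<Longrightarrow> f w = 0"
proof -
  obtain F where F: "F \<subseteq> (\<Union>d. hom_polys d)" "A = {L \<in> proj_space. \<forall>f\<in>F. \<forall>x\<in>L. f x = 0}"
    using assms(1) unfolding proj_closed_def by blast
  have "proj_pt v \<in> proj_space" unfolding proj_space_def using assms(2) by blast
  then obtain f x where f: "f \<in> F" "x \<in> proj_pt v" "f x \<noteq> 0" using assms(3) F(2) by blast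
  obtain d where d: "f \<in> polys" "\<And>c x. f (c *s x) = c ^ d * f x" using F(1) f(1) unfolding hom_polys_def by blast
  obtain c where "x = c *s v" using f(2) unfolding proj_pt_eq by blast
  then have "f v \<noteq> 0" using f(3) d(2) by auto
  moreover have "f w = 0" if "proj_pt w \<in> A" for w using that F(2) f(1) self_in_proj_pt by blast
  ultimately show ?thesis using that d(1) by blast
qed

text \<open>A point outside \<open>A\<close> and a point outside \<open>B\<close> are joined by the
  image of a line. On it the separating equations become nonzero polynomials in one variable, whose
  product cannot vanish identically.\<close>

lemma exceptional_divisor_irreducible: "proj_irreducible (exceptional_divisor C3_mod_Z3)"
  unfolding proj_irreducible_def
proof (intro conjI allI impI)
  let ?E = "exceptional_divisor C3_mod_Z3"
  have "axis 1 1 \<noteq> (0 :: complex^3)" by (simp add: axis_eq_0_iff)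
  then show "?E \<noteq> {}" unfolding exceptional_divisor_cubics by blast
  fix A B :: "(complex^(3 \<times> 3 \<times> 3)) set set"
  assume AB: "proj_closed A \<and> proj_closed B \<and> ?E \<subseteq> A \<union> B"
  show "?E \<subseteq> A \<or> ?E \<subseteq> B"
  proof (rule ccontr)
    assume "\<not> ?thesis"
    then obtain u1 u2 where u: "u1 \<noteq> 0" "proj_pt (cubics u1) \<notin> A" "u2 \<noteq> 0" "proj_pt (cubics u2) \<notin> B"
      unfolding exceptional_divisor_cubics by blast
    obtain f where f: "f \<in> polys" "f (cubics u1) \<noteq> 0" "\<And>w. proj_pt w \<in> A \<Longrightarrow> f w = 0"
      using proj_closed_separates[of A "cubics u1"] AB u cubics_eq_0_iff by blast
    obtain g where g: "g \<in> polys" "g (cubics u2) \<noteq> 0" "\<And>w. proj_pt w \<in> B \<Longrightarrow> g w = 0"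
      using proj_closed_separates[of B "cubics u2"] AB u cubics_eq_0_iff by blast
    let ?u = "\<lambda>s. u1 + s *s (u2 - u1)"
    obtain P where P: "\<And>s. f (cubics (?u s)) = poly P s" using polys_on_line[OF f(1)] by blast
    obtain Q where Q: "\<And>s. g (cubics (?u s)) = poly Q s" using polys_on_line[OF g(1)] by blast
    obtain k where k: "u1$k \<noteq> 0" using u(1) by (auto simp: vec_eq_iff)
    \<comment> \<open>A nonzero factor covering the parameter at which the line may pass through the
      origin, where there is no projective point.\<close>
    let ?Z = "[:u1$k, (u2 - u1)$k:]"
    have "poly (P * Q * ?Z) s = 0" for s
    proof (cases "?u s = 0")
      case True
      then have "?u s $ k = 0" by (simp only: zero_index)
      then have "poly ?Z s = 0" by (simp add: algebra_simps)
      then show ?thesis by (simp only: poly_mult mult_zero_right)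
    next
      case False
      then have "proj_pt (cubics (?u s)) \<in> A \<union> B" using AB unfolding exceptional_divisor_cubics by blast
      then have "poly P s = 0 \<or> poly Q s = 0" using f(3) g(3) P Q by (metis UnE)
      then show ?thesis by auto
    qed
    then have "P * Q * ?Z = 0" using poly_all_0_iff_0[of "P * Q * ?Z"] by blast
    then have "P = 0 \<or> Q = 0 \<or> ?Z = 0" by (simp only: mult_eq_0_iff disj_assoc)
    moreover have "P \<noteq> 0" using P[of 0] f(2) by auto
    moreover have "Q \<noteq> 0" using Q[of 1] g(2) by auto
    ultimately show False using k by simp
  qed
qed

lemma components_exceptional_divisor:
  "irreducible_components (exceptional_divisor C3_mod_Z3) = {exceptional_divisor C3_mod_Z3}"
  unfolding irreducible_components_def using exceptional_divisor_irreducible by blast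

text \<open>The span of all image vectors avoids choosing a representative of the line.\<close>

definition veronese :: "(complex^3) set \<Rightarrow> (complex^(3 \<times> 3 \<times> 3)) set" where
  "veronese L = vec.span (cubics ` L)"

lemma veronese_pt: "veronese (proj_pt u) = proj_pt (cubics u)"
  unfolding veronese_def proj_pt_def[of "cubics u"]
proof (intro subset_antisym vec.span_minimal vec.subspace_span)
  show "cubics ` proj_pt u \<subseteq> vec.span {cubics u}"
  proof
    fix w assume "w \<in> cubics ` proj_pt u"
    then obtain c where "w = cubics (c *s u)" unfolding proj_pt_eq by blast
    then have "w = c^3 *s cubics u" by (simp only: cubics_scale)
    then show "w \<in> vec.span {cubics u}" by (simp only: vec.span_scale vec.span_base singletonI)
  qed
  show "{cubics u} \<subseteq> vec.span (cubics ` proj_pt u)"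
    using self_in_proj_pt[of u] by (auto intro: vec.span_base)
qed

lemma veronese_bij: "bij_betw veronese proj_space (exceptional_divisor C3_mod_Z3)"
  unfolding bij_betw_def
proof
  show "inj_on veronese proj_space"
  proof (rule inj_onI)
    fix L M :: "(complex^3) set" assume "L \<in> proj_space" "M \<in> proj_space" and eq: "veronese L = veronese M"
    then obtain x y where xy: "L = proj_pt x" "x \<noteq> 0" "M = proj_pt y" "y \<noteq> 0" unfolding proj_space_def by blast
    then have "cubics y \<in> proj_pt (cubics x)" using eq self_in_proj_pt by (simp add: veronese_pt)
    then obtain c where "cubics y = c *s cubics x" unfolding proj_pt_eq by blast
    then obtain \<mu> i where "y = \<mu> *s x" "x$i \<noteq> 0" "\<mu>^3 = c" "\<mu> \<noteq> 0"
      by (rule cubics_proportional[OF _ xy(2,4)])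
    then show "L = M" using xy proj_pt_scale[of \<mu> x] by simp
  qed
  show "veronese ` proj_space = exceptional_divisor C3_mod_Z3"
  proof (intro subset_antisym subsetI)
    fix L assume "L \<in> veronese ` proj_space"
    then show "L \<in> exceptional_divisor C3_mod_Z3"
      unfolding proj_space_def exceptional_divisor_cubics by (auto simp: veronese_pt)
  next
    fix L assume "L \<in> exceptional_divisor C3_mod_Z3"
    then obtain u where u: "L = proj_pt (cubics u)" "u \<noteq> 0" unfolding exceptional_divisor_cubics by blast
    then have "L = veronese (proj_pt u)" "proj_pt u \<in> proj_space" unfolding proj_space_def veronese_pt by blast+
    then show "L \<in> veronese ` proj_space" by (rule image_eqI)
  qed
qed

lemma exceptional_divisor_iso_P2:
  "proj_isomorphic (exceptional_divisor C3_mod_Z3) (proj_space :: (complex^3) set set)"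
  unfolding proj_isomorphic_def
proof (intro exI conjI)
  let ?E = "exceptional_divisor C3_mod_Z3" and ?f = "inv_into proj_space veronese"
  note bij = veronese_bij
  show "bij_betw ?f ?E proj_space" by (rule bij_betw_inv_into[OF bij])
  have inv: "inv_into ?E ?f L = veronese L" if "L \<in> proj_space" for L
    by (rule inv_into_inv_into_eq[OF bij that])
  have f_pt: "?f (proj_pt (cubics w)) = proj_pt w" if "w \<noteq> 0" for w
  proof -
    have "proj_pt w \<in> proj_space" unfolding proj_space_def using that by blast
    then show ?thesis
      unfolding veronese_pt[symmetric] using bij by (intro inv_into_f_f) (auto simp: bij_betw_def)
  qed
  show "proj_regular ?E ?f"
    unfolding proj_regular_def
  proof
    fix L assume "L \<in> ?E"
    then obtain u where u: "L = proj_pt (cubics u)" "u \<noteq> 0" unfolding exceptional_divisor_cubics by blast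
    obtain i where i: "u$i \<noteq> 0" using u(2) by (auto simp: vec_eq_iff)
    \<comment> \<open>A local inverse of the Veronese map: the entries \<open>(i,i,j)\<close> of
      \<open>cubics w\<close> are \<open>w$j\<close> times the common factor
      \<open>w$i * w$i\<close>, so linear forms suffice where coordinate \<open>i\<close> is
      nonzero.\<close>
    define G :: "complex^(3 \<times> 3 \<times> 3) \<Rightarrow> complex^3" where "G v = (\<chi> j. v$(i,i,j))" for v
    have Gc: "G (c *s cubics w) = (c * w$i * w$i) *s w" for c w
      by (simp add: G_def vec_eq_iff cubics_nth mult_ac)
    show "\<exists>d G. (\<forall>i. (\<lambda>x. G x $ i) \<in> hom_polys d) \<and> (\<exists>x\<in>L. G x \<noteq> 0) \<and>
        (\<forall>M\<in>?E. \<forall>x\<in>M. G x \<noteq> 0 \<longrightarrow> ?f M = proj_pt (G x))"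
    proof (rule exI[of _ 1], rule exI[of _ G], intro conjI allI ballI impI)
      show "(\<lambda>x. G x $ j) \<in> hom_polys 1" for j
        unfolding hom_polys_def G_def using polys_nth by simp
      show "\<exists>x\<in>L. G x \<noteq> 0"
        using Gc[of 1 u] i u self_in_proj_pt by (intro bexI[of _ "cubics u"]) auto
      fix M x assume "M \<in> ?E" "x \<in> M" and nz: "G x \<noteq> 0"
      then obtain w c where w: "M = proj_pt (cubics w)" "w \<noteq> 0" "x = c *s cubics w"
        unfolding exceptional_divisor_cubics proj_pt_eq by blast
      have "c * w$i * w$i \<noteq> 0" using nz unfolding w(3) Gc by auto
      then show "?f M = proj_pt (G x)" unfolding w(1,3) Gc f_pt[OF w(2)] by (rule proj_pt_scale[symmetric])
    qed
  qed
  show "proj_regular proj_space (inv_into ?E ?f)"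
    unfolding proj_regular_def
  proof
    fix L :: "(complex^3) set" assume "L \<in> proj_space"
    then obtain u where u: "L = proj_pt u" "u \<noteq> 0" unfolding proj_space_def by blast
    show "\<exists>d G. (\<forall>i. (\<lambda>x. G x $ i) \<in> hom_polys d) \<and> (\<exists>x\<in>L. G x \<noteq> 0) \<and>
        (\<forall>M\<in>proj_space. \<forall>x\<in>M. G x \<noteq> 0 \<longrightarrow> inv_into ?E ?f M = proj_pt (G x))"
    proof (rule exI[of _ 3], rule exI[of _ cubics], intro conjI allI ballI impI)
      show "(\<lambda>x. cubics x $ m) \<in> hom_polys 3" for m
        unfolding hom_polys_def using cubics_polys by (simp add: cubics_scale)
      show "\<exists>x\<in>L. cubics x \<noteq> 0"
        using u self_in_proj_pt cubics_eq_0_iff by blast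
      fix M :: "(complex^3) set" and x assume M: "M \<in> proj_space" "x \<in> M" and nz: "cubics x \<noteq> 0"
      then obtain w where "M = proj_pt w" unfolding proj_space_def by blast
      then have "M = proj_pt x" using proj_pt_unique M(2) nz cubics_eq_0_iff by blast
      then show "inv_into ?E ?f M = proj_pt (cubics x)" using inv[OF M(1)] by (simp add: veronese_pt)
    qed
  qed
qed

section \<open>Uniqueness\<close>

lemma (in simple_latke) isomorphic_L3: "latke_isomorphic scale br (*s) L3"
proof -
  obtain x y z u c where c: "c \<noteq> 0" and sp: "span {x, y, z, u} = UNIV"
    and ind: "\<forall>a b d g. a \<cdot> x + b \<cdot> y + d \<cdot> z + g \<cdot> u = 0 \<longrightarrow> a = 0 \<and> b = 0 \<and> d = 0 \<and> g = 0"
    and B: "br x y z = c \<cdot> z" "br x y u = - (c \<cdot> u)" "br z u x = - x" "br z u y = y"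
    using exists_standard_basis by (elim exE conjE)
  let ?s = "1 / complex_of_real (sqrt 2)"
  \<comment> \<open>\<open>p\<close> and \<open>q\<close> are eigenvectors of
    \<open>L3.ad L3_X L3_Y\<close>, scaled so that \<open>p\<close>, \<open>q\<close>,
    \<open>L3_X\<close>, \<open>L3_Y\<close> have the multiplication table of \<open>x\<close>,
    \<open>y\<close>, \<open>z\<close>, \<open>u\<close> with the same \<open>c\<close>.\<close>
  define p where "p = L3_H1 - L3_H2"
  define q where "q = (c / 2) *s (L3_H1 + L3_H2)"
  \<comment> \<open>\<open>g\<close> starts from the coordinate space, where coordinates in the
    basis \<open>p\<close>, \<open>q\<close>, \<open>L3_X\<close>, \<open>L3_Y\<close> are explicit;
    the isomorphism sought is its inverse.\<close>
  define g where "g w = ((\<i> * w$2 - w$3) / 2) \<cdot> x + ((\<i> * w$2 + w$3) / c) \<cdot> y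
      + (?s * (w$1 - \<i> * w$4)) \<cdot> z + (?s * (w$1 + \<i> * w$4)) \<cdot> u" for w :: "complex^4"
  have add: "g (v + w) = g v + g w" for v w
    by (simp add: g_def add_divide_distrib diff_divide_distrib scale_left_distrib scale_left_diff_distrib ring_distribs)
  have sc: "g (r *s w) = r \<cdot> g w" for r w
    by (simp add: g_def scale_right_distrib algebra_simps)
  have neg: "g (- w) = - g w" for w using sc[of "- 1" w] by (simp only: vector_sneg_minus1[symmetric]) simp
  have gb: "g p = x" "g q = y" "g L3_X = z" "g L3_Y = u"
    using c by (simp_all add: g_def p_def q_def L3_HXY_nth sqrt2_sq field_simps)
  have L: "L3 p q L3_X = c *s L3_X" "L3 p q L3_Y = - (c *s L3_Y)" "L3 L3_X L3_Y p = - p" "L3 L3_X L3_Y q = q"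
    by (simp_all add: vec4_eq_iff L3_nth minor3_def p_def q_def L3_HXY_nth sqrt2_sq field_simps)
  let ?S = "{p, q, L3_X, L3_Y}"
  have spS: "vec.span ?S = UNIV"
  proof -
    have "w \<in> vec.span ?S" for w
    proof -
      have "w = ((\<i> * w$2 - w$3) / 2) *s p + ((\<i> * w$2 + w$3) / c) *s q
          + (?s * (w$1 - \<i> * w$4)) *s L3_X + (?s * (w$1 + \<i> * w$4)) *s L3_Y"
        using c by (simp add: vec4_eq_iff p_def q_def L3_HXY_nth sqrt2_sq field_simps)
      moreover have "\<dots> \<in> vec.span ?S" by (intro vec.span_add vec.span_scale vec.span_base) auto
      ultimately show ?thesis by (simp only:)
    qed
    then show ?thesis by auto
  qed
  note perms = br_perms[OF B(1)] br_perms[OF B(2)] br_perms[OF B(3)] br_perms[OF B(4)]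
  note permsL = L3.br_perms[OF L(1)] L3.br_perms[OF L(2)] L3.br_perms[OF L(3)] L3.br_perms[OF L(4)]
  have g0: "g 0 = 0" using sc[of 0 0] by simp
  have hom0: "g (L3 a b d) = br (g a) (g b) (g d)" if "a \<in> ?S" "b \<in> ?S" "d \<in> ?S" for a b d
    using that by (elim insertE emptyE; hypsubst) (simp_all add: gb g0 B L perms permsL neg sc)
  have LL: "L3 (r *s a + a') b d = r *s L3 a b d + L3 a' b d" "L3 b (r *s a + a') d = r *s L3 b a d + L3 b a' d"
    "L3 b d (r *s a + a') = r *s L3 b d a + L3 b d a'" "L3 0 b d = 0" "L3 b 0 d = 0" "L3 b d 0 = 0" for r a a' b d
    by (simp_all add: vec4_eq_iff L3_nth minor3_def algebra_simps)
  have hom1: "g (L3 a b d) = br (g a) (g b) (g d)" if "a \<in> ?S" "b \<in> ?S" "d \<in> vec.span ?S" for a b d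
    using that(3) by (induction rule: vec.span_induct_alt) (simp_all add: LL g0 add sc br_simps hom0[OF that(1,2)])
  have hom2: "g (L3 a b d) = br (g a) (g b) (g d)" if "a \<in> ?S" "b \<in> vec.span ?S" for a b d
    using that(2) by (induction rule: vec.span_induct_alt) (simp_all add: LL g0 add sc br_simps hom1[OF that(1)] spS)
  have hom3: "g (L3 a b d) = br (g a) (g b) (g d)" if "a \<in> vec.span ?S" for a b d
    using that by (induction rule: vec.span_induct_alt) (simp_all add: LL g0 add sc br_simps hom2 spS)
  then have hom: "g (L3 a b d) = br (g a) (g b) (g d)" for a b d unfolding spS by simp
  have inj: "inj g"
  proof (rule injI)
    fix v w assume "g v = g w"
    define d where "d = v + - w"
    have "g d = 0" unfolding d_def add neg using \<open>g v = g w\<close> by simp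
    then have z: "(\<i> * d$2 - d$3) / 2 = 0" "(\<i> * d$2 + d$3) / c = 0"
        "?s * (d$1 - \<i> * d$4) = 0" "?s * (d$1 + \<i> * d$4) = 0"
      unfolding g_def using ind by blast+
    have dbl: "a = 0 \<and> b = 0" if "r * (a - b) = 0" "s * (a + b) = 0" "r \<noteq> 0" "s \<noteq> 0" for a b r s :: complex
    proof -
      have "a = b" "a = - b" using that by (simp_all add: eq_neg_iff_add_eq_0)
      then show ?thesis by simp
    qed
    have "\<i> * d$2 = 0 \<and> d$3 = 0" using c z(1,2) by (intro dbl[of "1 / 2" _ _ "1 / c"]) simp_all
    moreover have "d$1 = 0 \<and> \<i> * d$4 = 0" by (rule dbl[OF z(3,4)]) simp_all
    ultimately have "d = 0" unfolding vec4_eq_iff by simp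
    then show "v = w" by (simp add: d_def)
  qed
  have "span {x, y, z, u} \<subseteq> range g"
  proof (rule span_minimal)
    show "{x, y, z, u} \<subseteq> range g" using gb by (metis empty_subsetI insert_subset rangeI)
    show "subspace (range g)"
      by (rule subspaceI) (use g0 add sc in \<open>metis rangeI, metis (no_types, lifting) image_iff rangeI, metis (no_types, lifting) image_iff rangeI\<close>)
  qed
  then have surj: "surj g" using sp by auto
  let ?f = "inv g"
  have gf: "g (?f v) = v" for v by (rule surj_f_inv_f[OF surj])
  have fg: "?f (g w) = w" for w by (rule inv_f_f[OF inj])
  have "Vector_Spaces.linear scale (*s) ?f"
    unfolding Vector_Spaces.linear_iff
  proof (intro conjI allI vector_space_axioms vec.vector_space_axioms)
    show "?f (v + w) = ?f v + ?f w" for v w using fg[of "?f v + ?f w"] by (simp add: add gf)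
    show "?f (r \<cdot> v) = r *s ?f v" for r v using fg[of "r *s ?f v"] by (simp add: sc gf)
  qed
  moreover have "bij ?f" using inj surj bij_imp_bij_inv bij_def by blast
  moreover have "?f (br a b d) = L3 (?f a) (?f b) (?f d)" for a b d
    using fg[of "L3 (?f a) (?f b) (?f d)"] by (simp add: hom gf)
  ultimately show ?thesis unfolding latke_isomorphic_def by blast
qed

theorem theorem4p1:
  fixes scale :: "complex \<Rightarrow> 'a::ab_group_add \<Rightarrow> 'a"
    and br :: "'a \<Rightarrow> 'a \<Rightarrow> 'a \<Rightarrow> 'a"
    and \<epsilon> :: complex
  assumes \<epsilon>: "\<epsilon> ^ 3 = 1" "\<epsilon> \<noteq> 1"
  shows
    \<comment> \<open>existence and uniqueness\<close>
    "latke (*s) L3 \<and> latke.simple (*s) L3 \<and>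
     ((\<exists>B. finite_dimensional_vector_space scale B) \<and> latke scale br \<and> latke.simple scale br
        \<longrightarrow> latke_isomorphic scale br (*s) L3) \<and>
     vec.dim (UNIV :: (complex^4) set) = 4 \<and>
     \<comment> \<open>the two bases\<close>
     vec.independent {L3_e 1, L3_e 2, L3_e 3, L3_e 4} \<and>
     vec.span {L3_e 1, L3_e 2, L3_e 3, L3_e 4} = UNIV \<and>
     card {L3_e 1, L3_e 2, L3_e 3, L3_e 4} = 4 \<and>
     L3 (L3_e 1) (L3_e 2) (L3_e 3) = - L3_e 4 \<and> L3 (L3_e 1) (L3_e 2) (L3_e 4) = L3_e 3 \<and>
     L3 (L3_e 1) (L3_e 3) (L3_e 4) = - L3_e 2 \<and> L3 (L3_e 2) (L3_e 3) (L3_e 4) = L3_e 1 \<and>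
     vec.independent {L3_H1, L3_H2, L3_X, L3_Y} \<and> vec.span {L3_H1, L3_H2, L3_X, L3_Y} = UNIV \<and>
     card {L3_H1, L3_H2, L3_X, L3_Y} = 4 \<and>
     L3 L3_H1 L3_H2 L3_X = L3_X \<and> L3 L3_H1 L3_H2 L3_Y = - L3_Y \<and>
     L3 L3_H1 L3_X L3_Y = L3_H2 \<and> L3 L3_H2 L3_X L3_Y = L3_H1 \<and>
     \<comment> \<open>its Lie algebra\<close>
     lie_isomorphic op_scale (latke.inner_derivations (*s) L3) op_comm mat_scale so4 mat_comm \<and>
     lie_isomorphic mat_scale so4 mat_comm pair_scale (sl2 \<times> sl2) pair_comm \<and>
     \<comment> \<open>its Dynkin diagram\<close>
     (\<exists>\<hh>. latke.cartan_subalgebra (*s) L3 \<hh>) \<and>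
     (\<forall>\<hh>. latke.cartan_subalgebra (*s) L3 \<hh> \<longrightarrow>
        (\<exists>l. latke.direction (*s) L3 \<hh> l) \<and>
        (\<forall>l. latke.direction (*s) L3 \<hh> l \<longrightarrow> card (latke.dynkin_nodes (*s) L3 \<hh> l) = 1)) \<and>
     \<comment> \<open>the singularity and the correspondence with the Dynkin diagram\<close>
     quotient_map_by \<epsilon> cubics \<and>
     irreducible_components (exceptional_divisor C3_mod_Z3) = {exceptional_divisor C3_mod_Z3} \<and>
     proj_isomorphic (exceptional_divisor C3_mod_Z3) (proj_space :: (complex^3) set set) \<and>
     (\<forall>\<hh> l. latke.cartan_subalgebra (*s) L3 \<hh> \<and> latke.direction (*s) L3 \<hh> l \<longrightarrow>
        (\<exists>\<phi>. bij_betw \<phi> (irreducible_components (exceptional_divisor C3_mod_Z3))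
                         (latke.dynkin_nodes (*s) L3 \<hh> l)))"
proof (intro conjI allI impI)
  assume hyp: "(\<exists>B. finite_dimensional_vector_space scale B) \<and> latke scale br \<and> latke.simple scale br"
  then obtain B where B: "finite_dimensional_vector_space scale B" by blast
  interpret S: simple_latke scale br B
    by (intro simple_latke.intro fd_latke.intro fd_space.intro simple_latke_axioms.intro) (use hyp B in simp_all)
  show "latke_isomorphic scale br (*s) L3" by (rule S.isomorphic_L3)
next
  show "\<exists>\<hh>. L3.cartan_subalgebra \<hh>" using cartan_exists by blast
  show "\<exists>l. L3.direction \<hh> l" if "L3.cartan_subalgebra \<hh>" for \<hh> by (rule direction_exists[OF that])
  show "card (L3.dynkin_nodes \<hh> l) = 1" if "L3.cartan_subalgebra \<hh>" "L3.direction \<hh> l" for \<hh> l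
    by (rule one_node[OF that])
  fix \<hh> l assume "L3.cartan_subalgebra \<hh> \<and> L3.direction \<hh> l"
  then obtain \<beta> where "L3.dynkin_nodes \<hh> l = {\<beta>}" using one_node card_1_singletonE by metis
  then show "\<exists>\<phi>. bij_betw \<phi> (irreducible_components (exceptional_divisor C3_mod_Z3)) (L3.dynkin_nodes \<hh> l)"
    unfolding components_exceptional_divisor by (intro exI[of _ "\<lambda>_. \<beta>"]) (simp add: bij_betw_def)
qed (use latke_L3 L3_simple span_e span_HXY spanning_basis4[OF span_e] spanning_basis4[OF span_HXY] L3_e_brackets
    L3_HXY_brackets inner_derivations_iso_so4 so4_iso_sl2_sl2 quotient_map_cubics[OF \<epsilon>] components_exceptional_divisor
    exceptional_divisor_iso_P2 vec_dim_card[where 'n = 4 and 'a = complex] in \<open>simp_all del: vec.dim_UNIV\<close>)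

end
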